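(* Let $(J,\xi)$ be a Markov additive process on $E\times\mathbb{R}$ ($E$ finite, $J$ irreducible, $\xi_0=0$) with matrix exponent $F$, let $Y_t=\exp(\xi_t)$, let $T>0$ and let $r\in\mathbb{R}$ be the interest rate. For $\alpha\in E$ and $k>0$ let $C_\alpha(k)=e^{-rT}\mathbb{E}_\alpha[(Y_T-k)^+]$ and $P_\alpha(k)=e^{-rT}\mathbb{E}_\alpha[(k-Y_T)^+]$ be the European call and put prices with strike $k$ and time to maturity $T$. If $\mathbb{E}[Y_T^{1+s}]<\infty$ for some $s>0$, then for all $\alpha\in E$ and $u\in\mathbb{C}$ with $\mathrm{Re}(u)\in(0,s)$, $$\int_0^\infty k^{u-1}C_\alpha(k)\,dk=\frac{e^{-rT}}{u(u+1)}\sum_{\beta\in E}\big(e^{TF(u+1)}\big)_{\alpha,\beta}.$$ If $\mathbb{E}[Y_T^{-s}]<\infty$ for some $s>0$, then for all $\alpha\in E$ and $u\in\mathbb{C}$ with $\mathrm{Re}(u)\in(-s,-1)$, $$\int_0^\infty k^{u-1}P_\alpha(k)\,dk=\frac{e^{-rT}}{u(u+1)}\sum_{\beta\in E}\big(e^{TF(u+1)}\big)_{\alpha,\beta}.$$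
   Context: Let $E$ be a finite set. A càdlàg process $(J_t,\xi_t)_{t\ge0}$ in $E\times\mathbb{R}$ adapted to $(\mathcal{F}_t)$ is a Markov additive process (MAP) if for all bounded continuous $f:E\times\mathbb{R}\to\mathbb{R}^+$ and $s,t>0$, $\mathbb{E}[f(J_{t+s},\xi_{t+s}-\xi_t)\mid\mathcal{F}_t]=\mathbb{E}_{J_t,0}[f(J_s,\xi_s)]$, where $\mathbb{E}_{\alpha,x}$ is expectation given $(J_0,\xi_0)=(\alpha,x)$; $\mathbb{E}_\alpha:=\mathbb{E}_{\alpha,0}$, and $\mathbb{E}$ is expectation with $\xi_0=0$ and an arbitrary fixed initial law of $J_0$. $J$ is an irreducible continuous-time Markov chain with rates $q_{\alpha,\beta}$ ($\alpha\neq\beta$), $q_\alpha=\sum_{\beta\ne\alpha}q_{\alpha,\beta}$; while $J$ is in state $\alpha$, $\xi$ evolves as an independent copy of a Lévy process $\xi^{(\alpha)}$; when $J$ jumps from $\alpha$ to $\beta$, $\xi$ makes an additional independent jump distributed as $U_{\alpha,\beta}$ (with $U_{\alpha,\beta}=0$ if $q_{\alpha,\beta}=0$). The matrix exponent $F(z)\in\mathbb{C}^{E\times E}$ has entries $F(z)_{\alpha,\alpha}=\psi_\alpha(z)-q_\alpha$, $F(z)_{\alpha,\beta}=q_{\alpha,\beta}G_{\alpha,\beta}(z)$ ($\alpha\ne\beta$), with $\psi_\alpha(z)=\log\mathbb{E}[e^{z\xi_1^{(\alpha)}}]$ (the Laplace exponent, so $\mathbb{E}[e^{z\xi^{(\alpha)}_t}]=e^{t\psi_\alpha(z)}$)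 and $G_{\alpha,\beta}(z)=\mathbb{E}[e^{zU_{\alpha,\beta}}]$; it satisfies $\mathbb{E}_\alpha[e^{z\xi_t};J_t=\beta]=(e^{tF(z)})_{\alpha,\beta}$. *)

theory Defs
  imports "HOL-Probability.Probability"
begin

section \<open>Processes\<close>

text \<open>Time is \<^typ>\<open>real\<close>, and only times \<open>t \<ge> 0\<close> matter. The topology is a parameter because the
  state space \<open>E \<times> \<real>\<close> carries the discrete topology on \<open>E\<close>, which is not a type class instance
  for a type that is merely finite.\<close>

definition cadlag :: "'a topology \<Rightarrow> (real \<Rightarrow> 'a) \<Rightarrow> bool" where
  "cadlag S f \<longleftrightarrow>
     (\<forall>t\<ge>0. limitin S f (f t) (at_right t)) \<and>
     (\<forall>t>0. \<exists>l. limitin S f l (at_left t))"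

definition process_path :: "(real \<Rightarrow> 'w \<Rightarrow> 'a) \<Rightarrow> 'w \<Rightarrow> real \<Rightarrow> 'a" where
  "process_path X \<omega> = (\<lambda>t\<in>{0..}. X t \<omega>)"

definition process_law :: "'w measure \<Rightarrow> 'a measure \<Rightarrow> (real \<Rightarrow> 'w \<Rightarrow> 'a) \<Rightarrow> (real \<Rightarrow> 'a) measure" where
  "process_law M S X = distr M (\<Pi>\<^sub>M t\<in>{0..}. S) (process_path X)"

definition process_sigma :: "'w measure \<Rightarrow> 'a measure \<Rightarrow> (real \<Rightarrow> 'w \<Rightarrow> 'a) \<Rightarrow> 'w set set" where
  "process_sigma M S X = sets (vimage_algebra (space M) (process_path X) (\<Pi>\<^sub>M t\<in>{0..}. S))"

definition levy_process :: "'w measure \<Rightarrow> (real \<Rightarrow> 'w \<Rightarrow> real) \<Rightarrow> bool" where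
  "levy_process M X \<longleftrightarrow>
     prob_space M \<and>
     (\<forall>t\<ge>0. X t \<in> borel_measurable M) \<and>
     (AE \<omega> in M. X 0 \<omega> = 0) \<and>
     (\<forall>s\<ge>0. \<forall>t\<ge>0. distr M borel (\<lambda>\<omega>. X (s + t) \<omega> - X s \<omega>) = distr M borel (X t)) \<and>
     (\<forall>(\<tau> :: nat \<Rightarrow> real) n. 0 \<le> \<tau> 0 \<longrightarrow> mono \<tau> \<longrightarrow>
        prob_space.indep_vars M (\<lambda>_. borel) (\<lambda>i \<omega>. X (\<tau> (Suc i)) \<omega> - X (\<tau> i) \<omega>) {..<n}) \<and>
     (AE \<omega> in M. cadlag euclidean (\<lambda>t. X t \<omega>))"


section \<open>Markov additive processes\<close>

text \<open>The measure \<open>P \<alpha>\<close> is the law on the underlying space under which \<open>(J, \<xi>)\<close> starts from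
  \<open>(\<alpha>, 0)\<close>, so that integration with respect to \<open>P \<alpha>\<close> is \<open>\<EE>\<^sub>\<alpha>\<close>.\<close>

locale markov_additive_process =
  fixes M :: "'w measure"
    and P :: "'e::finite \<Rightarrow> 'w measure"
    and \<F> :: "real \<Rightarrow> 'w measure"
    and J :: "real \<Rightarrow> 'w \<Rightarrow> 'e"
    and \<xi> :: "real \<Rightarrow> 'w \<Rightarrow> real"
  assumes prob: "prob_space (P \<alpha>)"
    and sets_P: "sets (P \<alpha>) = sets M"
    and filtration: "filtration (space M) \<F>"
    and subalgebra: "0 \<le> t \<Longrightarrow> subalgebra M (\<F> t)"
    and adapted: "0 \<le> t \<Longrightarrow> (\<lambda>\<omega>. (J t \<omega>, \<xi> t \<omega>)) \<in> \<F> t \<rightarrow>\<^sub>M count_space UNIV \<Otimes>\<^sub>M borel"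
    and cadlag: "AE \<omega> in P \<alpha>.
       cadlag (prod_topology (discrete_topology UNIV) euclidean) (\<lambda>t. (J t \<omega>, \<xi> t \<omega>))"
    and start: "AE \<omega> in P \<alpha>. J 0 \<omega> = \<alpha> \<and> \<xi> 0 \<omega> = 0"
    and markov_additive:
      "\<lbrakk>continuous_map (prod_topology (discrete_topology UNIV) euclidean) euclidean f;
        bounded (range f); \<And>y. 0 \<le> f y; 0 < s; 0 < t\<rbrakk> \<Longrightarrow>
       AE \<omega> in P \<alpha>.
         real_cond_exp (P \<alpha>) (\<F> t) (\<lambda>\<omega>. f (J (t + s) \<omega>, \<xi> (t + s) \<omega> - \<xi> t \<omega>)) \<omega> =
         (\<integral>\<omega>'. f (J s \<omega>', \<xi> s \<omega>') \<partial>P (J t \<omega>))"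

text \<open>A Markov chain in the filtration \<open>\<F>\<close> whose transition function has the off-diagonal
  derivatives \<open>q \<alpha> \<beta>\<close> at time 0. The diagonal of \<open>q\<close> is never used.\<close>

definition ctmc_with_rates ::
  "('e::finite \<Rightarrow> 'w measure) \<Rightarrow> (real \<Rightarrow> 'w measure) \<Rightarrow> (real \<Rightarrow> 'w \<Rightarrow> 'e) \<Rightarrow>
   ('e \<Rightarrow> 'e \<Rightarrow> real) \<Rightarrow> bool" where
  "ctmc_with_rates P \<F> J q \<longleftrightarrow>
     (\<forall>\<alpha> \<beta> s t. 0 < s \<longrightarrow> 0 < t \<longrightarrow>
        (AE \<omega> in P \<alpha>.
          real_cond_exp (P \<alpha>) (\<F> t) (\<lambda>\<omega>. of_bool (J (t + s) \<omega> = \<beta>)) \<omega> =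
          measure (P (J t \<omega>)) {\<omega>' \<in> space (P (J t \<omega>)). J s \<omega>' = \<beta>})) \<and>
     (\<forall>\<alpha> \<beta>. \<alpha> \<noteq> \<beta> \<longrightarrow>
        ((\<lambda>h. measure (P \<alpha>) {\<omega> \<in> space (P \<alpha>). J h \<omega> = \<beta>} / h) \<longlongrightarrow> q \<alpha> \<beta>) (at_right 0))"

definition irreducible_rates :: "('e \<Rightarrow> 'e \<Rightarrow> real) \<Rightarrow> bool" where
  "irreducible_rates q \<longleftrightarrow> (\<forall>\<alpha> \<beta>. (\<alpha>, \<beta>) \<in> {(a, b). a \<noteq> b \<and> 0 < q a b}\<^sup>*)"

text \<open>The \<open>n\<close>-th jump time of a path, which is \<open>\<infinity>\<close> if there are fewer than \<open>n\<close> jumps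
  (the infimum of the empty set in \<^typ>\<open>ereal\<close>).\<close>

primrec jump_time :: "(real \<Rightarrow> 'e) \<Rightarrow> nat \<Rightarrow> ereal" where
  "jump_time j 0 = 0"
| "jump_time j (Suc n) =
     Inf (ereal ` {t. jump_time j n < ereal t \<and> j t \<noteq> j (real_of_ereal (jump_time j n))})"

definition jump_count :: "(real \<Rightarrow> 'e) \<Rightarrow> real \<Rightarrow> nat" where
  "jump_count j t = card {n. 0 < n \<and> jump_time j n \<le> ereal t}"

text \<open>Given a path \<open>j\<close> of the chain, paths \<open>x \<beta> k\<close> of copies of the Levy processes and values
  \<open>v \<beta> \<gamma> k\<close> of copies of the jump variables, this is the value at time \<open>t\<close> of the additive
  component: during the \<open>k\<close>-th sojourn, spent in state \<open>\<beta>\<close>, it moves along \<open>x \<beta> k\<close>, and at the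
  end of that sojourn it makes the additional jump \<open>v \<beta> \<gamma> k\<close>, where \<open>\<gamma>\<close> is the next state.\<close>

definition additive_path ::
  "(real \<Rightarrow> 'e) \<Rightarrow> ('e \<Rightarrow> nat \<Rightarrow> real \<Rightarrow> real) \<Rightarrow> ('e \<Rightarrow> 'e \<Rightarrow> nat \<Rightarrow> real) \<Rightarrow> real \<Rightarrow> real" where
  "additive_path j x v t =
     (let \<tau> = (\<lambda>k. real_of_ereal (jump_time j k));
          n = jump_count j t
      in (\<Sum>k<n. x (j (\<tau> k)) k (\<tau> (Suc k) - \<tau> k) + v (j (\<tau> k)) (j (\<tau> (Suc k))) k)
         + x (j (\<tau> n)) n (t - \<tau> n))"

datatype 'e component = Chain | Levy 'e nat | Jump 'e 'e nat

text \<open>The chain \<open>J\<close>, the copies of the Levy processes \<open>L \<beta>\<close> and the copies of the jumps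
  \<open>U \<beta> \<gamma>\<close> (the originals live on \<open>B\<close>) are jointly independent and generate \<open>\<xi>\<close>. The space
  carrying \<open>J\<close> and \<open>\<xi>\<close> need not be rich enough to support the copies, so they are defined on
  extensions \<open>N \<alpha>\<close> of the spaces \<open>P \<alpha>\<close>, with projection \<open>\<pi>\<close>; the case of no extension
  is \<open>N = P\<close>, \<open>\<pi> = id\<close>. Jumps \<open>V \<beta> \<beta> n\<close> are never used. That a copy has the same law as \<open>L \<beta>\<close> on the product space
  does not by itself make its paths cadlag, so \<^term>\<open>levy_process\<close> is required in addition.\<close>

definition map_decomposition ::
  "('e::finite \<Rightarrow> 'w measure) \<Rightarrow> (real \<Rightarrow> 'w \<Rightarrow> 'e) \<Rightarrow> (real \<Rightarrow> 'w \<Rightarrow> real) \<Rightarrow>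
   'b measure \<Rightarrow> ('e \<Rightarrow> real \<Rightarrow> 'b \<Rightarrow> real) \<Rightarrow> ('e \<Rightarrow> 'e \<Rightarrow> 'b \<Rightarrow> real) \<Rightarrow>
   ('e \<Rightarrow> 'v measure) \<Rightarrow> ('v \<Rightarrow> 'w) \<Rightarrow> bool" where
  "map_decomposition P J \<xi> B L U N \<pi> \<longleftrightarrow>
     (\<forall>\<alpha>. prob_space (N \<alpha>) \<and> \<pi> \<in> N \<alpha> \<rightarrow>\<^sub>M P \<alpha> \<and> distr (N \<alpha>) (P \<alpha>) \<pi> = P \<alpha> \<and>
       (\<exists>(X :: 'e \<Rightarrow> nat \<Rightarrow> real \<Rightarrow> 'v \<Rightarrow> real) (V :: 'e \<Rightarrow> 'e \<Rightarrow> nat \<Rightarrow> 'v \<Rightarrow> real).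
          (\<forall>\<beta> n. levy_process (N \<alpha>) (X \<beta> n) \<and>
                 process_law (N \<alpha>) borel (X \<beta> n) = process_law B borel (L \<beta>)) \<and>
          (\<forall>\<beta> \<gamma> n. V \<beta> \<gamma> n \<in> borel_measurable (N \<alpha>) \<and>
                 (\<beta> \<noteq> \<gamma> \<longrightarrow>
                    distr (N \<alpha>) borel (V \<beta> \<gamma> n) = distr B borel (U \<beta> \<gamma>))) \<and>
          prob_space.indep_sets (N \<alpha>)
            (\<lambda>c. case c of
                Chain \<Rightarrow> process_sigma (N \<alpha>) (count_space UNIV) (\<lambda>t \<eta>. J t (\<pi> \<eta>))
              | Levy \<beta> n \<Rightarrow> process_sigma (N \<alpha>) borel (X \<beta> n)
              | Jump \<beta> \<gamma> n \<Rightarrow> sets (vimage_algebra (space (N \<alpha>)) (V \<beta> \<gamma> n) borel)) UNIV \<and>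
          (AE \<eta> in N \<alpha>. \<forall>t\<ge>0.
             \<xi> t (\<pi> \<eta>) = additive_path (\<lambda>s. J s (\<pi> \<eta>)) (\<lambda>\<beta> n s. X \<beta> n s \<eta>) (\<lambda>\<beta> \<gamma> n. V \<beta> \<gamma> n \<eta>) t)))"


section \<open>The matrix exponent\<close>

definition moment_gf :: "'w measure \<Rightarrow> ('w \<Rightarrow> real) \<Rightarrow> complex \<Rightarrow> complex" where
  "moment_gf M X z = (\<integral>\<omega>. exp (z * complex_of_real (X \<omega>)) \<partial>M)"

text \<open>The logarithm of \<open>\<EE>[exp (z X\<^sub>1)]\<close> in the definition of the Laplace exponent is not the
  principal branch: it is the one determined uniquely by \<open>\<EE>[exp (z X\<^sub>t)] = exp (t \<psi>(z))\<close> at all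
  times \<open>t\<close>.\<close>

definition laplace_exponent :: "'w measure \<Rightarrow> (real \<Rightarrow> 'w \<Rightarrow> real) \<Rightarrow> complex \<Rightarrow> complex" where
  "laplace_exponent M X z = (THE w. \<forall>t\<ge>0. moment_gf M (X t) z = exp (complex_of_real t * w))"

definition matrix_exponent ::
  "('e::finite \<Rightarrow> 'e \<Rightarrow> real) \<Rightarrow> 'b measure \<Rightarrow> ('e \<Rightarrow> real \<Rightarrow> 'b \<Rightarrow> real) \<Rightarrow>
   ('e \<Rightarrow> 'e \<Rightarrow> 'b \<Rightarrow> real) \<Rightarrow> complex \<Rightarrow> complex ^ 'e ^ 'e" where
  "matrix_exponent q B L U z =
     (\<chi> \<alpha> \<beta>. if \<alpha> = \<beta>
        then laplace_exponent B (L \<alpha>) z - complex_of_real (\<Sum>\<gamma>\<in>UNIV - {\<alpha>}. q \<alpha> \<gamma>)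
        else complex_of_real (q \<alpha> \<beta>) * moment_gf B (U \<alpha> \<beta>) z)"

text \<open>The class-based \<^const>\<open>exp\<close> is not available here, since multiplication on the vector type
  is componentwise.\<close>

definition mat_exp :: "complex ^ 'n::finite ^ 'n \<Rightarrow> complex ^ 'n ^ 'n" where
  "mat_exp A = (\<Sum>k. (((**) A) ^^ k) (mat 1) /\<^sub>R fact k)"


section \<open>Option prices\<close>

definition call_price ::
  "('e \<Rightarrow> 'w measure) \<Rightarrow> (real \<Rightarrow> 'w \<Rightarrow> real) \<Rightarrow> real \<Rightarrow> real \<Rightarrow> 'e \<Rightarrow> real \<Rightarrow> real" where
  "call_price P Y r T \<alpha> k = exp (- r * T) * (\<integral>\<omega>. max (Y T \<omega> - k) 0 \<partial>P \<alpha>)"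

definition put_price ::
  "('e \<Rightarrow> 'w measure) \<Rightarrow> (real \<Rightarrow> 'w \<Rightarrow> real) \<Rightarrow> real \<Rightarrow> real \<Rightarrow> 'e \<Rightarrow> real \<Rightarrow> real" where
  "put_price P Y r T \<alpha> k = exp (- r * T) * (\<integral>\<omega>. max (k - Y T \<omega>) 0 \<partial>P \<alpha>)"

end

theory Submission
  imports Defs
begin

text \<open>
  Put \<open>K\<^sub>t(\<alpha>, \<beta>) = \<EE>\<^sub>\<alpha>[exp (z \<xi>\<^sub>t); J\<^sub>t = \<beta>]\<close>. Two facts give the theorem.

  First, the Mellin transform in \<open>k\<close> of the payoff \<open>(y - k)\<^sup>+\<close>, respectively \<open>(k - y)\<^sup>+\<close>, is
  \<open>y\<^sup>u\<^sup>+\<^sup>1 / (u (u + 1))\<close>, so by Fubini's theorem the transform of the price is \<open>\<EE>\<^sub>\<alpha>[exp ((u + 1) \<xi>\<^sub>T)]\<close> up to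
  constants, that is, a row sum of \<open>K\<^sub>T\<close> for \<open>z = u + 1\<close> (\<open>expected_payoff_mellin\<close>).

  Secondly, \<open>K\<^sub>t = exp (t F(z))\<close> (\<open>mgf_eq_mat_exp\<close>). The Markov property makes \<open>K\<close> a matrix semigroup
  (\<open>mgf_semigroup\<close>), and a semigroup is determined by its derivative at 0 (\<open>matrix_semigroup_eq_mat_exp\<close>).
  So it remains to compute \<open>K\<^sub>h\<close> to first order in \<open>h\<close> from the decomposition of the process. Up to
  events of probability \<open>o(h)\<close> there are two cases. Either the chain does not jump up to time \<open>h\<close>; then
  \<open>\<xi>\<^sub>h\<close> is a Levy process at time \<open>h\<close>, independent of the chain, and contributes
  \<open>(1 - q\<^sub>\<alpha> h) exp (h \<psi>\<^sub>\<alpha>(z))\<close> to the diagonal (\<open>mgf_diag_derivative\<close>). Or it makes exactly one jump, from \<open>\<alpha>\<close>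
  to \<open>\<beta>\<close>; then \<open>\<xi>\<^sub>h\<close> is close to the additional jump, since both Levy processes involved stay near their start
  for a short time, and the contribution is \<open>h q\<^sub>\<alpha>\<^sub>\<beta> G\<^sub>\<alpha>\<^sub>\<beta>(z)\<close> (\<open>mgf_offdiag_derivative\<close>). The
  probabilities of these two events are bounded from below by observing the chain on fine grids, where
  the Markov property gives products of transition probabilities; since the transition rates bound
  them from above, nothing else of first order remains.

  Exponentials are unbounded, so events of probability \<open>o(h)\<close> must also be shown to carry only \<open>o(h)\<close> of
  the moment. As \<open>Re z = \<theta> p\<close> with \<open>0 \<le> \<theta> < 1\<close> for the order \<open>p\<close> of the moment that is assumed to be finite, it
  suffices that they carry \<open>O(h)\<close> of the moment of order \<open>p\<close> (\<open>exp_moment_split\<close>, \<open>tendsto_0_split\<close>). These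
  bounds come from the semigroup property and Bernoulli's inequality (\<open>real_mgf_upper_bounds\<close>). Finally,
  irreducibility carries the finiteness of the moment from the given initial law and time to all
  initial states and all times (\<open>nn_mgf_finite\<close>).
\<close>

section \<open>Piecewise constant paths\<close>

definition right_continuous_path :: "(real \<Rightarrow> 'e) \<Rightarrow> bool" where
  "right_continuous_path j \<longleftrightarrow> (\<forall>t\<ge>0. \<forall>\<^sub>F s in at_right t. j s = j t)"

text \<open>Paths are observed on the grids \<open>i h / n\<close>, \<open>i \<le> n\<close>: grid events have probabilities that the
  Markov property computes, and a right-continuous path is known from its values on fine grids.\<close>

definition grid_const :: "(real \<Rightarrow> 'e) \<Rightarrow> real \<Rightarrow> 'e \<Rightarrow> nat \<Rightarrow> bool" where
  "grid_const j h a n \<longleftrightarrow> (\<forall>i\<le>n. j (real i * (h / real n)) = a)"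

definition grid_switch :: "(real \<Rightarrow> 'e) \<Rightarrow> real \<Rightarrow> 'e \<Rightarrow> 'e \<Rightarrow> nat \<Rightarrow> bool" where
  "grid_switch j h a b n \<longleftrightarrow>
     (\<exists>k<n. \<forall>i\<le>n. j (real i * (h / real n)) = (if i \<le> k then a else b))"

definition grid_above :: "real \<Rightarrow> nat \<Rightarrow> real \<Rightarrow> nat" where
  "grid_above h n s = nat \<lceil>s * real n / h\<rceil>"

lemma grid_above_bounds:
  assumes "0 < h" "0 \<le> s" "s \<le> h" "0 < n"
  shows "grid_above h n s \<le> n" "s \<le> real (grid_above h n s) * (h / real n)"
    "real (grid_above h n s) * (h / real n) < s + h / real n"
proof -
  have nn: "0 \<le> s * real n / h" using assms by simp
  have "s * real n / h \<le> real n" using assms by (simp add: field_simps)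
  then show "grid_above h n s \<le> n" unfolding grid_above_def by (simp add: ceiling_le_iff nat_le_iff)
  have eq: "real (grid_above h n s) = of_int \<lceil>s * real n / h\<rceil>"
    unfolding grid_above_def using nn
    by (smt (verit, best) ceiling_less_zero le_of_int_ceiling of_nat_nat zero_le_ceiling)
  have "s * real n / h \<le> real (grid_above h n s)" "real (grid_above h n s) < s * real n / h + 1"
    unfolding eq by linarith+
  then show "s \<le> real (grid_above h n s) * (h / real n)"
    "real (grid_above h n s) * (h / real n) < s + h / real n"
    using assms by (auto simp: field_simps)
qed

lemma grid_above_mono: "0 < h \<Longrightarrow> s \<le> t \<Longrightarrow> grid_above h n s \<le> grid_above h n t"
  unfolding grid_above_def by (intro nat_mono ceiling_mono divide_right_mono mult_right_mono) auto

text \<open>Right continuity makes the grid points just above \<open>s\<close> see the value at \<open>s\<close>.\<close>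

lemma eventually_grid_above:
  assumes "right_continuous_path j" "0 < h" "0 \<le> s" "s \<le> h"
  shows "\<forall>\<^sub>F n in sequentially. j (real (grid_above h n s) * (h / real n)) = j s"
proof -
  obtain e where e: "s < e" "\<And>t. s < t \<Longrightarrow> t < e \<Longrightarrow> j t = j s"
    using assms(1,3) unfolding right_continuous_path_def eventually_at_right_field by auto
  have "(\<lambda>n. h / real n) \<longlonglongrightarrow> 0" by (rule lim_const_over_n)
  then have "\<forall>\<^sub>F n in sequentially. h / real n < e - s"
    by (rule order_tendstoD) (use e in auto)
  with eventually_gt_at_top[of 0] show ?thesis
  proof eventually_elim
    case (elim n)
    note b = grid_above_bounds[OF assms(2-4) elim(1)]
    show ?case
    proof (cases "real (grid_above h n s) * (h / real n) = s")
      case True then show ?thesis by simp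
    next
      case False
      with b elim show ?thesis by (intro e(2)) linarith+
    qed
  qed
qed

text \<open>It is enough to see the path on infinitely many of the grids, which makes the two statements that
  follow fit for limits superior of events.\<close>

lemma frequently_grid_const_imp:
  assumes "right_continuous_path j" "0 < h" "\<exists>\<^sub>F n in sequentially. grid_const j h a n" "0 \<le> s" "s \<le> h"
  shows "j s = a"
proof -
  have "\<exists>\<^sub>F n in sequentially. grid_const j h a n \<and> j (real (grid_above h n s) * (h / real n)) = j s \<and> 0 < n"
    using frequently_eventually_frequently[OF assms(3) eventually_conj[OF
        eventually_grid_above[OF assms(1,2,4,5)] eventually_gt_at_top[of 0]]] .
  then obtain n where "grid_const j h a n" "j (real (grid_above h n s) * (h / real n)) = j s" "0 < n"
    using frequently_ex by blast
  with grid_above_bounds(1)[OF assms(2,4,5), of n] show ?thesis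
    unfolding grid_const_def by metis
qed

lemma frequently_grid_switch_imp:
  assumes rc: "right_continuous_path j" and h: "0 < h" and ab: "a \<noteq> b"
    and sw: "\<exists>\<^sub>F n in sequentially. grid_switch j h a b n"
  obtains \<sigma> where "0 < \<sigma>" "\<sigma> \<le> h" "\<And>s. 0 \<le> s \<Longrightarrow> s < \<sigma> \<Longrightarrow> j s = a"
    "\<And>s. \<sigma> \<le> s \<Longrightarrow> s \<le> h \<Longrightarrow> j s = b"
proof -
  \<comment> \<open>Two times at once can be compared on one sufficiently fine grid.\<close>
  have two: "j s \<in> {a, b} \<and> (s \<le> t \<longrightarrow> j s = b \<longrightarrow> j t = b)"
    if st: "0 \<le> s" "s \<le> h" "0 \<le> t" "t \<le> h" for s t
  proof -
    have "\<exists>\<^sub>F n in sequentially. grid_switch j h a b n \<and>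
        (j (real (grid_above h n s) * (h / real n)) = j s \<and>
         j (real (grid_above h n t) * (h / real n)) = j t) \<and> 0 < n"
      using frequently_eventually_frequently[OF sw eventually_conj[OF eventually_conj[OF
          eventually_grid_above[OF rc h st(1,2)] eventually_grid_above[OF rc h st(3,4)]]
          eventually_gt_at_top[of 0]]] .
    then obtain n k where n: "k < n" "\<And>i. i \<le> n \<Longrightarrow> j (real i * (h / real n)) = (if i \<le> k then a else b)"
      "j (real (grid_above h n s) * (h / real n)) = j s" "j (real (grid_above h n t) * (h / real n)) = j t"
      "0 < n"
      unfolding grid_switch_def using frequently_ex by blast
    have "j s = (if grid_above h n s \<le> k then a else b)"
      using n(2)[OF grid_above_bounds(1)[OF h st(1,2) n(5)]] n(3) by simp
    moreover have "j t = (if grid_above h n t \<le> k then a else b)"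
      using n(2)[OF grid_above_bounds(1)[OF h st(3,4) n(5)]] n(4) by simp
    moreover have "s \<le> t \<Longrightarrow> grid_above h n s \<le> grid_above h n t"
      by (rule grid_above_mono[OF h])
    ultimately show ?thesis using ab by (auto split: if_splits)
  qed
  have "\<exists>\<^sub>F n in sequentially. grid_switch j h a b n \<and> (0::nat) < n"
    using frequently_eventually_frequently[OF sw eventually_gt_at_top[of 0]] .
  then obtain n k where n: "k < n" "0 < n"
      "\<And>i. i \<le> n \<Longrightarrow> j (real i * (h / real n)) = (if i \<le> k then a else b)"
    unfolding grid_switch_def using frequently_ex by blast
  have j0: "j 0 = a" using n(3)[of 0] by simp
  have jh: "j h = b" using n(3)[of n] n(1,2) by simp
  define S where "S = {s. 0 \<le> s \<and> s \<le> h \<and> j s = b}"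
  define \<sigma> where "\<sigma> = Inf S"
  have hS: "h \<in> S" using h jh by (auto simp: S_def)
  have bdd: "bdd_below S" by (rule bdd_belowI[of _ 0]) (auto simp: S_def)
  have \<sigma>0: "0 \<le> \<sigma>" unfolding \<sigma>_def using hS by (intro cInf_greatest) (auto simp: S_def)
  have \<sigma>h: "\<sigma> \<le> h" unfolding \<sigma>_def by (rule cInf_lower[OF hS bdd])
  have before: "j s = a" if "0 \<le> s" "s < \<sigma>" for s
  proof -
    have "s \<notin> S" using cInf_lower[OF _ bdd, of s] that(2) unfolding \<sigma>_def by force
    then show ?thesis using two[of s s] that \<sigma>h unfolding S_def by auto
  qed
  have after: "j s = b" if "\<sigma> < s" "s \<le> h" for s
  proof -
    have "\<exists>t\<in>S. t < s" using that(1) hS unfolding \<sigma>_def by (intro cInf_lessD) auto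
    then obtain t where "t \<in> S" "t < s" by blast
    then show ?thesis using two[of t s] that by (auto simp: S_def)
  qed
  have at: "j \<sigma> = b"
  proof (cases "\<sigma> = h")
    case True then show ?thesis using jh by simp
  next
    case False
    obtain e where e: "\<sigma> < e" "\<And>t. \<sigma> < t \<Longrightarrow> t < e \<Longrightarrow> j t = j \<sigma>"
      using rc \<sigma>0 unfolding right_continuous_path_def eventually_at_right_field by auto
    define t where "t = (\<sigma> + min e h) / 2"
    have "\<sigma> < t" "t < e" "t \<le> h" using e(1) False \<sigma>h by (auto simp: t_def min_def field_simps)
    then show ?thesis using e(2)[of t] after[of t] by simp
  qed
  have "0 < \<sigma>" using \<sigma>0 at j0 ab by (cases "\<sigma> = 0") auto
  then show ?thesis
    using \<sigma>h before after at by (intro that[of \<sigma>]) (auto simp: le_less)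
qed

lemma jump_time_Suc_ge: "jump_time j n \<le> jump_time j (Suc n)"
  unfolding jump_time.simps by (rule Inf_greatest) (auto simp: less_imp_le)

lemma jump_time_mono: "m \<le> n \<Longrightarrow> jump_time j m \<le> jump_time j n"
  by (rule lift_Suc_mono_le) (rule jump_time_Suc_ge)

lemma jump_time_Suc_gt:
  assumes rc: "right_continuous_path j" and n: "jump_time j n = ereal \<sigma>" and \<sigma>: "0 \<le> \<sigma>" "\<sigma> \<le> h"
    and const: "\<And>s. \<sigma> \<le> s \<Longrightarrow> s \<le> h \<Longrightarrow> j s = j \<sigma>"
  shows "ereal h < jump_time j (Suc n)"
proof -
  obtain e where e: "h < e" "\<And>t. h < t \<Longrightarrow> t < e \<Longrightarrow> j t = j h"
    using rc \<sigma> unfolding right_continuous_path_def eventually_at_right_field by (meson order_trans)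
  have "ereal e \<le> jump_time j (Suc n)"
    unfolding jump_time.simps
  proof (rule Inf_greatest, clarsimp simp: n)
    fix t assume t: "\<sigma> < t" "j t \<noteq> j \<sigma>"
    show "e \<le> t"
    proof (rule ccontr)
      assume "\<not> e \<le> t"
      then have "j t = j \<sigma>"
        using const[of t] const[of h] e(2)[of t] t \<sigma> by (cases "t \<le> h") auto
      with t show False by simp
    qed
  qed
  with e(1) show ?thesis by (metis ereal_less_eq(3) less_le_trans linorder_not_less)
qed

text \<open>On the paths that matter for first-order asymptotics, those with at most one jump of the chain, the
  additive component has a simple form. Right continuity at \<open>h\<close> is what excludes a further jump at
  time \<open>h\<close> itself.\<close>

lemma additive_path_const:
  assumes "right_continuous_path j" "0 < h" "\<And>s. 0 \<le> s \<Longrightarrow> s \<le> h \<Longrightarrow> j s = a"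
  shows "additive_path j x v h = x a 0 h"
proof -
  have gt: "ereal h < jump_time j (Suc 0)"
    by (rule jump_time_Suc_gt[OF assms(1), of 0 0]) (use assms in \<open>auto simp: zero_ereal_def\<close>)
  have "{n. 0 < n \<and> jump_time j n \<le> ereal h} = {}"
  proof safe
    fix n assume n: "0 < n" "jump_time j n \<le> ereal h"
    have "jump_time j (Suc 0) \<le> jump_time j n" by (rule jump_time_mono) (use n in simp)
    with gt n(2) show "n \<in> {}" by (meson leD order_trans)
  qed
  then have "jump_count j h = 0" by (simp only: jump_count_def card.empty)
  then show ?thesis using assms unfolding additive_path_def by (simp add: Let_def)
qed

lemma additive_path_switch:
  assumes rc: "right_continuous_path j" and ab: "a \<noteq> b" and \<sigma>: "0 < \<sigma>" "\<sigma> \<le> h"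
    and before: "\<And>s. 0 \<le> s \<Longrightarrow> s < \<sigma> \<Longrightarrow> j s = a"
    and after: "\<And>s. \<sigma> \<le> s \<Longrightarrow> s \<le> h \<Longrightarrow> j s = b"
  shows "additive_path j x v h = x a 0 \<sigma> + v a b 0 + x b 1 (h - \<sigma>)"
proof -
  have j0: "j 0 = a" and js: "j \<sigma> = b" using before[of 0] after[of \<sigma>] \<sigma> by auto
  have t1: "jump_time j (Suc 0) = ereal \<sigma>"
  proof (rule antisym)
    show "jump_time j (Suc 0) \<le> ereal \<sigma>"
      using j0 js ab \<sigma> by (auto intro!: Inf_lower)
    show "ereal \<sigma> \<le> jump_time j (Suc 0)"
      unfolding jump_time.simps
    proof (rule Inf_greatest, clarsimp simp: zero_ereal_def)
      fix t assume "0 < t" "j t \<noteq> j 0"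
      then show "\<sigma> \<le> t" using before[of t] j0 by (cases "t < \<sigma>") auto
    qed
  qed
  have gt: "ereal h < jump_time j (Suc (Suc 0))"
    by (rule jump_time_Suc_gt[OF rc t1]) (use \<sigma> after js in auto)
  have "{n. 0 < n \<and> jump_time j n \<le> ereal h} = {Suc 0}"
  proof safe
    fix n assume n: "0 < n" "jump_time j n \<le> ereal h"
    have "\<not> Suc (Suc 0) \<le> n" using gt n(2) jump_time_mono[of "Suc (Suc 0)" n j] by (meson leD order_trans)
    then show "n = Suc 0" using n(1) by simp
  qed (use t1 \<sigma> in auto)
  then have "jump_count j h = Suc 0" by (simp add: jump_count_def)
  then show ?thesis using j0 js t1 unfolding additive_path_def by (simp add: Let_def del: jump_time.simps(2))
qed

section \<open>One-parameter semigroups\<close>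

lemma tendsto_eventually_eq:
  "(f \<longlongrightarrow> l) F \<Longrightarrow> \<forall>\<^sub>F x in F. f x = g x \<Longrightarrow> l = l' \<Longrightarrow> (g \<longlongrightarrow> l') F"
  by (auto intro: Lim_transform_eventually)

lemma has_vector_derivative_iff_quotient:
  fixes f :: "real \<Rightarrow> 'a::real_normed_vector"
  shows "(f has_vector_derivative D) (at x within S) \<longleftrightarrow>
    ((\<lambda>y. (f y - f x) /\<^sub>R (y - x)) \<longlongrightarrow> D) (at x within S)"
proof -
  have "(f has_vector_derivative D) (at x within S) \<longleftrightarrow>
     ((\<lambda>y. norm (f y - f x - (y - x) *\<^sub>R D) / norm (y - x)) \<longlongrightarrow> 0) (at x within S)"
    unfolding has_vector_derivative_def has_derivative_iff_norm
    by (simp add: bounded_linear_scaleR_left)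
  also have "\<dots> \<longleftrightarrow> ((\<lambda>y. norm ((f y - f x) /\<^sub>R (y - x) - D)) \<longlongrightarrow> 0) (at x within S)"
  proof (rule filterlim_cong[OF refl refl])
    show "\<forall>\<^sub>F y in at x within S. norm (f y - f x - (y - x) *\<^sub>R D) / norm (y - x) =
        norm ((f y - f x) /\<^sub>R (y - x) - D)"
      unfolding eventually_at_filter
    proof (intro always_eventually allI impI)
      fix y assume "y \<noteq> x"
      then have "(f y - f x) /\<^sub>R (y - x) - D = (f y - f x - (y - x) *\<^sub>R D) /\<^sub>R (y - x)"
        by (simp add: scaleR_diff_right)
      then show "norm (f y - f x - (y - x) *\<^sub>R D) / norm (y - x) =
        norm ((f y - f x) /\<^sub>R (y - x) - D)" by (simp add: divide_inverse)
    qed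
  qed
  also have "\<dots> \<longleftrightarrow> ((\<lambda>y. (f y - f x) /\<^sub>R (y - x)) \<longlongrightarrow> D) (at x within S)"
    by (simp add: tendsto_norm_zero_iff LIM_zero_iff)
  finally show ?thesis .
qed

lemma tendsto_at_within_Ici:
  fixes f :: "real \<Rightarrow> 'a::topological_space"
  assumes r: "((\<lambda>h. f (t + h)) \<longlongrightarrow> l) (at_right 0)"
    and l: "0 < t \<Longrightarrow> ((\<lambda>h. f (t - h)) \<longlongrightarrow> l) (at_right 0)" and t: "0 \<le> t"
  shows "(f \<longlongrightarrow> l) (at t within {0..})"
proof -
  have 1: "(f \<longlongrightarrow> l) (at_right t)"
    using r unfolding filterlim_at_right_to_0[of f _ t] by (simp add: add.commute)
  show ?thesis
  proof (cases "t = 0")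
    case True then show ?thesis using 1 by (simp add: at_within_Ici_at_right)
  next
    case False
    then have "((\<lambda>h. f (t - h)) \<longlongrightarrow> l) (at_right 0)" using l t by simp
    then have "(f \<longlongrightarrow> l) (at_left t)"
      unfolding filterlim_at_left_to_right[of f _ t] filterlim_at_right_to_0[of _ _ "-t"]
      by (simp add: algebra_simps)
    with 1 have "(f \<longlongrightarrow> l) (at t)" by (rule filterlim_split_at[rotated])
    then show ?thesis by (rule tendsto_within_subset) simp
  qed
qed

text \<open>A multiplicative function with a primitive is itself differentiable:
  \<open>f t * (\<integral>\<^sub>0\<^sup>\<delta> f)\<close> is the increment of the primitive over \<open>[t, t + \<delta>]\<close>, and
  \<open>\<integral>\<^sub>0\<^sup>\<delta> f \<noteq> 0\<close> for small \<open>\<delta>\<close>.\<close>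

lemma continuous_multiplicative_imp_exp:
  fixes f :: "real \<Rightarrow> complex"
  assumes mult: "\<And>s t. 0 \<le> s \<Longrightarrow> 0 \<le> t \<Longrightarrow> f (s + t) = f s * f t"
    and f0: "f 0 = 1" and lim: "(f \<longlongrightarrow> 1) (at_right 0)"
  shows "\<exists>w. \<forall>t\<ge>0. f t = exp (of_real t * w)"
proof -
  have cont: "continuous_on {0..} f"
    unfolding continuous_on_def
  proof (rule ballI)
    fix t :: real assume "t \<in> {0..}"
    then have t: "0 \<le> t" by simp
    show "(f \<longlongrightarrow> f t) (at t within {0..})"
    proof (rule tendsto_at_within_Ici[OF _ _ t])
      have "((\<lambda>h. f t * f h) \<longlongrightarrow> f t * 1) (at_right 0)" by (intro tendsto_intros lim)
      then show "((\<lambda>h. f (t + h)) \<longlongrightarrow> f t) (at_right 0)"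
        by (rule tendsto_eventually_eq)
           (auto simp: eventually_at_filter mult t)
    next
      assume t': "0 < t"
      have ne: "\<forall>\<^sub>F h in at_right 0. f h \<noteq> 0" by (rule tendsto_imp_eventually_ne[OF lim]) simp
      have lt: "\<forall>\<^sub>F h in at_right 0. h < t \<and> 0 < h"
        using t' by (auto simp: eventually_at_right_field)
      have "((\<lambda>h. f t / f h) \<longlongrightarrow> f t / 1) (at_right 0)" by (intro tendsto_intros lim) simp
      moreover have "\<forall>\<^sub>F h in at_right 0. f t / f h = f (t - h)"
        using ne lt
      proof eventually_elim
        case (elim h)
        then have "f t = f (t - h) * f h" using mult[of "t - h" h] by simp
        with elim show ?case by simp
      qed
      ultimately show "((\<lambda>h. f (t - h)) \<longlongrightarrow> f t) (at_right 0)"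
        by (auto intro: Lim_transform_eventually)
    qed
  qed
  have cont_ab: "continuous_on {a..b} f" if "0 \<le> a" for a b
    by (rule continuous_on_subset[OF cont]) (use that in auto)
  define I where "I = (\<lambda>t. integral {0..t} f)"
  have I: "(I has_vector_derivative f x) (at x within {0..})" if "0 \<le> x" for x
  proof -
    have "(I has_vector_derivative f x) (at x within {0..x+1})"
      unfolding I_def by (rule integral_has_vector_derivative) (use that cont_ab in auto)
    moreover have "at x within {0..x+1} = at x within {0..}"
      by (rule at_within_nhd[of x "{..<x+1}"]) (use that in auto)
    ultimately show ?thesis by simp
  qed
  obtain \<delta> where \<delta>: "0 < \<delta>" and c0: "I \<delta> \<noteq> 0"
  proof -
    have "((\<lambda>y. (I y - I 0) /\<^sub>R (y - 0)) \<longlongrightarrow> 1) (at_right 0)"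
      using I[of 0] f0 unfolding has_vector_derivative_iff_quotient by (simp add: at_within_Ici_at_right)
    then have "\<forall>\<^sub>F y in at_right 0. (I y - I 0) /\<^sub>R (y - 0) \<noteq> 0"
      by (rule tendsto_imp_eventually_ne) simp
    moreover have "\<forall>\<^sub>F y::real in at_right 0. 0 < y" by (auto simp: eventually_at_right_field intro: exI[of _ 1])
    ultimately have "\<forall>\<^sub>F y in at_right 0. 0 < y \<and> I y \<noteq> 0"
      by eventually_elim (auto simp: I_def)
    from eventually_happens[OF this] obtain y where "0 < y" "I y \<noteq> 0" by auto
    then show ?thesis by (rule that)
  qed
  have key: "f t * I \<delta> = I (t + \<delta>) - I t" if t: "0 \<le> t" for t
  proof -
    have "I (t + \<delta>) - I t = integral {t..t+\<delta>} f"
      unfolding I_def using Henstock_Kurzweil_Integration.integral_combine[of 0 t "t + \<delta>" f] t \<delta>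
        integrable_continuous_real[OF cont_ab[of 0 "t+\<delta>"]] by (simp add: algebra_simps)
    also have "\<dots> = integral {0..\<delta>} (\<lambda>s. f (s + t))"
      using integral_shift_cbox_plus[where f=f and c=t and a=0 and b=\<delta>]
      by (simp add: add.commute o_def)
    also have "\<dots> = integral {0..\<delta>} (\<lambda>s. f t * f s)"
      by (rule integral_cong) (use t mult in \<open>auto simp: add.commute\<close>)
    also have "\<dots> = f t * I \<delta>" by (simp add: I_def)
    finally show ?thesis by simp
  qed
  define w where "w = (f \<delta> - 1) / I \<delta>"
  have deriv: "(f has_vector_derivative f t * w) (at t within {0..})" if t: "0 \<le> t" for t
  proof -
    have "((I \<circ> (\<lambda>t. t + \<delta>)) has_vector_derivative (1 *\<^sub>R f (t + \<delta>))) (at t within {0..})"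
    proof (rule vector_diff_chain_within)
      show "((\<lambda>t. t + \<delta>) has_vector_derivative 1) (at t within {0..})"
        by (auto intro!: derivative_eq_intros)
      show "(I has_vector_derivative f (t + \<delta>)) (at (t + \<delta>) within (\<lambda>t. t + \<delta>) ` {0..})"
        by (rule has_vector_derivative_within_subset[OF I]) (use t \<delta> in auto)
    qed
    then have "((\<lambda>t. (I (t + \<delta>) - I t) / I \<delta>) has_vector_derivative ((f (t + \<delta>) - f t) / I \<delta>)) (at t within {0..})"
      using I[OF t] by (intro has_vector_derivative_divide has_vector_derivative_diff) (auto simp: o_def)
    moreover have "(f (t + \<delta>) - f t) / I \<delta> = f t * w"
      using mult[of t \<delta>] t \<delta> by (simp add: w_def field_simps)
    ultimately have "((\<lambda>t. (I (t + \<delta>) - I t) / I \<delta>) has_vector_derivative (f t * w)) (at t within {0..})"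
      by simp
    then show ?thesis
      by (rule has_vector_derivative_transform[rotated 2]) (use t key c0 in \<open>auto simp: field_simps\<close>)
  qed
  have "\<exists>c. \<forall>t\<in>{0..}. f t * exp (- (of_real t * w)) = c"
  proof (rule has_vector_derivative_zero_constant[of "{0::real..}" "\<lambda>t. f t * exp (- (of_real t * w))"])
    fix t :: real assume "t \<in> {0..}"
    have "((\<lambda>z. exp (- (z * w))) has_field_derivative (- w * exp (- (of_real t * w)))) (at (of_real t))"
      by (auto intro!: derivative_eq_intros)
    then have "((\<lambda>t. exp (- (of_real t * w))) has_vector_derivative (- w * exp (- (of_real t * w)))) (at t within {0..})"
      by (rule has_vector_derivative_real_field)
    from has_vector_derivative_mult[OF deriv this] \<open>t \<in> {0..}\<close>
    show "((\<lambda>t. f t * exp (- (of_real t * w))) has_vector_derivative 0) (at t within {0..})"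
      by (simp add: algebra_simps)
  qed auto
  then obtain c where c: "\<And>t. 0 \<le> t \<Longrightarrow> f t * exp (- (of_real t * w)) = c" by auto
  have "f t = exp (of_real t * w)" if "0 \<le> t" for t
    using c[OF that] c[of 0] f0 by (simp add: exp_minus field_simps)
  then show ?thesis by blast
qed

subsection \<open>Matrix semigroups\<close>

lemma sum_mat_1_right: "(\<Sum>c\<in>UNIV. (A :: complex ^ 'n::finite ^ 'm) $ a $ c * mat 1 $ c $ b) = A $ a $ b"
proof -
  have "(A ** mat 1) $ a $ b = A $ a $ b" by simp
  then show ?thesis unfolding matrix_matrix_mult_def by simp
qed

lemma sum_mat_1_left: "(\<Sum>c\<in>UNIV. mat 1 $ a $ c * (A :: complex ^ 'm::finite ^ 'n::finite) $ c $ b) = A $ a $ b"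
proof -
  have "(mat 1 ** A) $ a $ b = A $ a $ b" by simp
  then show ?thesis unfolding matrix_matrix_mult_def by simp
qed

lemma matrix_power_component_Suc:
  "(((**) A) ^^ Suc k) (mat 1) $ a $ b = (\<Sum>c\<in>UNIV. A $ a $ c * (((**) A) ^^ k) (mat 1) $ c $ b)"
  by (simp add: matrix_matrix_mult_def)

lemma matrix_power_scaleR:
  fixes A :: "complex ^ 'n::finite ^ 'n"
  shows "(((**) (t *\<^sub>R A)) ^^ k) (mat 1) = t ^ k *\<^sub>R (((**) A) ^^ k) (mat 1)"
proof (induction k)
  case (Suc k)
  have "(((**) (t *\<^sub>R A)) ^^ Suc k) (mat 1) = (t *\<^sub>R A) ** (t ^ k *\<^sub>R (((**) A) ^^ k) (mat 1))"
    using Suc by simp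
  also have "\<dots> = t ^ Suc k *\<^sub>R (A ** (((**) A) ^^ k) (mat 1))"
    by (simp add: matrix_matrix_mult_def vec_eq_iff scaleR_sum_right mult_ac)
  finally show ?case by simp
qed simp

lemma norm_matrix_power_component_le:
  fixes A :: "complex ^ 'n::finite ^ 'n"
  shows "norm ((((**) A) ^^ k) (mat 1) $ a $ b) \<le> (\<Sum>a\<in>UNIV. \<Sum>b\<in>UNIV. norm (A $ a $ b)) ^ k"
proof (induction k arbitrary: a b)
  case 0 then show ?case by (simp add: mat_def)
next
  case (Suc k)
  let ?C = "(\<Sum>a\<in>UNIV. \<Sum>b\<in>UNIV. norm (A $ a $ b))"
  have C0: "0 \<le> ?C" by (intro sum_nonneg) auto
  have "norm ((((**) A) ^^ Suc k) (mat 1) $ a $ b) \<le>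
      (\<Sum>c\<in>UNIV. norm (A $ a $ c) * norm ((((**) A) ^^ k) (mat 1) $ c $ b))"
    unfolding matrix_power_component_Suc by (rule order_trans[OF norm_sum]) (simp add: norm_mult)
  also have "\<dots> \<le> (\<Sum>c\<in>UNIV. norm (A $ a $ c) * ?C ^ k)"
    by (intro sum_mono mult_left_mono Suc) auto
  also have "\<dots> = (\<Sum>c\<in>UNIV. norm (A $ a $ c)) * ?C ^ k" by (simp add: sum_distrib_right)
  also have "\<dots> \<le> ?C * ?C ^ k"
    using C0 by (intro mult_right_mono member_le_sum[of a UNIV "\<lambda>a. \<Sum>b\<in>UNIV. norm (A $ a $ b)"])
       (auto intro: sum_nonneg)
  finally show ?case by simp
qed

text \<open>An entry of the matrix exponential as a power series in a complex variable, so that it can be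
  differentiated term by term.\<close>

definition mat_exp_entry :: "complex ^ 'n::finite ^ 'n \<Rightarrow> 'n \<Rightarrow> 'n \<Rightarrow> complex \<Rightarrow> complex" where
  "mat_exp_entry A a b x = (\<Sum>k. ((((**) A) ^^ k) (mat 1) $ a $ b / fact k) * x ^ k)"

lemma summable_mat_exp_entry:
  fixes A :: "complex ^ 'n::finite ^ 'n"
  shows "summable (\<lambda>k. ((((**) A) ^^ k) (mat 1) $ a $ b / fact k) * x ^ k)"
proof (rule summable_comparison_test[OF exI, OF allI, OF impI])
  let ?C = "(\<Sum>a\<in>UNIV. \<Sum>b\<in>UNIV. norm (A $ a $ b))"
  show "summable (\<lambda>k. (?C * norm x) ^ k /\<^sub>R fact k)" by (rule summable_exp_generic)
  fix k
  show "norm (((((**) A) ^^ k) (mat 1) $ a $ b / fact k) * x ^ k) \<le> (?C * norm x) ^ k /\<^sub>R fact k"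
    using mult_right_mono[OF norm_matrix_power_component_le[where A=A and k=k and a=a and b=b], of "norm x ^ k / fact k"]
    by (simp add: norm_mult norm_divide norm_power power_mult_distrib field_simps)
qed

lemma mat_exp_scaleR_component: "mat_exp (t *\<^sub>R A) $ a $ b = mat_exp_entry A a b (of_real t)"
proof -
  let ?S = "\<lambda>k. (((**) (t *\<^sub>R A)) ^^ k) (mat 1) /\<^sub>R fact k"
  have "?S sums (\<chi> a b. mat_exp_entry A a b (of_real t))"
    unfolding sums_def
  proof (intro vec_tendstoI)
    fix a b
    have "(\<lambda>k. ((((**) A) ^^ k) (mat 1) $ a $ b / fact k) * of_real t ^ k) sums
       mat_exp_entry A a b (of_real t)"
      unfolding mat_exp_entry_def by (rule summable_sums[OF summable_mat_exp_entry])
    then have "(\<lambda>n. \<Sum>k<n. ((((**) A) ^^ k) (mat 1) $ a $ b / fact k) * of_real t ^ k)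
        \<longlonglongrightarrow> mat_exp_entry A a b (of_real t)" unfolding sums_def .
    moreover have "(sum ?S {..<n}) $ a $ b =
        (\<Sum>k<n. ((((**) A) ^^ k) (mat 1) $ a $ b / fact k) * of_real t ^ k)" for n
      by (simp add: matrix_power_scaleR) (simp add: scaleR_conv_of_real field_simps)
    ultimately show "(\<lambda>n. (sum ?S {..<n}) $ a $ b) \<longlonglongrightarrow> (\<chi> a b. mat_exp_entry A a b (of_real t)) $ a $ b"
      by simp
  qed
  then have "mat_exp (t *\<^sub>R A) = (\<chi> a b. mat_exp_entry A a b (of_real t))"
    unfolding mat_exp_def by (rule sums_unique[symmetric])
  then show ?thesis by simp
qed

lemma mat_exp_entry_0: "mat_exp_entry A a b 0 = mat 1 $ a $ b"
  unfolding mat_exp_entry_def by (simp add: powser_zero[of "\<lambda>k. (((**) A) ^^ k) (mat 1) $ a $ b / fact k", simplified])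

lemma mat_exp_entry_has_vector_derivative:
  "((\<lambda>s. mat_exp_entry A a b (of_real s)) has_vector_derivative
      (\<Sum>c\<in>UNIV. A $ a $ c * mat_exp_entry A c b (of_real s))) (at s within S)"
proof (rule has_vector_derivative_real_field)
  let ?c = "\<lambda>a b k. (((**) A) ^^ k) (mat 1) $ a $ b / fact k"
  have "((\<lambda>x. \<Sum>k. ?c a b k * x ^ k) has_field_derivative (\<Sum>k. diffs (?c a b) k * (of_real s) ^ k)) (at (of_real s))"
    by (rule termdiffs_strong_converges_everywhere) (rule summable_mat_exp_entry)
  moreover have "diffs (?c a b) k * (of_real s) ^ k = (\<Sum>c\<in>UNIV. A $ a $ c * (?c c b k * of_real s ^ k))" for k
  proof -
    have "diffs (?c a b) k = (((**) A) ^^ Suc k) (mat 1) $ a $ b / fact k"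
      unfolding diffs_def by (simp add: field_simps del: of_nat_Suc)
    then show ?thesis unfolding matrix_power_component_Suc
      by (simp add: sum_distrib_right sum_divide_distrib mult.assoc)
  qed
  moreover have "(\<Sum>k. \<Sum>c\<in>UNIV. A $ a $ c * (?c c b k * of_real s ^ k)) =
      (\<Sum>c\<in>UNIV. A $ a $ c * (\<Sum>k. ?c c b k * of_real s ^ k))"
    by (subst suminf_sum) (intro summable_mult summable_mat_exp_entry sum.cong refl suminf_mult)+
  ultimately show "((\<lambda>x. mat_exp_entry A a b x) has_field_derivative
      (\<Sum>c\<in>UNIV. A $ a $ c * mat_exp_entry A c b (of_real s))) (at (of_real s))"
    unfolding mat_exp_entry_def by simp
qed

text \<open>The generator determines the semigroup: \<open>K (t - s) ** exp (s F)\<close> does not depend on \<open>s\<close>.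
  That \<open>K\<close> is differentiable also from the left needs a bound of \<open>K\<close> on compact intervals,
  which follows from the bound near 0.\<close>

theorem matrix_semigroup_eq_mat_exp:
  fixes K :: "real \<Rightarrow> complex ^ 'n::finite ^ 'n"
  assumes mult: "\<And>s t. 0 \<le> s \<Longrightarrow> 0 \<le> t \<Longrightarrow> K (s + t) = K s ** K t" and K0: "K 0 = mat 1"
    and gen: "\<And>a b. ((\<lambda>h. (K h $ a $ b - mat 1 $ a $ b) /\<^sub>R h) \<longlongrightarrow> F $ a $ b) (at_right 0)"
    and t: "0 \<le> t"
  shows "K t = mat_exp (t *\<^sub>R F)"
proof -
  define N where "N = (\<lambda>A :: complex ^ 'n ^ 'n. \<Sum>a\<in>UNIV. \<Sum>b\<in>UNIV. norm (A $ a $ b))"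
  have N_mult: "N (A ** B) \<le> N A * N B" for A B
  proof -
    have "N (A ** B) \<le> (\<Sum>a\<in>UNIV. \<Sum>b\<in>UNIV. \<Sum>c\<in>UNIV. norm (A $ a $ c) * norm (B $ c $ b))"
      unfolding N_def matrix_matrix_mult_def
      by (intro sum_mono) (auto intro!: order_trans[OF norm_sum] simp: norm_mult)
    also have "\<dots> = (\<Sum>a\<in>UNIV. \<Sum>c\<in>UNIV. norm (A $ a $ c) * (\<Sum>b\<in>UNIV. norm (B $ c $ b)))"
      by (subst sum.swap) (simp add: sum_distrib_left)
    also have "\<dots> \<le> (\<Sum>a\<in>UNIV. \<Sum>c\<in>UNIV. norm (A $ a $ c) * N B)"
      unfolding N_def
      by (intro sum_mono mult_left_mono member_le_sum[of _ UNIV "\<lambda>c. \<Sum>b\<in>UNIV. norm (B $ c $ b)"])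
         (auto intro: sum_nonneg)
    finally show ?thesis by (simp add: N_def sum_distrib_right)
  qed
  have N_entry: "norm (A $ a $ b) \<le> N A" for A a b
  proof -
    have "norm (A $ a $ b) \<le> (\<Sum>b\<in>UNIV. norm (A $ a $ b))" by (rule member_le_sum) auto
    also have "\<dots> \<le> N A" unfolding N_def
      by (rule member_le_sum[of a UNIV "\<lambda>a. \<Sum>b\<in>UNIV. norm (A $ a $ b)"]) (auto intro: sum_nonneg)
    finally show ?thesis .
  qed
  have N0: "0 \<le> N A" for A unfolding N_def by (intro sum_nonneg) auto
  have hpos: "\<forall>\<^sub>F h::real in at_right 0. 0 < h" by (auto simp: eventually_at_right_field intro: exI[of _ 1])
  have Klim: "((\<lambda>h. K h $ a $ b) \<longlongrightarrow> mat 1 $ a $ b) (at_right 0)" for a b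
  proof -
    have "((\<lambda>h. mat 1 $ a $ b + h *\<^sub>R ((K h $ a $ b - mat 1 $ a $ b) /\<^sub>R h)) \<longlongrightarrow>
        mat 1 $ a $ b + 0 *\<^sub>R F $ a $ b) (at_right 0)"
      by (intro tendsto_intros gen)
    then show ?thesis
      by (rule tendsto_eventually_eq)
         (use hpos in \<open>auto elim!: eventually_mono\<close>)
  qed
  obtain \<delta> C where \<delta>: "0 < \<delta>" and C1: "1 \<le> C" and C: "\<And>h. 0 \<le> h \<Longrightarrow> h \<le> \<delta> \<Longrightarrow> N (K h) \<le> C"
  proof -
    have "((\<lambda>h. N (K h)) \<longlongrightarrow> N (mat 1)) (at_right 0)"
      unfolding N_def by (intro tendsto_intros Klim)
    then have "\<forall>\<^sub>F h in at_right 0. N (K h) < N (mat 1) + 1" by (rule order_tendstoD) simp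
    then obtain d where d: "0 < d" "\<And>h. 0 < h \<Longrightarrow> h < d \<Longrightarrow> N (K h) < N (mat 1) + 1"
      by (auto simp: eventually_at_right_field)
    have "0 \<le> N (mat 1 :: complex ^ 'n ^ 'n)" unfolding N_def by (intro sum_nonneg) auto
    moreover have "N (K h) \<le> N (mat 1) + 1" if "0 \<le> h" "h \<le> d / 2" for h
      using that d K0 by (cases "h = 0") (auto intro!: less_imp_le d(2))
    ultimately show ?thesis using that[of "d / 2" "N (mat 1) + 1"] d by simp
  qed
  have bound: "N (K u) \<le> C ^ Suc m" if "0 \<le> u" "u \<le> real m * \<delta>" for u m
    using that
  proof (induction m arbitrary: u)
    case 0 then show ?case using C[of 0] C1 \<delta> by (simp add: K0)
  next
    case (Suc m)
    show ?case
    proof (cases "u \<le> \<delta>")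
      case True
      then have "N (K u) \<le> C ^ 1" using C Suc.prems by simp
      also have "\<dots> \<le> C ^ Suc (Suc m)" using C1 by (intro power_increasing) auto
      finally show ?thesis .
    next
      case False
      have "K u = K (u - \<delta>) ** K \<delta>" using mult[of "u - \<delta>" \<delta>] False \<delta> by simp
      then have "N (K u) \<le> N (K (u - \<delta>)) * N (K \<delta>)" using N_mult by simp
      also have "\<dots> \<le> C ^ Suc m * C"
        using Suc.prems False C1 \<delta> C[of \<delta>] N0
        by (intro mult_mono Suc.IH) (auto simp: algebra_simps)
      finally show ?thesis by (simp add: mult.commute)
    qed
  qed
  have deriv: "((\<lambda>u. K u $ a $ b) has_vector_derivative (\<Sum>c\<in>UNIV. K u $ a $ c * F $ c $ b)) (at u within {0..})"
    if u: "0 \<le> u" for u a b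
    unfolding has_vector_derivative_iff_quotient
  proof (rule tendsto_at_within_Ici[OF _ _ u])
    have comp: "K (s + t) $ a $ b = (\<Sum>c\<in>UNIV. K s $ a $ c * K t $ c $ b)" if "0 \<le> s" "0 \<le> t" for s t
      using mult[OF that] by (simp add: matrix_matrix_mult_def)
    have diff: "(K (s + h) $ a $ b - K s $ a $ b) /\<^sub>R h =
        (\<Sum>c\<in>UNIV. K s $ a $ c * ((K h $ c $ b - mat 1 $ c $ b) /\<^sub>R h))" if "0 \<le> s" "0 < h" for s h
    proof -
      have "K (s + h) $ a $ b - K s $ a $ b = (\<Sum>c\<in>UNIV. K s $ a $ c * (K h $ c $ b - mat 1 $ c $ b))"
        using that by (simp add: comp right_diff_distrib sum_subtractf sum_mat_1_right)
      then show ?thesis by (simp add: scaleR_sum_right)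
    qed
    have "((\<lambda>h. \<Sum>c\<in>UNIV. K u $ a $ c * ((K h $ c $ b - mat 1 $ c $ b) /\<^sub>R h)) \<longlongrightarrow>
        (\<Sum>c\<in>UNIV. K u $ a $ c * F $ c $ b)) (at_right 0)"
      by (intro tendsto_intros gen)
    then show "((\<lambda>h. (K (u + h) $ a $ b - K u $ a $ b) /\<^sub>R (u + h - u)) \<longlongrightarrow>
        (\<Sum>c\<in>UNIV. K u $ a $ c * F $ c $ b)) (at_right 0)"
      by (rule Lim_transform_eventually) (use hpos u diff in \<open>auto elim!: eventually_mono\<close>)
    assume u': "0 < u"
    have lt: "\<forall>\<^sub>F h in at_right 0. h < u \<and> 0 < h"
      using u' by (auto simp: eventually_at_right_field)
    obtain m where m: "u \<le> real m * \<delta>" using reals_Archimedean3[OF \<delta>] by (meson less_imp_le)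
    have left: "((\<lambda>h. K (u - h) $ a $ c) \<longlongrightarrow> K u $ a $ c) (at_right 0)" for c
    proof -
      have "((\<lambda>h. \<Sum>d\<in>UNIV. K (u - h) $ a $ d * (K h $ d $ c - mat 1 $ d $ c)) \<longlongrightarrow> (\<Sum>d\<in>(UNIV::'n set). 0)) (at_right 0)"
      proof (intro tendsto_sum)
        fix d
        have B: "\<forall>\<^sub>F h in at_right 0. norm (K (u - h) $ a $ d) \<le> C ^ Suc m"
          using lt by eventually_elim (rule order_trans[OF N_entry bound], use m in auto)
        have "((\<lambda>h. K h $ d $ c - mat 1 $ d $ c) \<longlongrightarrow> 0) (at_right 0)"
          using Klim by (rule LIM_zero)
        then show "((\<lambda>h. K (u - h) $ a $ d * (K h $ d $ c - mat 1 $ d $ c)) \<longlongrightarrow> 0) (at_right 0)"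
          by (rule lim_null_mult_left_bounded[OF B])
      qed
      then have "((\<lambda>h. K u $ a $ c - (\<Sum>d\<in>UNIV. K (u - h) $ a $ d * (K h $ d $ c - mat 1 $ d $ c))) \<longlongrightarrow>
          K u $ a $ c - 0) (at_right 0)"
        by (intro tendsto_intros) simp
      moreover have "\<forall>\<^sub>F h in at_right 0. K u $ a $ c - (\<Sum>d\<in>UNIV. K (u - h) $ a $ d * (K h $ d $ c - mat 1 $ d $ c))
          = K (u - h) $ a $ c"
        using lt
      proof eventually_elim
        case (elim h)
        have "K u $ a $ c = (\<Sum>d\<in>UNIV. K (u - h) $ a $ d * K h $ d $ c)"
          using mult[of "u - h" h] elim by (simp add: matrix_matrix_mult_def)
        moreover have "K (u - h) $ a $ c = (\<Sum>d\<in>UNIV. K (u - h) $ a $ d * mat 1 $ d $ c)"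
          by (simp add: sum_mat_1_right)
        ultimately show ?case by (simp add: right_diff_distrib sum_subtractf)
      qed
      ultimately show ?thesis by (auto intro: Lim_transform_eventually)
    qed
    have "((\<lambda>h. \<Sum>c\<in>UNIV. K (u - h) $ a $ c * ((K h $ c $ b - mat 1 $ c $ b) /\<^sub>R h)) \<longlongrightarrow>
        (\<Sum>c\<in>UNIV. K u $ a $ c * F $ c $ b)) (at_right 0)"
      by (intro tendsto_intros gen left)
    then show "((\<lambda>h. (K (u - h) $ a $ b - K u $ a $ b) /\<^sub>R (u - h - u)) \<longlongrightarrow>
        (\<Sum>c\<in>UNIV. K u $ a $ c * F $ c $ b)) (at_right 0)"
    proof (rule Lim_transform_eventually)
      show "\<forall>\<^sub>F h in at_right 0. (\<Sum>c\<in>UNIV. K (u - h) $ a $ c * ((K h $ c $ b - mat 1 $ c $ b) /\<^sub>R h)) =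
          (K (u - h) $ a $ b - K u $ a $ b) /\<^sub>R (u - h - u)"
        using lt
      proof eventually_elim
        case (elim h)
        have "(K (u - h) $ a $ b - K u $ a $ b) /\<^sub>R (u - h - u) = (K u $ a $ b - K (u - h) $ a $ b) /\<^sub>R h"
          by (simp add: scaleR_diff_right)
        then show ?case using diff[of "u - h" h] elim by simp
      qed
    qed
  qed
  have "K t $ a $ b = mat_exp_entry F a b (of_real t)" for a b
  proof -
    define \<phi> where "\<phi> = (\<lambda>s. \<Sum>c\<in>UNIV. K (t - s) $ a $ c * mat_exp_entry F c b (of_real s))"
    have "(\<phi> has_vector_derivative 0) (at s within {0..t})" if s: "s \<in> {0..t}" for s
    proof -
      have 1: "((\<lambda>s. K (t - s) $ a $ c) has_vector_derivative - (\<Sum>d\<in>UNIV. K (t - s) $ a $ d * F $ d $ c))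
          (at s within {0..t})" for c
      proof -
        have "(((\<lambda>u. K u $ a $ c) \<circ> (\<lambda>s. t - s)) has_vector_derivative
            ((-1) *\<^sub>R (\<Sum>d\<in>UNIV. K (t - s) $ a $ d * F $ d $ c))) (at s within {0..t})"
        proof (rule vector_diff_chain_within)
          show "((\<lambda>s. t - s) has_vector_derivative -1) (at s within {0..t})"
            using has_vector_derivative_diff[OF has_vector_derivative_const has_vector_derivative_id] by fastforce
          show "((\<lambda>u. K u $ a $ c) has_vector_derivative (\<Sum>d\<in>UNIV. K (t - s) $ a $ d * F $ d $ c))
              (at (t - s) within (\<lambda>s. t - s) ` {0..t})"
            by (rule has_vector_derivative_within_subset[OF deriv]) (use s in auto)
        qed
        then show ?thesis by (simp add: o_def)
      qed
      have "(\<phi> has_vector_derivative (\<Sum>c\<in>UNIV. K (t - s) $ a $ c * (\<Sum>d\<in>UNIV. F $ c $ d * mat_exp_entry F d b (of_real s))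
           + (- (\<Sum>d\<in>UNIV. K (t - s) $ a $ d * F $ d $ c)) * mat_exp_entry F c b (of_real s))) (at s within {0..t})"
        unfolding \<phi>_def
        by (intro has_vector_derivative_sum has_vector_derivative_mult 1 mat_exp_entry_has_vector_derivative)
      moreover have "(\<Sum>c\<in>UNIV. K (t - s) $ a $ c * (\<Sum>d\<in>UNIV. F $ c $ d * mat_exp_entry F d b (of_real s))
           + (- (\<Sum>d\<in>UNIV. K (t - s) $ a $ d * F $ d $ c)) * mat_exp_entry F c b (of_real s)) = 0"
      proof -
        have "(\<Sum>c\<in>UNIV. K (t - s) $ a $ c * (\<Sum>d\<in>UNIV. F $ c $ d * mat_exp_entry F d b (of_real s))) =
            (\<Sum>d\<in>UNIV. \<Sum>c\<in>UNIV. K (t - s) $ a $ c * F $ c $ d * mat_exp_entry F d b (of_real s))"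
          by (subst sum.swap) (simp add: sum_distrib_left mult.assoc)
        then show ?thesis by (simp add: sum_distrib_right sum_subtractf)
      qed
      ultimately show ?thesis by simp
    qed
    then obtain c where "\<And>s. s \<in> {0..t} \<Longrightarrow> \<phi> s = c"
      using has_vector_derivative_zero_constant[of "{0..t}" \<phi>] by auto
    then have "\<phi> 0 = \<phi> t" using t by simp
    moreover have "\<phi> 0 = K t $ a $ b"
      by (simp add: \<phi>_def mat_exp_entry_0 sum_mat_1_right)
    moreover have "\<phi> t = mat_exp_entry F a b (of_real t)"
      using sum_mat_1_left[of a "\<chi> c b. mat_exp_entry F c b (of_real t)" b] by (simp add: \<phi>_def K0)
    ultimately show ?thesis by simp
  qed
  then show ?thesis by (simp add: vec_eq_iff mat_exp_scaleR_component)
qed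

section \<open>The Mellin transform of a payoff\<close>

text \<open>A primitive of \<open>k \<mapsto> k\<^sup>u\<^sup>-\<^sup>1 (y - k)\<close>; it serves the call on \<open>(0, y)\<close> and, with the opposite sign, the
  put on \<open>(y, \<infinity>)\<close>.\<close>

definition payoff_primitive :: "complex \<Rightarrow> real \<Rightarrow> real \<Rightarrow> complex" where
  "payoff_primitive u y k =
     of_real y * of_real k powr u / u - of_real k powr (u + 1) / (u + 1)"

lemma payoff_primitive_has_vector_derivative:
  assumes "u \<noteq> 0" "u + 1 \<noteq> 0" "0 < k"
  shows "(payoff_primitive u y has_vector_derivative
    of_real k powr (u - 1) * of_real (y - k)) (at k within S)"
  unfolding payoff_primitive_def
proof (rule has_vector_derivative_real_field)
  have k: "complex_of_real k \<notin> \<real>\<^sub>\<le>\<^sub>0" using assms by (simp add: complex_nonpos_Reals_iff)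
  have d: "((\<lambda>z. z powr v) has_field_derivative v * of_real k powr (v - 1)) (at (complex_of_real k))" for v
    by (rule has_field_derivative_powr[OF k])
  have "of_real k powr u = of_real k powr (u - 1) * complex_of_real k"
    using assms by (simp add: powr_diff)
  then have e2: "((u + 1) * of_real k powr (u + 1 - 1)) / (u + 1) = of_real k powr (u - 1) * of_real k"
    using assms(2) by (subst nonzero_mult_div_cancel_left) simp_all
  have e1: "of_real y * (u * of_real k powr (u - 1)) / u = of_real k powr (u - 1) * of_real y"
    using assms(1) by simp
  then show "((\<lambda>z. of_real y * z powr u / u - z powr (u + 1) / (u + 1)) has_field_derivative
    of_real k powr (u - 1) * of_real (y - k)) (at (complex_of_real k))"
    using DERIV_diff[OF DERIV_cdivide[OF DERIV_cmult[OF d[of u], of "of_real y"], of u]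
        DERIV_cdivide[OF d[of "u + 1"], of "u + 1"]]
    unfolding e1 e2 by (simp add: right_diff_distrib)
qed

lemma payoff_primitive_of_real:
  "0 < k \<Longrightarrow> payoff_primitive (of_real \<sigma>) y k =
     of_real (y * k powr \<sigma> / \<sigma> - k powr (\<sigma> + 1) / (\<sigma> + 1))"
  using powr_of_real[of k \<sigma>] powr_of_real[of k "\<sigma> + 1"] by (simp add: payoff_primitive_def)

lemma payoff_primitive_diagonal:
  assumes "u \<noteq> 0" "u + 1 \<noteq> 0" "0 < y"
  shows "payoff_primitive u y y = of_real y powr (u + 1) / (u * (u + 1))"
  using assms by (simp add: payoff_primitive_def powr_add field_simps)

text \<open>The real and the complex exponent are treated together: positivity of the payoff gives
  integrability for the real part of the exponent, which dominates the complex integrand.\<close>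

lemma payoff_mellin_interval:
  fixes a b :: ereal and u :: complex and c y :: real
  assumes ab: "0 \<le> a" "a < b" and u: "Re u \<noteq> 0" "Re u + 1 \<noteq> 0"
    and sign: "\<And>k. a < ereal k \<Longrightarrow> ereal k < b \<Longrightarrow> 0 \<le> c * (y - k)"
    and lim: "\<And>v. Re v = Re u \<Longrightarrow> ((payoff_primitive v y \<circ> real_of_ereal) \<longlongrightarrow> A v) (at_right a)"
      "\<And>v. Re v = Re u \<Longrightarrow> ((payoff_primitive v y \<circ> real_of_ereal) \<longlongrightarrow> B v) (at_left b)"
  shows "set_integrable lborel (einterval a b) (\<lambda>k. k powr (Re u - 1) * (c * (y - k)))"
    and "(LINT k:einterval a b|lborel. k powr (Re u - 1) * (c * (y - k))) = c * Re (B (of_real (Re u)) - A (of_real (Re u)))"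
    and "set_integrable lborel (einterval a b) (\<lambda>k. of_real k powr (u - 1) * of_real (c * (y - k)))"
    and "(LINT k:einterval a b|lborel. of_real k powr (u - 1) * of_real (c * (y - k))) = of_real c * (B u - A u)"
proof -
  let ?\<sigma> = "Re u"
  have u0: "u \<noteq> 0" "u + 1 \<noteq> 0" using u by (auto simp: complex_eq_iff)
  have pos: "0 < k" if "a < ereal k" for k
    using ab(1) that by (metis ereal_less(2) order_le_less_trans)
  define F where "F = (\<lambda>k. c * Re (payoff_primitive (of_real ?\<sigma>) y k))"
  have deriv: "DERIV F k :> k powr (?\<sigma> - 1) * (c * (y - k))" if "0 < k" for k
  proof -
    have D: "((\<lambda>k. Re (payoff_primitive (of_real ?\<sigma>) y k)) has_vector_derivative
       Re (of_real k powr (of_real ?\<sigma> - 1) * of_real (y - k))) (at k)"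
      by (intro bounded_linear.has_vector_derivative[OF bounded_linear_Re] payoff_primitive_has_vector_derivative)
         (use u that in \<open>auto simp: complex_eq_iff\<close>)
    have E: "Re (of_real k powr (of_real ?\<sigma> - 1) * of_real (y - k)) = k powr (?\<sigma> - 1) * (y - k)"
      using that powr_of_real[of k "?\<sigma> - 1"] by simp
    from DERIV_cmult[OF D[unfolded E, folded has_real_derivative_iff_has_vector_derivative], of c] show ?thesis unfolding F_def by (simp add: mult_ac)
  qed
  have limF: "((F \<circ> real_of_ereal) \<longlongrightarrow> c * Re (A (of_real ?\<sigma>))) (at_right a)"
    "((F \<circ> real_of_ereal) \<longlongrightarrow> c * Re (B (of_real ?\<sigma>))) (at_left b)"
    using tendsto_mult_left[OF tendsto_Re[OF lim(1)[of "of_real ?\<sigma>"]], of c]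
      tendsto_mult_left[OF tendsto_Re[OF lim(2)[of "of_real ?\<sigma>"]], of c]
    unfolding F_def by (simp_all add: o_def)
  have rcont: "isCont (\<lambda>k. k powr (?\<sigma> - 1) * (c * (y - k))) k" if "0 < k" for k :: real
    using that by (intro continuous_intros) auto
  note real = interval_integral_FTC_nonneg[OF ab(2), of F "\<lambda>k. k powr (?\<sigma> - 1) * (c * (y - k))"
      "c * Re (A (of_real ?\<sigma>))" "c * Re (B (of_real ?\<sigma>))"]
  have r: "set_integrable lborel (einterval a b) (\<lambda>k. k powr (?\<sigma> - 1) * (c * (y - k)))"
    "(LBINT k=a..b. k powr (?\<sigma> - 1) * (c * (y - k))) = c * Re (B (of_real ?\<sigma>)) - c * Re (A (of_real ?\<sigma>))"
    by (rule real; use deriv pos limF sign rcont in \<open>auto intro!: AE_I2\<close>)+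
  show int: "set_integrable lborel (einterval a b) (\<lambda>k. k powr (?\<sigma> - 1) * (c * (y - k)))" by (rule r)
  show "(LINT k:einterval a b|lborel. k powr (Re u - 1) * (c * (y - k))) = c * Re (B (of_real (Re u)) - A (of_real (Re u)))"
  proof -
    have "c * Re (B (of_real (Re u)) - A (of_real (Re u))) = c * Re (B (of_real ?\<sigma>)) - c * Re (A (of_real ?\<sigma>))"
      by (simp add: right_diff_distrib)
    then show ?thesis using r(2) less_imp_le[OF ab(2)] by (simp add: interval_lebesgue_integral_def)
  qed
  have cont: "isCont (\<lambda>k. of_real k powr (u - 1) * of_real (c * (y - k)) :: complex) k" if "0 < k" for k
    using that by (intro continuous_intros) (auto simp: complex_nonpos_Reals_iff)
  show cint: "set_integrable lborel (einterval a b) (\<lambda>k. of_real k powr (u - 1) * of_real (c * (y - k)))"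
    unfolding set_integrable_def
  proof (rule Bochner_Integration.integrable_bound[OF int[unfolded set_integrable_def]])
    show "AE k in lborel. norm (indicat_real (einterval a b) k *\<^sub>R (of_real k powr (u - 1) * of_real (c * (y - k)) :: complex))
        \<le> norm (indicat_real (einterval a b) k *\<^sub>R (k powr (Re u - 1) * (c * (y - k))))"
    proof (rule AE_I2)
      fix k :: real
      show "norm (indicat_real (einterval a b) k *\<^sub>R (of_real k powr (u - 1) * of_real (c * (y - k)) :: complex))
        \<le> norm (indicat_real (einterval a b) k *\<^sub>R (k powr (Re u - 1) * (c * (y - k))))"
      proof (cases "k \<in> einterval a b")
        case True
        then have "0 < k" using pos by (auto simp: einterval_def)
        then have "norm (of_real k powr (u - 1) :: complex) = k powr (Re u - 1)"
          by (subst norm_powr_real_powr) auto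
        then show ?thesis using True by (simp only: norm_scaleR norm_mult norm_of_real real_norm_def abs_mult) simp
      qed simp
    qed
    show "(\<lambda>k. indicat_real (einterval a b) k *\<^sub>R (of_real k powr (u - 1) * of_real (c * (y - k)) :: complex))
        \<in> borel_measurable lborel"
      using borel_measurable_continuous_on_indicator[OF borel_einterval continuous_at_imp_continuous_on, of a b
          "\<lambda>k. of_real k powr (u - 1) * of_real (c * (y - k)) :: complex"] cont pos
      by (auto simp: einterval_def)
  qed
  have "(LBINT k=a..b. of_real k powr (u - 1) * of_real (c * (y - k))) = of_real c * B u - of_real c * A u"
  proof (rule interval_integral_FTC_integrable[OF ab(2), where F="\<lambda>k. of_real c * payoff_primitive u y k"])
    fix k assume "a < ereal k"
    show "((\<lambda>k. of_real c * payoff_primitive u y k) has_vector_derivative of_real k powr (u - 1) * of_real (c * (y - k))) (at k)"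
      using has_vector_derivative_mult_right[OF payoff_primitive_has_vector_derivative[OF u0 pos[OF \<open>a < ereal k\<close>]], of "of_real c" y UNIV]
      by (simp add: mult_ac)
    show "isCont (\<lambda>k. of_real k powr (u - 1) * of_real (c * (y - k)) :: complex) k"
      by (rule cont[OF pos[OF \<open>a < ereal k\<close>]])
  next
    show "(((\<lambda>k. of_real c * payoff_primitive u y k) \<circ> real_of_ereal) \<longlongrightarrow> of_real c * A u) (at_right a)"
      "(((\<lambda>k. of_real c * payoff_primitive u y k) \<circ> real_of_ereal) \<longlongrightarrow> of_real c * B u) (at_left b)"
      using tendsto_mult_left[OF lim(1)[of u], of "of_real c"] tendsto_mult_left[OF lim(2)[of u], of "of_real c"]
      by (simp_all add: o_def)
  qed (rule cint)
  also have "of_real c * B u - of_real c * A u = of_real c * (B u - A u)" by (simp add: right_diff_distrib)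
  finally show "(LINT k:einterval a b|lborel. of_real k powr (u - 1) * of_real (c * (y - k))) = of_real c * (B u - A u)"
    using less_imp_le[OF ab(2)] by (simp add: interval_lebesgue_integral_def)
qed

lemma tendsto_powr_complex_zero:
  assumes "((\<lambda>k. k powr Re v) \<longlongrightarrow> 0) F" "\<forall>\<^sub>F k in F. 0 < k"
  shows "((\<lambda>k. complex_of_real k powr v) \<longlongrightarrow> 0) F"
  by (rule Lim_null_comparison[OF _ assms(1)])
     (use assms(2) in \<open>auto elim!: eventually_mono simp: norm_powr_real_powr\<close>)

lemma payoff_primitive_tendsto_0:
  assumes "((\<lambda>k. k powr Re u) \<longlongrightarrow> 0) F" "((\<lambda>k. k powr (Re u + 1)) \<longlongrightarrow> 0) F" "\<forall>\<^sub>F k in F. 0 < k"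
  shows "(payoff_primitive u y \<longlongrightarrow> 0) F"
proof -
  have "((\<lambda>k. of_real y * of_real k powr u * inverse u - of_real k powr (u + 1) * inverse (u + 1)) \<longlongrightarrow>
      of_real y * 0 * inverse u - 0 * inverse (u + 1)) F"
    by (intro tendsto_intros tendsto_powr_complex_zero) (use assms in simp_all)
  then show ?thesis unfolding payoff_primitive_def by (simp add: divide_inverse)
qed

lemma payoff_primitive_isCont: "u \<noteq> 0 \<Longrightarrow> u + 1 \<noteq> 0 \<Longrightarrow> 0 < y \<Longrightarrow> isCont (payoff_primitive u y) y"
  using has_vector_derivative_continuous payoff_primitive_has_vector_derivative by blast

lemma call_payoff_mellin:
  assumes y: "0 < y" and u: "0 < Re u"
  shows "set_integrable lborel {0<..} (\<lambda>k. k powr (Re u - 1) * max (y - k) 0)"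
    and "(LINT k:{0<..}|lborel. k powr (Re u - 1) * max (y - k) 0) = y powr (Re u + 1) / (Re u * (Re u + 1))"
    and "(LINT k:{0<..}|lborel. of_real k powr (u - 1) * of_real (max (y - k) 0)) =
           (of_real y powr (u + 1) / (u * (u + 1)) :: complex)"
proof -
  have lim0: "((payoff_primitive v y \<circ> real_of_ereal) \<longlongrightarrow> 0) (at_right 0)" if "Re v = Re u" for v
  proof -
    have "\<forall>\<^sub>F k::real in at_right 0. 0 < k" by (auto simp: eventually_at_right_field intro: exI[of _ 1])
    moreover have "((\<lambda>k::real. k powr s) \<longlongrightarrow> 0) (at_right 0)" if "0 < s" for s
      by (rule tendsto_zero_powrI[where b=s])
         (use that calculation in \<open>auto intro!: tendsto_eq_intros elim!: eventually_mono\<close>)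
    ultimately have "(payoff_primitive v y \<longlongrightarrow> 0) (at_right 0)"
      using that u by (intro payoff_primitive_tendsto_0) auto
    then show ?thesis by (simp add: zero_ereal_def ereal_tendsto_simps)
  qed
  have limy: "((payoff_primitive v y \<circ> real_of_ereal) \<longlongrightarrow> payoff_primitive v y y) (at_left (ereal y))"
    if "Re v = Re u" for v
    unfolding ereal_tendsto_simps
    using payoff_primitive_isCont[of v y] that u y
    by (intro tendsto_within_subset[OF isContD]) (auto simp: complex_eq_iff)
  note P = payoff_mellin_interval[OF _ _ _ _ _ lim0 limy, where c=1]
  have ein: "einterval 0 (ereal y) = {0<..<y}" by (auto simp: einterval_def zero_ereal_def)
  have 1: "indicat_real {0<..} k *\<^sub>R (k powr (Re u - 1) * max (y - k) 0) =
      indicat_real (einterval 0 (ereal y)) k *\<^sub>R (k powr (Re u - 1) * (1 * (y - k)))" for k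
    unfolding ein by (auto simp: indicator_def max_def)
  have 2: "indicat_real {0<..} k *\<^sub>R (of_real k powr (u - 1) * of_real (max (y - k) 0) :: complex) =
      indicat_real (einterval 0 (ereal y)) k *\<^sub>R (of_real k powr (u - 1) * of_real (1 * (y - k)))" for k
    unfolding ein by (auto simp: indicator_def max_def)
  have nz: "u \<noteq> 0" "u + 1 \<noteq> 0" using u by (auto simp: complex_eq_iff)
  have diag: "Re (payoff_primitive (of_real (Re u)) y y) = y powr (Re u + 1) / (Re u * (Re u + 1))"
    using payoff_primitive_of_real[OF y, of "Re u" y] y u by (simp add: powr_add field_simps)
  show "set_integrable lborel {0<..} (\<lambda>k. k powr (Re u - 1) * max (y - k) 0)"
    unfolding set_integrable_def 1 by (rule P(1)[unfolded set_integrable_def]) (use y u in auto)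
  show "(LINT k:{0<..}|lborel. k powr (Re u - 1) * max (y - k) 0) = y powr (Re u + 1) / (Re u * (Re u + 1))"
    unfolding set_lebesgue_integral_def 1
    by (subst P(2)[unfolded set_lebesgue_integral_def]) (use y u diag in auto)
  show "(LINT k:{0<..}|lborel. of_real k powr (u - 1) * of_real (max (y - k) 0)) =
           (of_real y powr (u + 1) / (u * (u + 1)) :: complex)"
    unfolding set_lebesgue_integral_def 2
    by (subst P(4)[unfolded set_lebesgue_integral_def]) (use y u nz payoff_primitive_diagonal in auto)
qed

lemma put_payoff_mellin:
  assumes y: "0 < y" and u: "Re u < -1"
  shows "set_integrable lborel {0<..} (\<lambda>k. k powr (Re u - 1) * max (k - y) 0)"
    and "(LINT k:{0<..}|lborel. k powr (Re u - 1) * max (k - y) 0) = y powr (Re u + 1) / (Re u * (Re u + 1))"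
    and "(LINT k:{0<..}|lborel. of_real k powr (u - 1) * of_real (max (k - y) 0)) =
           (of_real y powr (u + 1) / (u * (u + 1)) :: complex)"
proof -
  have lim0: "((payoff_primitive v y \<circ> real_of_ereal) \<longlongrightarrow> 0) (at_left \<infinity>)" if "Re v = Re u" for v
  proof -
    have "(payoff_primitive v y \<longlongrightarrow> 0) at_top"
      by (rule payoff_primitive_tendsto_0)
         (use that u in \<open>auto intro!: tendsto_neg_powr filterlim_ident eventually_gt_at_top\<close>)
    then show ?thesis by (simp add: ereal_tendsto_simps)
  qed
  have limy: "((payoff_primitive v y \<circ> real_of_ereal) \<longlongrightarrow> payoff_primitive v y y) (at_right (ereal y))"
    if "Re v = Re u" for v
    unfolding ereal_tendsto_simps
    using payoff_primitive_isCont[of v y] that u y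
    by (intro tendsto_within_subset[OF isContD]) (auto simp: complex_eq_iff)
  note P = payoff_mellin_interval[OF _ _ _ _ _ limy lim0, where c="-1"]
  have ein: "einterval (ereal y) \<infinity> = {y<..}" by (auto simp: einterval_def)
  have 1: "indicat_real {0<..} k *\<^sub>R (k powr (Re u - 1) * max (k - y) 0) =
      indicat_real (einterval (ereal y) \<infinity>) k *\<^sub>R (k powr (Re u - 1) * (-1 * (y - k)))" for k
    unfolding ein using y by (auto simp: indicator_def max_def)
  have 2: "indicat_real {0<..} k *\<^sub>R (of_real k powr (u - 1) * of_real (max (k - y) 0) :: complex) =
      indicat_real (einterval (ereal y) \<infinity>) k *\<^sub>R (of_real k powr (u - 1) * of_real (-1 * (y - k)))" for k
    unfolding ein using y by (auto simp: indicator_def max_def)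
  have nz: "u \<noteq> 0" "u + 1 \<noteq> 0" using u by (auto simp: complex_eq_iff)
  have diag: "Re (payoff_primitive (of_real (Re u)) y y) = y powr (Re u + 1) / (Re u * (Re u + 1))"
    using payoff_primitive_of_real[OF y, of "Re u" y] y u by (simp add: powr_add field_simps)
  show "set_integrable lborel {0<..} (\<lambda>k. k powr (Re u - 1) * max (k - y) 0)"
    unfolding set_integrable_def 1 by (rule P(1)[unfolded set_integrable_def]) (use y u in auto)
  show "(LINT k:{0<..}|lborel. k powr (Re u - 1) * max (k - y) 0) = y powr (Re u + 1) / (Re u * (Re u + 1))"
    unfolding set_lebesgue_integral_def 1
    by (subst P(2)[unfolded set_lebesgue_integral_def]) (use y u diag in auto)
  show "(LINT k:{0<..}|lborel. of_real k powr (u - 1) * of_real (max (k - y) 0)) =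
           (of_real y powr (u + 1) / (u * (u + 1)) :: complex)"
    unfolding set_lebesgue_integral_def 2
    by (subst P(4)[unfolded set_lebesgue_integral_def]) (use y u nz payoff_primitive_diagonal in auto)
qed

text \<open>Fubini's theorem carries a Mellin transform of the payoff over to the expected payoff. It
  applies because the transform at the real part of \<open>u\<close>, where the integrand is nonnegative, is
  integrable.\<close>

lemma expected_payoff_mellin:
  fixes pay :: "real \<Rightarrow> real \<Rightarrow> real" and X :: "'w \<Rightarrow> real" and u :: complex and c :: real and C :: complex
  assumes M: "prob_space M" and X[measurable]: "X \<in> borel_measurable M" and Xpos: "\<And>\<omega>. 0 < X \<omega>"
    and pay[measurable]: "(\<lambda>(y, k). pay y k) \<in> borel_measurable (borel \<Otimes>\<^sub>M borel)"
    and nonneg: "\<And>y k. 0 \<le> pay y k"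
    and real_int: "\<And>y. 0 < y \<Longrightarrow> set_integrable lborel {0<..} (\<lambda>k. k powr (Re u - 1) * pay y k)"
    and real_eq: "\<And>y. 0 < y \<Longrightarrow> (LINT k:{0<..}|lborel. k powr (Re u - 1) * pay y k) = y powr (Re u + 1) * c"
    and eq: "\<And>y. 0 < y \<Longrightarrow> (LINT k:{0<..}|lborel. of_real k powr (u - 1) * of_real (pay y k)) = of_real y powr (u + 1) * C"
    and moment: "integrable M (\<lambda>\<omega>. X \<omega> powr (Re u + 1))"
  shows "set_integrable lborel {0<..} (\<lambda>k. of_real k powr (u - 1) * of_real (\<integral>\<omega>. pay (X \<omega>) k \<partial>M))"
    and "(LINT k:{0<..}|lborel. of_real k powr (u - 1) * of_real (\<integral>\<omega>. pay (X \<omega>) k \<partial>M)) =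
      C * (\<integral>\<omega>. of_real (X \<omega>) powr (u + 1) \<partial>M)"
proof -
  interpret prob_space M by (rule M)
  interpret pair_sigma_finite M lborel ..
  define g where "g = (\<lambda>(\<omega>, k). indicat_real {0<..} k *\<^sub>R (of_real k powr (u - 1) * of_real (pay (X \<omega>) k) :: complex))"
  have gm[measurable]: "g \<in> borel_measurable (M \<Otimes>\<^sub>M lborel)"
  proof -
    have pw: "(\<lambda>k. indicat_real {0<..} k *\<^sub>R complex_of_real k powr (u - 1)) \<in> borel_measurable borel"
      by (intro borel_measurable_continuous_on_indicator continuous_intros) (auto simp: complex_nonpos_Reals_iff)
    have "(\<lambda>x. indicat_real {0<..} (snd x) *\<^sub>R complex_of_real (snd x) powr (u - 1)) \<in> borel_measurable (M \<Otimes>\<^sub>M lborel)"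
      by (rule measurable_compose[OF _ pw]) measurable
    moreover have "(\<lambda>x. (X (fst x), snd x)) \<in> measurable (M \<Otimes>\<^sub>M lborel) (borel \<Otimes>\<^sub>M borel)"
      by measurable
    from measurable_compose[OF this pay]
    have "(\<lambda>x. pay (X (fst x)) (snd x)) \<in> borel_measurable (M \<Otimes>\<^sub>M lborel)" by simp
    moreover from this have "(\<lambda>x. complex_of_real (pay (X (fst x)) (snd x))) \<in> borel_measurable (M \<Otimes>\<^sub>M lborel)"
      using measurable_compose[OF _ borel_measurable_continuous_onI[OF continuous_on_of_real[OF continuous_on_id]]]
      by fast
    ultimately have "(\<lambda>x. (indicat_real {0<..} (snd x) *\<^sub>R complex_of_real (snd x) powr (u - 1)) *
        of_real (pay (X (fst x)) (snd x))) \<in> borel_measurable (M \<Otimes>\<^sub>M lborel)"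
      by (intro borel_measurable_times)
    then show ?thesis unfolding g_def case_prod_beta by simp
  qed
  have norm_g: "norm (g (\<omega>, k)) = indicat_real {0<..} k *\<^sub>R (k powr (Re u - 1) * pay (X \<omega>) k)" for \<omega> k
    by (auto simp: g_def indicator_def norm_mult norm_powr_real_powr nonneg)
  have g: "integrable (M \<Otimes>\<^sub>M lborel) g"
  proof (rule Fubini_integrable[OF gm])
    have "(\<integral>k. norm (g (\<omega>, k)) \<partial>lborel) = X \<omega> powr (Re u + 1) * c" for \<omega>
      unfolding norm_g using real_eq[OF Xpos[of \<omega>]] by (simp add: set_lebesgue_integral_def)
    then show "integrable M (\<lambda>\<omega>. \<integral>k. norm (g (\<omega>, k)) \<partial>lborel)" using moment by simp
    show "AE \<omega> in M. integrable lborel (\<lambda>k. g (\<omega>, k))"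
    proof (rule AE_I2)
      fix \<omega> assume [measurable]: "\<omega> \<in> space M"
      have "integrable lborel (\<lambda>k. norm (g (\<omega>, k)))"
        unfolding norm_g using real_int[OF Xpos[of \<omega>]] by (simp add: set_integrable_def)
      then show "integrable lborel (\<lambda>k. g (\<omega>, k))"
        by (subst (asm) integrable_norm_iff) measurable
    qed
  qed
  have inner: "(\<integral>\<omega>. g (\<omega>, k) \<partial>M) =
      indicat_real {0<..} k *\<^sub>R (of_real k powr (u - 1) * of_real (\<integral>\<omega>. pay (X \<omega>) k \<partial>M))" for k
    by (simp add: g_def)
  show "set_integrable lborel {0<..} (\<lambda>k. of_real k powr (u - 1) * of_real (\<integral>\<omega>. pay (X \<omega>) k \<partial>M))"
    using integrable_snd[of "\<lambda>\<omega> k. g (\<omega>, k)"] g unfolding set_integrable_def inner[symmetric] by simp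
  have "(LINT k:{0<..}|lborel. of_real k powr (u - 1) * of_real (\<integral>\<omega>. pay (X \<omega>) k \<partial>M)) =
      (\<integral>k. (\<integral>\<omega>. g (\<omega>, k) \<partial>M) \<partial>lborel)"
    unfolding set_lebesgue_integral_def inner ..
  also have "\<dots> = (\<integral>\<omega>. (\<integral>k. g (\<omega>, k) \<partial>lborel) \<partial>M)"
    using Fubini_integral[of "\<lambda>\<omega> k. g (\<omega>, k)"] g by simp
  also have "\<dots> = (\<integral>\<omega>. of_real (X \<omega>) powr (u + 1) * C \<partial>M)"
    using eq[OF Xpos] by (simp add: g_def set_lebesgue_integral_def)
  finally show "(LINT k:{0<..}|lborel. of_real k powr (u - 1) * of_real (\<integral>\<omega>. pay (X \<omega>) k \<partial>M)) =
      C * (\<integral>\<omega>. of_real (X \<omega>) powr (u + 1) \<partial>M)" by (simp add: mult.commute)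
qed

section \<open>The semigroup of a Markov additive process\<close>

context markov_additive_process
begin

abbreviation in_state :: "real \<Rightarrow> 'e \<Rightarrow> 'w set" where
  "in_state t \<beta> \<equiv> {\<omega> \<in> space M. J t \<omega> = \<beta>}"

lemma space_P: "space (P \<alpha>) = space M"
  by (rule sets_eq_imp_space_eq) (rule sets_P)

lemma subalgebra_P: "0 \<le> t \<Longrightarrow> subalgebra (P \<alpha>) (\<F> t)"
  using subalgebra[of t] sets_P[of \<alpha>] space_P[of \<alpha>] unfolding subalgebra_def by simp

lemma J_measurable_\<F>: "0 \<le> t \<Longrightarrow> J t \<in> measurable (\<F> t) (count_space UNIV)"
  using measurable_compose[OF adapted measurable_fst] by simp

lemma \<xi>_measurable_\<F>: "0 \<le> t \<Longrightarrow> \<xi> t \<in> borel_measurable (\<F> t)"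
  using measurable_compose[OF adapted measurable_snd] by simp

lemma J_measurable [measurable]: "0 \<le> t \<Longrightarrow> J t \<in> measurable (P \<alpha>) (count_space UNIV)"
  using measurable_from_subalg[OF subalgebra_P J_measurable_\<F>] .

lemma \<xi>_measurable [measurable]: "0 \<le> t \<Longrightarrow> \<xi> t \<in> borel_measurable (P \<alpha>)"
  using measurable_from_subalg[OF subalgebra_P \<xi>_measurable_\<F>] .

lemma space_\<F>: "space (\<F> t) = space M"
  using filtration by (simp add: filtration_def)

lemma sets_\<F>_mono: "s \<le> t \<Longrightarrow> sets (\<F> s) \<subseteq> sets (\<F> t)"
  using filtration by (simp add: filtration_def)

lemma sets_\<F>_P: "0 \<le> t \<Longrightarrow> H \<in> sets (\<F> t) \<Longrightarrow> H \<in> sets (P \<alpha>)"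
  using subalgebra_P unfolding subalgebra_def by blast

text \<open>The defining property against test functions of the form \<open>of_bool (j = \<gamma>) * g x\<close>, integrated over an event of the
  past on which the present state is \<open>\<beta>\<close>.\<close>

lemma markov_test_function:
  assumes t: "0 < t" and s: "0 < s" and H: "H \<in> sets (\<F> t)" "\<And>\<omega>. \<omega> \<in> H \<Longrightarrow> J t \<omega> = \<beta>"
    and g: "continuous_on UNIV g" "\<And>x. 0 \<le> g x" "\<And>x. g x \<le> (1::real)"
  shows "(\<integral>\<omega>. indicator H \<omega> * (of_bool (J (t + s) \<omega> = \<gamma>) * g (\<xi> (t + s) \<omega> - \<xi> t \<omega>)) \<partial>P \<alpha>) =
    measure (P \<alpha>) H * (\<integral>\<omega>. of_bool (J s \<omega> = \<gamma>) * g (\<xi> s \<omega>) \<partial>P \<beta>)"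
proof -
  interpret prob_space "P \<alpha>" by (rule prob)
  interpret finite_measure_subalgebra "P \<alpha>" "\<F> t"
    by unfold_locales (use subalgebra_P t in auto)
  have [measurable]: "g \<in> borel_measurable borel" by (rule borel_measurable_continuous_onI[OF g(1)])
  have ts: "0 \<le> t" "0 \<le> t + s" using t s by auto
  note [measurable] = J_measurable[OF ts(2)] \<xi>_measurable[OF ts(1)] \<xi>_measurable[OF ts(2)]
  define f where "f = (\<lambda>(j, x). of_bool (j = \<gamma>) * g x)"
  define G where "G = (\<lambda>\<omega>. f (J (t + s) \<omega>, \<xi> (t + s) \<omega> - \<xi> t \<omega>))"
  have "continuous_map (prod_topology (discrete_topology UNIV) euclidean) euclideanreal
      (\<lambda>y. of_bool (fst y = \<gamma>) * g (snd y))"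
  proof (intro continuous_map_real_mult)
    show "continuous_map (prod_topology (discrete_topology UNIV) euclidean) euclideanreal (\<lambda>y. of_bool (fst y = \<gamma>))"
      using continuous_map_compose[OF continuous_map_fst, of "discrete_topology UNIV" euclideanreal "\<lambda>j. of_bool (j = \<gamma>)"]
      by (simp add: o_def)
    show "continuous_map (prod_topology (discrete_topology UNIV) euclidean) euclideanreal (\<lambda>y. g (snd y))"
      using continuous_map_compose[OF continuous_map_snd, of euclidean euclideanreal g] g(1)
      by (simp add: o_def)
  qed
  then have cf: "continuous_map (prod_topology (discrete_topology UNIV) euclidean) euclidean f"
    by (simp add: f_def case_prod_beta')
  have f01: "0 \<le> f y" "f y \<le> 1" for y using g by (auto simp: f_def split: prod.split)
  have bf: "bounded (range f)"
    unfolding bounded_iff using f01 by (auto intro!: exI[of _ 1])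
  have Gm[measurable]: "G \<in> borel_measurable (P \<alpha>)"
    unfolding G_def f_def case_prod_conv by measurable
  have G: "integrable (P \<alpha>) G"
    by (rule integrable_const_bound[of _ 1, OF _ Gm]) (use f01 in \<open>auto simp: G_def\<close>)
  have "(\<integral>\<omega>. indicator H \<omega> * G \<omega> \<partial>P \<alpha>) = (\<integral>\<omega>. indicator H \<omega> * real_cond_exp (P \<alpha>) (\<F> t) G \<omega> \<partial>P \<alpha>)"
    using real_cond_exp_intA[OF G H(1)] by (simp add: set_lebesgue_integral_def)
  also have "\<dots> = (\<integral>\<omega>. indicator H \<omega> * (\<integral>\<omega>'. f (J s \<omega>', \<xi> s \<omega>') \<partial>P \<beta>) \<partial>P \<alpha>)"
  proof (rule integral_cong_AE)
    have "AE \<omega> in P \<alpha>. real_cond_exp (P \<alpha>) (\<F> t) G \<omega> = (\<integral>\<omega>'. f (J s \<omega>', \<xi> s \<omega>') \<partial>P (J t \<omega>))"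
      unfolding G_def by (rule markov_additive[OF cf bf f01(1) s t])
    then show "AE \<omega> in P \<alpha>. indicator H \<omega> * real_cond_exp (P \<alpha>) (\<F> t) G \<omega> =
        indicator H \<omega> * (\<integral>\<omega>'. f (J s \<omega>', \<xi> s \<omega>') \<partial>P \<beta>)"
      by eventually_elim (use H(2) in \<open>auto simp: indicator_def\<close>)
  qed (use sets_\<F>_P[OF _ H(1)] t in auto)
  also have "\<dots> = measure (P \<alpha>) H * (\<integral>\<omega>'. f (J s \<omega>', \<xi> s \<omega>') \<partial>P \<beta>)"
    using sets_\<F>_P[OF _ H(1)] t by simp
  finally show ?thesis by (simp add: G_def f_def)
qed

text \<open>Indicators of the half-lines \<open>(x, \<infinity>)\<close> are increasing limits of continuous functions, and the half-lines
  determine a finite measure.\<close>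

lemma markov_measure:
  assumes t: "0 < t" and s: "0 < s" and H: "H \<in> sets (\<F> t)" "\<And>\<omega>. \<omega> \<in> H \<Longrightarrow> J t \<omega> = \<beta>"
    and B: "B \<in> sets borel"
  shows "emeasure (P \<alpha>) {\<omega> \<in> H. J (t + s) \<omega> = \<gamma> \<and> \<xi> (t + s) \<omega> - \<xi> t \<omega> \<in> B} =
    emeasure (P \<alpha>) H * emeasure (P \<beta>) {\<omega> \<in> space M. J s \<omega> = \<gamma> \<and> \<xi> s \<omega> \<in> B}"
proof -
  interpret a: prob_space "P \<alpha>" by (rule prob)
  interpret b: prob_space "P \<beta>" by (rule prob)
  have HP[measurable]: "H \<in> sets (P \<alpha>)" using sets_\<F>_P[OF _ H(1)] t by simp
  note [measurable] = J_measurable[of "t + s"] \<xi>_measurable[of "t + s"] \<xi>_measurable[of t]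
    J_measurable[of s] \<xi>_measurable[of s]
  have ts: "0 \<le> t" "0 \<le> s" "0 \<le> t + s" using t s by auto
  define D where "D = (\<lambda>\<omega>. \<xi> (t + s) \<omega> - \<xi> t \<omega>)"
  have D[measurable]: "D \<in> borel_measurable (P \<alpha>)" unfolding D_def using ts by measurable
  have SB: "{\<omega> \<in> space M. J s \<omega> = \<gamma> \<and> \<xi> s \<omega> \<in> B} \<in> sets (P \<beta>)" if "B \<in> sets borel" for B
    using that ts unfolding space_P[of \<beta>, symmetric] by measurable
  have SH: "{\<omega> \<in> H. J (t + s) \<omega> = \<gamma> \<and> D \<omega> \<in> B} \<in> sets (P \<alpha>)" if "B \<in> sets borel" for B
  proof -
    have "{\<omega> \<in> H. J (t + s) \<omega> = \<gamma> \<and> D \<omega> \<in> B} = H \<inter> {\<omega> \<in> space (P \<alpha>). J (t + s) \<omega> = \<gamma> \<and> D \<omega> \<in> B}"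
      using sets.sets_into_space[OF HP] by auto
    also have "\<dots> \<in> sets (P \<alpha>)" using that ts by measurable
    finally show ?thesis .
  qed
  define \<mu> where "\<mu> = distr (density (P \<alpha>) (indicator {\<omega> \<in> H. J (t + s) \<omega> = \<gamma>})) borel D"
  define \<nu> where "\<nu> = scale_measure (emeasure (P \<alpha>) H)
      (distr (density (P \<beta>) (indicator (in_state s \<gamma>))) borel (\<xi> s))"
  have m1: "{\<omega> \<in> H. J (t + s) \<omega> = \<gamma>} \<in> sets (P \<alpha>)" using SH[of UNIV] by simp
  have m2: "(in_state s \<gamma>) \<in> sets (P \<beta>)" using SB[of UNIV] by simp
  have \<mu>: "emeasure \<mu> B = emeasure (P \<alpha>) {\<omega> \<in> H. J (t + s) \<omega> = \<gamma> \<and> D \<omega> \<in> B}" if B: "B \<in> sets borel" for B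
  proof -
    have "emeasure \<mu> B = emeasure (density (P \<alpha>) (indicator {\<omega> \<in> H. J (t + s) \<omega> = \<gamma>})) (D -` B \<inter> space (P \<alpha>))"
      unfolding \<mu>_def using B by (subst emeasure_distr) auto
    also have "\<dots> = emeasure (P \<alpha>) ({\<omega> \<in> H. J (t + s) \<omega> = \<gamma>} \<inter> (D -` B \<inter> space (P \<alpha>)))"
      using m1 B by (intro emeasure_restricted measurable_sets[OF D])
    also have "{\<omega> \<in> H. J (t + s) \<omega> = \<gamma>} \<inter> (D -` B \<inter> space (P \<alpha>)) = {\<omega> \<in> H. J (t + s) \<omega> = \<gamma> \<and> D \<omega> \<in> B}"
      using sets.sets_into_space[OF HP] by auto
    finally show ?thesis .
  qed
  have \<nu>: "emeasure \<nu> B = emeasure (P \<alpha>) H * emeasure (P \<beta>) {\<omega> \<in> space M. J s \<omega> = \<gamma> \<and> \<xi> s \<omega> \<in> B}"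
    if B: "B \<in> sets borel" for B
  proof -
    have "emeasure (distr (density (P \<beta>) (indicator (in_state s \<gamma>))) borel (\<xi> s)) B =
        emeasure (density (P \<beta>) (indicator (in_state s \<gamma>))) (\<xi> s -` B \<inter> space (P \<beta>))"
      using B ts by (subst emeasure_distr) auto
    also have "\<dots> = emeasure (P \<beta>) ((in_state s \<gamma>) \<inter> (\<xi> s -` B \<inter> space (P \<beta>)))"
      using m2 B ts by (intro emeasure_restricted measurable_sets[OF \<xi>_measurable])
    also have "(in_state s \<gamma>) \<inter> (\<xi> s -` B \<inter> space (P \<beta>)) = {\<omega> \<in> space M. J s \<omega> = \<gamma> \<and> \<xi> s \<omega> \<in> B}"
      by (auto simp: space_P)
    finally show ?thesis by (simp add: \<nu>_def)
  qed
  have "\<mu> = \<nu>"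
  proof (rule measure_eqI_lessThan)
    show "emeasure \<mu> {x<..} < \<infinity>" for x
      by (subst \<mu>) (auto simp: less_top[symmetric] a.emeasure_finite)
    show "emeasure \<mu> {x<..} = emeasure \<nu> {x<..}" for x
    proof -
      define g where "g = (\<lambda>n y. min 1 (real n * max 0 (y - x)))"
      have gc: "continuous_on UNIV (g n)" "0 \<le> g n y" "g n y \<le> 1" for n y
        unfolding g_def by (auto intro!: continuous_intros)
      have [measurable]: "g n \<in> borel_measurable borel" for n
        by (rule borel_measurable_continuous_onI[OF gc(1)])
      have glim: "(\<lambda>n. g n y) \<longlonglongrightarrow> indicat_real {x<..} y" for y
      proof (cases "x < y")
        case True
        have "\<forall>\<^sub>F n in sequentially. 1 / (y - x) < real n"
          using filterlim_real_sequentially unfolding filterlim_at_top_dense by blast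
        then have "\<forall>\<^sub>F n in sequentially. indicat_real {x<..} y = g n y"
          by eventually_elim (use True in \<open>simp add: g_def field_simps min_def\<close>)
        then show ?thesis by (intro tendsto_eventually) (auto elim!: eventually_mono)
      qed (simp add: g_def)
      have glim1: "x < y \<Longrightarrow> (\<lambda>n. g n y) \<longlonglongrightarrow> 1" and glim0: "\<not> x < y \<Longrightarrow> (\<lambda>n. g n y) \<longlonglongrightarrow> 0" for y
        using glim[of y] by (simp_all add: indicator_def)
      have 1: "(\<lambda>n. \<integral>\<omega>. indicator H \<omega> * (of_bool (J (t + s) \<omega> = \<gamma>) * g n (D \<omega>)) \<partial>P \<alpha>)
          \<longlonglongrightarrow> (\<integral>\<omega>. indicator H \<omega> * (of_bool (J (t + s) \<omega> = \<gamma>) * indicat_real {x<..} (D \<omega>)) \<partial>P \<alpha>)"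
        by (rule integral_dominated_convergence[where w="\<lambda>_. 1"])
           (use ts gc in \<open>auto intro!: AE_I2 tendsto_mult tendsto_const glim0 glim1 split: split_indicator\<close>)
      have 2: "(\<lambda>n. \<integral>\<omega>. of_bool (J s \<omega> = \<gamma>) * g n (\<xi> s \<omega>) \<partial>P \<beta>)
          \<longlonglongrightarrow> (\<integral>\<omega>. of_bool (J s \<omega> = \<gamma>) * indicat_real {x<..} (\<xi> s \<omega>) \<partial>P \<beta>)"
        by (rule integral_dominated_convergence[where w="\<lambda>_. 1"])
           (use ts gc in \<open>auto intro!: AE_I2 tendsto_mult tendsto_const glim0 glim1 split: split_indicator\<close>)
      have "(\<integral>\<omega>. indicator H \<omega> * (of_bool (J (t + s) \<omega> = \<gamma>) * indicat_real {x<..} (D \<omega>)) \<partial>P \<alpha>) =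
          measure (P \<alpha>) H * (\<integral>\<omega>. of_bool (J s \<omega> = \<gamma>) * indicat_real {x<..} (\<xi> s \<omega>) \<partial>P \<beta>)"
      proof (rule LIMSEQ_unique[OF 1])
        have "(\<integral>\<omega>. indicator H \<omega> * (of_bool (J (t + s) \<omega> = \<gamma>) * g n (D \<omega>)) \<partial>P \<alpha>) =
            measure (P \<alpha>) H * (\<integral>\<omega>. of_bool (J s \<omega> = \<gamma>) * g n (\<xi> s \<omega>) \<partial>P \<beta>)" for n
          unfolding D_def by (rule markov_test_function[OF t s H gc])
        then show "(\<lambda>n. \<integral>\<omega>. indicator H \<omega> * (of_bool (J (t + s) \<omega> = \<gamma>) * g n (D \<omega>)) \<partial>P \<alpha>)
            \<longlonglongrightarrow> measure (P \<alpha>) H * (\<integral>\<omega>. of_bool (J s \<omega> = \<gamma>) * indicat_real {x<..} (\<xi> s \<omega>) \<partial>P \<beta>)"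
          using tendsto_mult_left[OF 2, of "measure (P \<alpha>) H"] by simp
      qed
      moreover have "(\<integral>\<omega>. indicator H \<omega> * (of_bool (J (t + s) \<omega> = \<gamma>) * indicat_real {x<..} (D \<omega>)) \<partial>P \<alpha>) =
          measure (P \<alpha>) {\<omega> \<in> H. J (t + s) \<omega> = \<gamma> \<and> D \<omega> \<in> {x<..}}"
      proof -
        have "(\<lambda>\<omega>. indicator H \<omega> * (of_bool (J (t + s) \<omega> = \<gamma>) * indicat_real {x<..} (D \<omega>))) =
            indicat_real {\<omega> \<in> H. J (t + s) \<omega> = \<gamma> \<and> D \<omega> \<in> {x<..}}"
          by (auto simp: indicator_def fun_eq_iff)
        then show ?thesis using SH[of "{x<..}"] by simp
      qed
      moreover have "(\<integral>\<omega>. of_bool (J s \<omega> = \<gamma>) * indicat_real {x<..} (\<xi> s \<omega>) \<partial>P \<beta>) =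
          measure (P \<beta>) {\<omega> \<in> space M. J s \<omega> = \<gamma> \<and> \<xi> s \<omega> \<in> {x<..}}"
      proof -
        have "(\<integral>\<omega>. of_bool (J s \<omega> = \<gamma>) * indicat_real {x<..} (\<xi> s \<omega>) \<partial>P \<beta>) =
            (\<integral>\<omega>. indicat_real {\<omega> \<in> space M. J s \<omega> = \<gamma> \<and> \<xi> s \<omega> \<in> {x<..}} \<omega> \<partial>P \<beta>)"
          by (rule Bochner_Integration.integral_cong) (auto simp: indicator_def space_P)
        then show ?thesis using SB[of "{x<..}"] by simp
      qed
      ultimately have "measure (P \<alpha>) {\<omega> \<in> H. J (t + s) \<omega> = \<gamma> \<and> D \<omega> \<in> {x<..}} =
          measure (P \<alpha>) H * measure (P \<beta>) {\<omega> \<in> space M. J s \<omega> = \<gamma> \<and> \<xi> s \<omega> \<in> {x<..}}" by simp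
      then show ?thesis
        by (simp only: \<mu> \<nu> borel_open open_greaterThan a.emeasure_eq_measure b.emeasure_eq_measure
            ennreal_mult[OF measure_nonneg measure_nonneg, symmetric])
    qed
  qed (simp_all add: \<mu>_def \<nu>_def)
  then show ?thesis using \<mu>[OF B] \<nu>[OF B] by (simp add: D_def)
qed

text \<open>The part on \<open>{J\<^sub>t = \<beta>}\<close> of the distribution of \<open>\<xi>\<^sub>t\<close> under \<open>P \<alpha>\<close>. Its moment generating
  function is the entry \<open>\<EE>\<^sub>\<alpha>[exp (z \<xi>\<^sub>t); J\<^sub>t = \<beta>]\<close> of the matrix semigroup.\<close>

definition law :: "real \<Rightarrow> 'e \<Rightarrow> 'e \<Rightarrow> real measure" where
  "law t \<alpha> \<beta> = distr (density (P \<alpha>) (indicator (in_state t \<beta>))) borel (\<xi> t)"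

definition nn_mgf :: "real \<Rightarrow> real \<Rightarrow> 'e \<Rightarrow> 'e \<Rightarrow> ennreal" where
  "nn_mgf p t \<alpha> \<beta> = (\<integral>\<^sup>+x. ennreal (exp (p * x)) \<partial>law t \<alpha> \<beta>)"

definition mgf :: "complex \<Rightarrow> real \<Rightarrow> 'e \<Rightarrow> 'e \<Rightarrow> complex" where
  "mgf z t \<alpha> \<beta> = (\<integral>x. exp (z * of_real x) \<partial>law t \<alpha> \<beta>)"

lemma sets_law [simp, measurable_cong]: "sets (law t \<alpha> \<beta>) = sets borel"
  by (simp add: law_def)

lemma space_law [simp]: "space (law t \<alpha> \<beta>) = UNIV"
  by (simp add: law_def)

lemma J_event [measurable]: "0 \<le> t \<Longrightarrow> (in_state t \<beta>) \<in> sets (P \<alpha>)"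
  using measurable_sets[OF J_measurable[of t \<alpha>], of "{\<beta>}"] by (simp add: space_P vimage_def Int_def conj_commute)

lemma nn_integral_law:
  assumes t: "0 \<le> t" and [measurable]: "f \<in> borel_measurable borel"
  shows "(\<integral>\<^sup>+x. f x \<partial>law t \<alpha> \<beta>) = (\<integral>\<^sup>+\<omega>. indicator (in_state t \<beta>) \<omega> * f (\<xi> t \<omega>) \<partial>P \<alpha>)"
proof -
  note [measurable] = \<xi>_measurable[OF t] J_event[OF t]
  show ?thesis unfolding law_def by (simp add: nn_integral_distr nn_integral_density)
qed

lemma integrable_law_iff:
  fixes f :: "real \<Rightarrow> 'a::{banach, second_countable_topology}"
  assumes t: "0 \<le> t" and [measurable]: "f \<in> borel_measurable borel"
  shows "integrable (law t \<alpha> \<beta>) f \<longleftrightarrow>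
    integrable (P \<alpha>) (\<lambda>\<omega>. indicat_real (in_state t \<beta>) \<omega> *\<^sub>R f (\<xi> t \<omega>))"
proof -
  note [measurable] = \<xi>_measurable[OF t] J_event[OF t]
  show ?thesis unfolding law_def ennreal_indicator[symmetric] by (simp add: integrable_distr_eq integrable_density)
qed

lemma integral_law:
  fixes f :: "real \<Rightarrow> 'a::{banach, second_countable_topology}"
  assumes t: "0 \<le> t" and [measurable]: "f \<in> borel_measurable borel"
  shows "(\<integral>x. f x \<partial>law t \<alpha> \<beta>) = (\<integral>\<omega>. indicat_real (in_state t \<beta>) \<omega> *\<^sub>R f (\<xi> t \<omega>) \<partial>P \<alpha>)"
proof -
  note [measurable] = \<xi>_measurable[OF t] J_event[OF t]
  show ?thesis unfolding law_def ennreal_indicator[symmetric] by (simp add: integral_distr integral_density)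
qed

lemma emeasure_law:
  assumes t: "0 \<le> t" and B: "B \<in> sets borel"
  shows "emeasure (law t \<alpha> \<beta>) B = emeasure (P \<alpha>) {\<omega> \<in> space M. J t \<omega> = \<beta> \<and> \<xi> t \<omega> \<in> B}"
proof -
  have "emeasure (law t \<alpha> \<beta>) B =
      emeasure (density (P \<alpha>) (indicator (in_state t \<beta>))) (\<xi> t -` B \<inter> space (P \<alpha>))"
    unfolding law_def using t B by (subst emeasure_distr) auto
  also have "\<dots> = emeasure (P \<alpha>) ((in_state t \<beta>) \<inter> (\<xi> t -` B \<inter> space (P \<alpha>)))"
    using t B by (intro emeasure_restricted J_event measurable_sets[OF \<xi>_measurable])
  also have "(in_state t \<beta>) \<inter> (\<xi> t -` B \<inter> space (P \<alpha>)) = {\<omega> \<in> space M. J t \<omega> = \<beta> \<and> \<xi> t \<omega> \<in> B}"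
    by (auto simp: space_P)
  finally show ?thesis .
qed

lemma finite_measure_law: "0 \<le> t \<Longrightarrow> finite_measure (law t \<alpha> \<beta>)"
proof (rule finite_measureI)
  interpret prob_space "P \<alpha>" by (rule prob)
  show "0 \<le> t \<Longrightarrow> emeasure (law t \<alpha> \<beta>) (space (law t \<alpha> \<beta>)) \<noteq> \<infinity>"
    by (simp add: emeasure_law)
qed

text \<open>Given \<open>J\<^sub>t = \<beta>\<close>, the increment after time \<open>t\<close> is independent of \<open>\<xi>\<^sub>t\<close>.\<close>

lemma law_pair:
  assumes t: "0 < t" and s: "0 < s"
  shows "law t \<alpha> \<beta> \<Otimes>\<^sub>M law s \<beta> \<gamma> =
    distr (density (P \<alpha>) (indicator {\<omega> \<in> space M. J t \<omega> = \<beta> \<and> J (t + s) \<omega> = \<gamma>})) (borel \<Otimes>\<^sub>M borel)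
      (\<lambda>\<omega>. (\<xi> t \<omega>, \<xi> (t + s) \<omega> - \<xi> t \<omega>))"
proof (rule pair_measure_eqI)
  have ts: "0 \<le> t" "0 \<le> s" "0 \<le> t + s" using t s by auto
  note [measurable] = \<xi>_measurable[OF ts(1)] \<xi>_measurable[OF ts(3)] J_event[OF ts(1)] J_event[OF ts(3)]
  show "sigma_finite_measure (law t \<alpha> \<beta>)" "sigma_finite_measure (law s \<beta> \<gamma>)"
    using finite_measure_law ts by (auto intro: finite_measure.axioms)
  fix A B assume "A \<in> sets (law t \<alpha> \<beta>)" "B \<in> sets (law s \<beta> \<gamma>)"
  then have A[measurable]: "A \<in> sets borel" and B[measurable]: "B \<in> sets borel" by auto
  define H where "H = {\<omega> \<in> space M. J t \<omega> = \<beta> \<and> \<xi> t \<omega> \<in> A}"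
  have HF: "H \<in> sets (\<F> t)"
  proof -
    note [measurable] = J_measurable_\<F>[OF ts(1)] \<xi>_measurable_\<F>[OF ts(1)]
    show ?thesis unfolding H_def space_\<F>[of t, symmetric] by measurable
  qed
  have E: "{\<omega> \<in> space M. J t \<omega> = \<beta> \<and> J (t + s) \<omega> = \<gamma>} \<in> sets (P \<alpha>)"
  proof -
    have "{\<omega> \<in> space M. J t \<omega> = \<beta> \<and> J (t + s) \<omega> = \<gamma>} =
        (in_state t \<beta>) \<inter> (in_state (t + s) \<gamma>)" by auto
    then show ?thesis by simp
  qed
  have "emeasure (law t \<alpha> \<beta>) A * emeasure (law s \<beta> \<gamma>) B =
      emeasure (P \<alpha>) {\<omega> \<in> H. J (t + s) \<omega> = \<gamma> \<and> \<xi> (t + s) \<omega> - \<xi> t \<omega> \<in> B}"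
    using markov_measure[OF t s HF _ B, of \<beta> \<alpha> \<gamma>] ts A B by (simp add: emeasure_law H_def)
  also have "{\<omega> \<in> H. J (t + s) \<omega> = \<gamma> \<and> \<xi> (t + s) \<omega> - \<xi> t \<omega> \<in> B} =
     {\<omega> \<in> space M. J t \<omega> = \<beta> \<and> J (t + s) \<omega> = \<gamma>} \<inter>
      ((\<lambda>\<omega>. (\<xi> t \<omega>, \<xi> (t + s) \<omega> - \<xi> t \<omega>)) -` (A \<times> B) \<inter> space (P \<alpha>))"
    by (auto simp: H_def space_P)
  also have "emeasure (P \<alpha>) \<dots> = emeasure (density (P \<alpha>) (indicator {\<omega> \<in> space M. J t \<omega> = \<beta> \<and> J (t + s) \<omega> = \<gamma>}))
      ((\<lambda>\<omega>. (\<xi> t \<omega>, \<xi> (t + s) \<omega> - \<xi> t \<omega>)) -` (A \<times> B) \<inter> space (P \<alpha>))"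
    by (rule emeasure_restricted[symmetric, OF E]) measurable
  also have "\<dots> = emeasure (distr (density (P \<alpha>) (indicator {\<omega> \<in> space M. J t \<omega> = \<beta> \<and> J (t + s) \<omega> = \<gamma>})) (borel \<Otimes>\<^sub>M borel)
      (\<lambda>\<omega>. (\<xi> t \<omega>, \<xi> (t + s) \<omega> - \<xi> t \<omega>))) (A \<times> B)"
    by (subst emeasure_distr) auto
  finally show "emeasure (law t \<alpha> \<beta>) A * emeasure (law s \<beta> \<gamma>) B = \<dots>" .
qed simp

lemma sum_indicator_J:
  "0 \<le> t \<Longrightarrow> \<omega> \<in> space M \<Longrightarrow>
    (\<Sum>\<beta>\<in>UNIV. indicator {\<omega> \<in> space M. J t \<omega> = \<beta> \<and> J s \<omega> = \<gamma>} \<omega>) =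
    (indicator (in_state s \<gamma>) \<omega> :: 'a::semiring_1)"
  by (simp add: indicator_def if_distrib sum.delta cong: if_cong)

text \<open>In \<open>[0, \<infinity>]\<close> the semigroup property holds without any moment condition; this is how finiteness of
  moments is transported between times and states.\<close>

lemma nn_mgf_semigroup:
  assumes t: "0 < t" and s: "0 < s"
  shows "nn_mgf p (t + s) \<alpha> \<gamma> = (\<Sum>\<beta>\<in>UNIV. nn_mgf p t \<alpha> \<beta> * nn_mgf p s \<beta> \<gamma>)"
proof -
  have ts: "0 \<le> t" "0 \<le> s" "0 \<le> t + s" using t s by auto
  note [measurable] = \<xi>_measurable[OF ts(1)] \<xi>_measurable[OF ts(3)] J_event[OF ts(1)] J_event[OF ts(3)]
  let ?I = "\<lambda>\<beta>. {\<omega> \<in> space M. J t \<omega> = \<beta> \<and> J (t + s) \<omega> = \<gamma>}"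
  have E[measurable]: "?I \<beta> \<in> sets (P \<alpha>)" for \<beta>
  proof -
    have "?I \<beta> = (in_state t \<beta>) \<inter> (in_state (t + s) \<gamma>)" by auto
    then show ?thesis by simp
  qed
  have "nn_mgf p (t + s) \<alpha> \<gamma> =
      (\<integral>\<^sup>+\<omega>. indicator (in_state (t + s) \<gamma>) \<omega> * ennreal (exp (p * \<xi> (t + s) \<omega>)) \<partial>P \<alpha>)"
    unfolding nn_mgf_def using ts by (simp add: nn_integral_law)
  also have "\<dots> = (\<integral>\<^sup>+\<omega>. (\<Sum>\<beta>\<in>UNIV. indicator (?I \<beta>) \<omega> * ennreal (exp (p * \<xi> (t + s) \<omega>))) \<partial>P \<alpha>)"
    by (rule nn_integral_cong) (simp add: sum_distrib_right[symmetric] sum_indicator_J[OF ts(1)] space_P)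
  also have "\<dots> = (\<Sum>\<beta>\<in>UNIV. \<integral>\<^sup>+\<omega>. indicator (?I \<beta>) \<omega> * ennreal (exp (p * \<xi> (t + s) \<omega>)) \<partial>P \<alpha>)"
    by (rule nn_integral_sum) measurable
  also have "\<dots> = (\<Sum>\<beta>\<in>UNIV. nn_mgf p t \<alpha> \<beta> * nn_mgf p s \<beta> \<gamma>)"
  proof (rule sum.cong[OF refl])
    fix \<beta>
    interpret l2: finite_measure "law s \<beta> \<gamma>" by (rule finite_measure_law[OF ts(2)])
    have ex: "ennreal (exp (p * \<xi> t \<omega>)) * ennreal (exp (p * (\<xi> (t + s) \<omega> - \<xi> t \<omega>))) = ennreal (exp (p * \<xi> (t + s) \<omega>))" for \<omega>
      by (simp add: ennreal_mult[symmetric] exp_add[symmetric] algebra_simps)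
    have "(\<integral>\<^sup>+\<omega>. indicator (?I \<beta>) \<omega> * ennreal (exp (p * \<xi> (t + s) \<omega>)) \<partial>P \<alpha>) =
        (\<integral>\<^sup>+x. ennreal (exp (p * fst x)) * ennreal (exp (p * snd x)) \<partial>(law t \<alpha> \<beta> \<Otimes>\<^sub>M law s \<beta> \<gamma>))"
      unfolding law_pair[OF t s]
      by (simp add: nn_integral_distr nn_integral_density ex)
    also have "\<dots> = (\<integral>\<^sup>+x. \<integral>\<^sup>+y. ennreal (exp (p * x)) * ennreal (exp (p * y)) \<partial>law s \<beta> \<gamma> \<partial>law t \<alpha> \<beta>)"
      by (subst l2.nn_integral_fst[symmetric]) auto
    also have "\<dots> = nn_mgf p t \<alpha> \<beta> * nn_mgf p s \<beta> \<gamma>"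
      unfolding nn_mgf_def by (simp add: nn_integral_cmult nn_integral_multc)
    finally show "(\<integral>\<^sup>+\<omega>. indicator (?I \<beta>) \<omega> * ennreal (exp (p * \<xi> (t + s) \<omega>)) \<partial>P \<alpha>) =
        nn_mgf p t \<alpha> \<beta> * nn_mgf p s \<beta> \<gamma>" .
  qed
  finally show ?thesis .
qed

lemma integrable_mgf:
  assumes "nn_mgf (Re z) t \<alpha> \<beta> < \<infinity>"
  shows "integrable (law t \<alpha> \<beta>) (\<lambda>x. exp (z * of_real x) :: complex)"
  using assms unfolding nn_mgf_def by (intro integrableI_bounded) (auto simp: norm_exp_eq_Re)

lemma mgf_semigroup:
  assumes t: "0 < t" and s: "0 < s"
    and fin: "\<And>\<alpha> \<beta>. nn_mgf (Re z) t \<alpha> \<beta> < \<infinity>" "\<And>\<alpha> \<beta>. nn_mgf (Re z) s \<alpha> \<beta> < \<infinity>"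
  shows "mgf z (t + s) \<alpha> \<gamma> = (\<Sum>\<beta>\<in>UNIV. mgf z t \<alpha> \<beta> * mgf z s \<beta> \<gamma>)"
proof -
  have ts: "0 \<le> t" "0 \<le> s" "0 \<le> t + s" using t s by auto
  note [measurable] = \<xi>_measurable[OF ts(1)] \<xi>_measurable[OF ts(3)] J_event[OF ts(1)] J_event[OF ts(3)]
  let ?I = "\<lambda>\<beta>. {\<omega> \<in> space M. J t \<omega> = \<beta> \<and> J (t + s) \<omega> = \<gamma>}"
  let ?e = "\<lambda>x::real. exp (z * of_real x) :: complex"
  have E[measurable]: "?I \<beta> \<in> sets (P \<alpha>)" for \<beta>
  proof -
    have "?I \<beta> = (in_state t \<beta>) \<inter> (in_state (t + s) \<gamma>)" by auto
    then show ?thesis by simp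
  qed
  have *: "integrable (law t \<alpha> \<beta> \<Otimes>\<^sub>M law s \<beta> \<gamma>) (\<lambda>x. ?e (fst x) * ?e (snd x)) \<and>
      (\<integral>x. ?e (fst x) * ?e (snd x) \<partial>(law t \<alpha> \<beta> \<Otimes>\<^sub>M law s \<beta> \<gamma>)) = mgf z t \<alpha> \<beta> * mgf z s \<beta> \<gamma>" for \<beta>
  proof -
    interpret l1: finite_measure "law t \<alpha> \<beta>" by (rule finite_measure_law[OF ts(1)])
    interpret l2: finite_measure "law s \<beta> \<gamma>" by (rule finite_measure_law[OF ts(2)])
    interpret pair_sigma_finite "law t \<alpha> \<beta>" "law s \<beta> \<gamma>" ..
    have i1: "integrable (law t \<alpha> \<beta>) ?e" and i2: "integrable (law s \<beta> \<gamma>) ?e"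
      using fin by (auto intro: integrable_mgf)
    have i: "integrable (law t \<alpha> \<beta> \<Otimes>\<^sub>M law s \<beta> \<gamma>) (\<lambda>x. ?e (fst x) * ?e (snd x))"
      by (rule Fubini_integrable)
         (use i1 i2 integrable_norm[OF i1] in \<open>auto simp: norm_mult simp del: norm_exp_eq_Re\<close>)
    have "(\<integral>x. ?e (fst x) * ?e (snd x) \<partial>(law t \<alpha> \<beta> \<Otimes>\<^sub>M law s \<beta> \<gamma>)) =
        (\<integral>x. (\<integral>y. ?e x * ?e y \<partial>law s \<beta> \<gamma>) \<partial>law t \<alpha> \<beta>)"
      by (subst integral_fst'[symmetric, OF i]) simp
    also have "\<dots> = mgf z t \<alpha> \<beta> * mgf z s \<beta> \<gamma>" by (simp add: mgf_def)
    finally show ?thesis using i by simp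
  qed
  have ex: "?e (\<xi> t \<omega>) * ?e (\<xi> (t + s) \<omega> - \<xi> t \<omega>) = ?e (\<xi> (t + s) \<omega>)" for \<omega>
    by (simp add: exp_add[symmetric] algebra_simps)
  have tr: "(\<integral>x. ?e (fst x) * ?e (snd x) \<partial>(law t \<alpha> \<beta> \<Otimes>\<^sub>M law s \<beta> \<gamma>)) =
      (\<integral>\<omega>. indicat_real (?I \<beta>) \<omega> *\<^sub>R ?e (\<xi> (t + s) \<omega>) \<partial>P \<alpha>)"
    "integrable (law t \<alpha> \<beta> \<Otimes>\<^sub>M law s \<beta> \<gamma>) (\<lambda>x. ?e (fst x) * ?e (snd x)) \<longleftrightarrow>
      integrable (P \<alpha>) (\<lambda>\<omega>. indicat_real (?I \<beta>) \<omega> *\<^sub>R ?e (\<xi> (t + s) \<omega>))" for \<beta>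
    unfolding law_pair[OF t s] ennreal_indicator[symmetric]
    by (simp_all add: integral_distr integral_density integrable_distr_eq integrable_density ex del: of_real_diff)
  have "mgf z (t + s) \<alpha> \<gamma> = (\<integral>\<omega>. indicat_real (in_state (t + s) \<gamma>) \<omega> *\<^sub>R ?e (\<xi> (t + s) \<omega>) \<partial>P \<alpha>)"
    unfolding mgf_def using ts by (simp add: integral_law)
  also have "\<dots> = (\<integral>\<omega>. (\<Sum>\<beta>\<in>UNIV. indicat_real (?I \<beta>) \<omega> *\<^sub>R ?e (\<xi> (t + s) \<omega>)) \<partial>P \<alpha>)"
    by (rule Bochner_Integration.integral_cong)
       (simp_all add: scaleR_sum_left[symmetric] sum_indicator_J[OF ts(1)] space_P)
  also have "\<dots> = (\<Sum>\<beta>\<in>UNIV. \<integral>\<omega>. indicat_real (?I \<beta>) \<omega> *\<^sub>R ?e (\<xi> (t + s) \<omega>) \<partial>P \<alpha>)"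
    by (rule Bochner_Integration.integral_sum) (use * tr(2) in blast)
  also have "\<dots> = (\<Sum>\<beta>\<in>UNIV. mgf z t \<alpha> \<beta> * mgf z s \<beta> \<gamma>)"
    unfolding tr(1)[symmetric] using * by simp
  finally show ?thesis .
qed

end

section \<open>Exponential moments at small times\<close>

lemma powr_le_split:
  fixes y R :: real
  assumes "0 \<le> \<theta>" "\<theta> < 1" "0 < R" "0 < y"
  shows "y powr \<theta> \<le> R powr \<theta> + R powr (\<theta> - 1) * y"
proof (cases "y \<le> R")
  case True
  then have "y powr \<theta> \<le> R powr \<theta>" using assms by (intro powr_mono2) auto
  then show ?thesis using assms by (simp add: add_increasing2)
next
  case False
  have "y powr \<theta> = y powr (\<theta> - 1) * y" using assms by (simp add: powr_diff)
  also have "\<dots> \<le> R powr (\<theta> - 1) * y"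
    using assms False by (intro mult_right_mono powr_mono2') auto
  finally show ?thesis by (simp add: add_increasing)
qed

text \<open>The device for uniform integrability: a moment of order \<open>\<theta> p\<close> with \<open>\<theta> < 1\<close> over an event
  is small as soon as the event is improbable and the moment of order \<open>p\<close> over it is bounded.\<close>

lemma exp_moment_split:
  fixes Z :: "'a \<Rightarrow> real"
  assumes M: "finite_measure M" and Z[measurable]: "Z \<in> borel_measurable M"
    and int: "integrable M (\<lambda>\<omega>. exp (p * Z \<omega>))"
    and \<theta>: "0 \<le> \<theta>" "\<theta> < 1"
  shows "integrable M (\<lambda>\<omega>. exp (\<theta> * p * Z \<omega>))"
    and "C \<in> sets M \<Longrightarrow> 0 < R \<Longrightarrow> (\<integral>\<omega>. indicat_real C \<omega> * exp (\<theta> * p * Z \<omega>) \<partial>M) \<le>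
      R powr \<theta> * measure M C + R powr (\<theta> - 1) * (\<integral>\<omega>. indicat_real C \<omega> * exp (p * Z \<omega>) \<partial>M)"
proof -
  interpret finite_measure M by (rule M)
  have le: "exp (\<theta> * p * x) \<le> R powr \<theta> + R powr (\<theta> - 1) * exp (p * x)" if "0 < R" for R x :: real
    using powr_le_split[OF \<theta> that, of "exp (p * x)"] by (simp add: powr_def mult_ac)
  show 1: "integrable M (\<lambda>\<omega>. exp (\<theta> * p * Z \<omega>))"
  proof (rule Bochner_Integration.integrable_bound)
    show "integrable M (\<lambda>\<omega>. 1 + exp (p * Z \<omega>))" using int by simp
    show "AE \<omega> in M. norm (exp (\<theta> * p * Z \<omega>)) \<le> norm (1 + exp (p * Z \<omega>))"
      using le[of 1] by (auto intro!: AE_I2 simp: abs_of_nonneg add_nonneg_nonneg)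
  qed measurable
  assume C[measurable]: "C \<in> sets M" and R: "0 < R"
  have iC: "integrable M (indicat_real C)"
    by (rule integrable_real_indicator[OF C]) (simp add: less_top[symmetric])
  have "(\<integral>\<omega>. indicat_real C \<omega> * exp (\<theta> * p * Z \<omega>) \<partial>M) \<le>
      (\<integral>\<omega>. R powr \<theta> * indicat_real C \<omega> + R powr (\<theta> - 1) * (indicat_real C \<omega> * exp (p * Z \<omega>)) \<partial>M)"
  proof (rule integral_mono)
    show "integrable M (\<lambda>\<omega>. indicat_real C \<omega> * exp (\<theta> * p * Z \<omega>))"
      using integrable_mult_indicator[OF C 1] by simp
    show "integrable M (\<lambda>\<omega>. R powr \<theta> * indicat_real C \<omega> + R powr (\<theta> - 1) * (indicat_real C \<omega> * exp (p * Z \<omega>)))"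
      using integrable_mult_indicator[OF C int] iC
      by (intro Bochner_Integration.integrable_add integrable_mult_right) auto
  qed (use le[OF R] in \<open>auto simp: indicator_def\<close>)
  also have "\<dots> = R powr \<theta> * measure M C + R powr (\<theta> - 1) * (\<integral>\<omega>. indicat_real C \<omega> * exp (p * Z \<omega>) \<partial>M)"
    using integrable_mult_indicator[OF C int] iC by (subst Bochner_Integration.integral_add) auto
  finally show "(\<integral>\<omega>. indicat_real C \<omega> * exp (\<theta> * p * Z \<omega>) \<partial>M) \<le>
      R powr \<theta> * measure M C + R powr (\<theta> - 1) * (\<integral>\<omega>. indicat_real C \<omega> * exp (p * Z \<omega>) \<partial>M)" .
qed

lemma tendsto_0_split:
  fixes f g :: "'a \<Rightarrow> real"
  assumes \<theta>: "\<theta> < 1" and g: "(g \<longlongrightarrow> 0) F" and f0: "\<forall>\<^sub>F x in F. 0 \<le> f x"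
    and le: "\<And>R. 0 < R \<Longrightarrow> \<forall>\<^sub>F x in F. f x \<le> R powr \<theta> * g x + R powr (\<theta> - 1) * K"
  shows "(f \<longlongrightarrow> 0) F"
proof (rule order_tendstoI)
  fix a :: real assume a: "a < 0"
  show "\<forall>\<^sub>F x in F. a < f x" using f0 by eventually_elim (use a in simp)
next
  fix a :: real assume a: "0 < a"
  have "((\<lambda>R. R powr (\<theta> - 1) * K) \<longlongrightarrow> 0 * K) at_top"
    by (intro tendsto_mult tendsto_const tendsto_neg_powr filterlim_ident) (use \<theta> in auto)
  then have "\<forall>\<^sub>F R in at_top. R powr (\<theta> - 1) * K < a / 2"
    by (intro order_tendstoD(2)[where y=0]) (use a in auto)
  then obtain R where R: "0 < R" "R powr (\<theta> - 1) * K < a / 2"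
    using eventually_happens[OF eventually_conj[OF _ eventually_gt_at_top[of "0::real"]]]
    by (metis trivial_limit_at_top_linorder)
  have "((\<lambda>x. R powr \<theta> * g x) \<longlongrightarrow> R powr \<theta> * 0) F" by (intro tendsto_intros g)
  then have "\<forall>\<^sub>F x in F. R powr \<theta> * g x < a / 2" by (intro order_tendstoD(2)[where y="R powr \<theta> * 0"]) (use a in auto)
  then show "\<forall>\<^sub>F x in F. f x < a" using le[OF R(1)]
    by eventually_elim (use R(2) in linarith)
qed

text \<open>Comparison of a small time \<open>h\<close> with a multiple of \<open>h\<close> of fixed order of magnitude, after
  which Bernoulli's inequality gives first-order bounds.\<close>

lemma obtain_multiple:
  fixes h \<delta> :: real
  assumes "0 < h" "h \<le> \<delta>"
  obtains n :: nat where "1 \<le> n" "real n * h \<le> \<delta>" "\<delta> \<le> 2 * real n * h"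
proof -
  define n where "n = nat \<lfloor>\<delta> / h\<rfloor>"
  have q: "1 \<le> \<delta> / h" using assms by simp
  then have eq: "real n = of_int \<lfloor>\<delta> / h\<rfloor>" unfolding n_def by (subst of_nat_nat) auto
  have n: "1 \<le> n" using q by (simp add: n_def le_nat_iff)
  have "real n \<le> \<delta> / h" "\<delta> / h < real n + 1" unfolding eq by linarith+
  moreover from this n have "\<delta> / h \<le> 2 * real n" by linarith
  ultimately show ?thesis using that[of n] n assms by (simp add: field_simps)
qed

text \<open>With \<open>x = 1 - y\<close>, one has \<open>x\<^sup>n \<le> (1 + y)\<^sup>-\<^sup>n \<le> 1 / (1 + n y)\<close> by Bernoulli's inequality.\<close>

lemma power_lower_bound_imp:
  fixes x c \<delta> h :: real
  assumes "0 < h" "h \<le> \<delta>" "0 < c" "0 < x"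
    and pow: "\<And>n. real n * h \<le> \<delta> \<Longrightarrow> c \<le> x ^ n"
  shows "1 - 2 / (c * \<delta>) * h \<le> x"
proof (cases "x < 1")
  case True
  obtain n where n: "1 \<le> n" "real n * h \<le> \<delta>" "\<delta> \<le> 2 * real n * h"
    using obtain_multiple[OF assms(1,2)] .
  define y where "y = 1 - x"
  have y: "0 < y" "y < 1" using True assms by (auto simp: y_def)
  have "(1 - y) * (1 + y) \<le> 1" using y by (simp add: algebra_simps)
  moreover have "0 \<le> (1 - y) * (1 + y)" using y by simp
  ultimately have "(1 - y) ^ n * (1 + y) ^ n \<le> 1"
    unfolding power_mult_distrib[symmetric] by (intro power_le_one)
  moreover have "1 + real n * y \<le> (1 + y) ^ n" using Bernoulli_inequality[of y n] y by simp
  moreover have "c \<le> (1 - y) ^ n" using pow[OF n(2)] by (simp add: y_def)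
  ultimately have "c * (1 + real n * y) \<le> 1"
    using mult_mono[of c "(1 - y) ^ n" "1 + real n * y" "(1 + y) ^ n"] assms y by simp
  then have "c * (real n * y) \<le> 1" using assms(3) by (simp add: distrib_left)
  have "c * \<delta> * y \<le> 2 * h"
  proof -
    have "c * \<delta> * y = \<delta> * (c * y)" by simp
    also have "\<dots> \<le> 2 * real n * h * (c * y)" using n(3) y assms by (intro mult_right_mono) auto
    also have "\<dots> = 2 * h * (c * (real n * y))" by simp
    also have "\<dots> \<le> 2 * h * 1" using \<open>c * (real n * y) \<le> 1\<close> assms by (intro mult_left_mono) auto
    finally show ?thesis by simp
  qed
  then have "y \<le> 2 / (c * \<delta>) * h" using assms by (simp add: field_simps)
  then show ?thesis by (simp add: y_def)
next
  case False
  have "0 \<le> 2 / (c * \<delta>) * h" using assms by simp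
  then show ?thesis using False by linarith
qed

lemma power_upper_bound_imp:
  fixes x K \<delta> h :: real
  assumes "0 < h" "h \<le> \<delta>" "0 \<le> K" and pow: "\<And>n. real n * h \<le> \<delta> \<Longrightarrow> x ^ n \<le> K"
  shows "x \<le> 1 + 2 * K / \<delta> * h"
proof (cases "1 < x")
  case True
  obtain n where n: "1 \<le> n" "real n * h \<le> \<delta>" "\<delta> \<le> 2 * real n * h"
    using obtain_multiple[OF assms(1,2)] .
  have "1 + real n * (x - 1) \<le> x ^ n" using Bernoulli_inequality[of "x - 1" n] True by simp
  then have "real n * (x - 1) \<le> K" using pow[OF n(2)] by simp
  then have "2 * h * (real n * (x - 1)) \<le> 2 * h * K" using assms by (intro mult_left_mono) auto
  moreover have "\<delta> * (x - 1) \<le> 2 * real n * h * (x - 1)" using n(3) True by (intro mult_right_mono) auto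
  ultimately have "\<delta> * (x - 1) \<le> 2 * h * K" by (simp add: mult_ac)
  then show ?thesis using assms by (simp add: field_simps)
next
  case False
  have "0 \<le> 2 * K / \<delta> * h" using assms by simp
  then show ?thesis using False by linarith
qed

section \<open>Levy processes\<close>

lemma process_sigma_event:
  assumes "\<And>t. 0 \<le> t \<Longrightarrow> X t \<in> measurable M S" "0 \<le> t" "A \<in> sets S"
  shows "{\<omega> \<in> space M. X t \<omega> \<in> A} \<in> process_sigma M S X"
proof -
  have "process_path X \<in> space M \<rightarrow> space (\<Pi>\<^sub>M t\<in>{0..}. S)"
    using assms(1)[THEN measurable_space] by (auto simp: space_PiM process_path_def)
  moreover have "{f \<in> space (\<Pi>\<^sub>M t\<in>{0..}. S). f t \<in> A} \<in> sets (\<Pi>\<^sub>M t\<in>{0..}. S)"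
    using assms(2,3) by (intro measurable_sets_Collect[OF measurable_component_singleton]) auto
  moreover have "{\<omega> \<in> space M. X t \<omega> \<in> A} = process_path X -` {f \<in> space (\<Pi>\<^sub>M t\<in>{0..}. S). f t \<in> A} \<inter> space M"
    using assms(2) calculation(1) by (auto simp: process_path_def)
  ultimately show ?thesis unfolding process_sigma_def by (simp only: in_vimage_algebra)
qed

lemma process_sigma_sets:
  assumes "\<And>t. 0 \<le> t \<Longrightarrow> X t \<in> measurable M S" "A \<in> process_sigma M S X"
  shows "A \<in> sets M"
proof -
  have m: "process_path X \<in> measurable M (\<Pi>\<^sub>M t\<in>{0..}. S)"
    unfolding process_path_def using assms(1) by (intro measurable_restrict) auto
  then have "process_path X \<in> space M \<rightarrow> space (\<Pi>\<^sub>M t\<in>{0..}. S)" by (auto dest: measurable_space)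
  then obtain B where "B \<in> sets (\<Pi>\<^sub>M t\<in>{0..}. S)" "A = process_path X -` B \<inter> space M"
    using assms(2) unfolding process_sigma_def by (auto simp: sets_vimage_algebra2)
  then show ?thesis using measurable_sets[OF m] by simp
qed

lemma process_law_distr:
  assumes "\<And>t. 0 \<le> t \<Longrightarrow> X t \<in> measurable M S" "0 \<le> t"
  shows "distr (process_law M S X) S (\<lambda>f. f t) = distr M S (X t)"
proof -
  have m: "process_path X \<in> measurable M (\<Pi>\<^sub>M t\<in>{0..}. S)"
    unfolding process_path_def using assms(1) by (intro measurable_restrict) auto
  show ?thesis unfolding process_law_def using assms(2)
    by (subst distr_distr[OF measurable_component_singleton m]) (auto simp: o_def process_path_def)
qed

locale levy =
  fixes M :: "'w measure" and X :: "real \<Rightarrow> 'w \<Rightarrow> real"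
  assumes levy: "levy_process M X"
begin

sublocale prob_space M using levy by (simp add: levy_process_def)

lemma X_measurable [measurable]: "0 \<le> t \<Longrightarrow> X t \<in> borel_measurable M"
  using levy by (simp add: levy_process_def)

lemma X_0: "AE \<omega> in M. X 0 \<omega> = 0"
  using levy by (simp add: levy_process_def)

lemma right_continuous: "AE \<omega> in M. \<forall>t\<ge>0. ((\<lambda>s. X s \<omega>) \<longlongrightarrow> X t \<omega>) (at_right t)"
  using levy by (auto simp: levy_process_def cadlag_def elim!: eventually_mono)

text \<open>Only rational times are used, so that the event is measurable with respect to the process; right
  continuity extends the bound to all times outside it.\<close>

definition escape :: "real \<Rightarrow> real \<Rightarrow> 'w set" where
  "escape \<epsilon> h = {\<omega> \<in> space M. \<exists>q::rat. 0 \<le> q \<and> of_rat q < h \<and> \<epsilon> < \<bar>X (of_rat q) \<omega>\<bar>}"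

lemma escape_process_sigma: "escape \<epsilon> h \<in> process_sigma M borel X"
proof -
  have "escape \<epsilon> h = (\<Union>q\<in>{q::rat. 0 \<le> q \<and> of_rat q < h}. {\<omega> \<in> space M. X (of_rat q) \<omega> \<in> {x. \<epsilon> < \<bar>x\<bar>}})"
    by (auto simp: escape_def)
  also have "\<dots> \<in> process_sigma M borel X"
    unfolding process_sigma_def
  proof (rule sets.countable_UN'')
    fix q :: rat assume "q \<in> {q. 0 \<le> q \<and> of_rat q < h}"
    moreover have "{x::real. \<epsilon> < \<bar>x\<bar>} \<in> sets borel" by measurable
    ultimately show "{\<omega> \<in> space M. X (of_rat q) \<omega> \<in> {x. \<epsilon> < \<bar>x\<bar>}} \<in>
        sets (vimage_algebra (space M) (process_path X) (\<Pi>\<^sub>M t\<in>{0..}. borel))"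
      by (intro process_sigma_event[unfolded process_sigma_def]) (auto simp: zero_le_of_rat_iff)
  qed auto
  finally show ?thesis .
qed

lemma escape_sets [measurable]: "escape \<epsilon> h \<in> sets M"
  by (rule process_sigma_sets[OF _ escape_process_sigma]) auto

lemma not_escape_imp:
  assumes rc: "\<forall>t\<ge>0. ((\<lambda>s. X s \<omega>) \<longlongrightarrow> X t \<omega>) (at_right t)" and \<omega>: "\<omega> \<in> space M" "\<omega> \<notin> escape \<epsilon> h"
    and s: "0 \<le> s" "s < h"
  shows "\<bar>X s \<omega>\<bar> \<le> \<epsilon>"
proof (rule ccontr)
  assume "\<not> \<bar>X s \<omega>\<bar> \<le> \<epsilon>"
  moreover have "((\<lambda>u. \<bar>X u \<omega>\<bar>) \<longlongrightarrow> \<bar>X s \<omega>\<bar>) (at_right s)" using rc s by (intro tendsto_intros) auto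
  ultimately have "\<forall>\<^sub>F u in at_right s. \<epsilon> < \<bar>X u \<omega>\<bar>" by (intro order_tendstoD) auto
  then obtain e where e: "s < e" "\<And>u. s < u \<Longrightarrow> u < e \<Longrightarrow> \<epsilon> < \<bar>X u \<omega>\<bar>"
    by (auto simp: eventually_at_right_field)
  obtain q :: rat where q: "s < of_rat q" "of_rat q < min e h"
    using of_rat_dense[of s "min e h"] e s by auto
  have "(0::real) < of_rat q" using s q by linarith
  then have "0 \<le> q" by (simp add: zero_less_of_rat_iff)
  then have "\<omega> \<in> escape \<epsilon> h" using e(2)[of "of_rat q"] \<omega> q
    unfolding escape_def by (auto intro!: exI[of _ q])
  with \<omega> show False by simp
qed

lemma escape_tendsto_0:
  assumes \<epsilon>: "0 < \<epsilon>"
  shows "((\<lambda>h. prob (escape \<epsilon> h)) \<longlongrightarrow> 0) (at_right 0)"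
proof -
  have mono: "escape \<epsilon> h \<subseteq> escape \<epsilon> h'" if "h \<le> h'" for h h'
    using that by (force simp: escape_def)
  have "(\<lambda>n. prob (escape \<epsilon> (inverse (real (Suc n))))) \<longlonglongrightarrow> prob (\<Inter>n. escape \<epsilon> (inverse (real (Suc n))))"
  proof (rule finite_Lim_measure_decseq)
    show "decseq (\<lambda>n. escape \<epsilon> (inverse (real (Suc n))))"
      by (intro decseq_SucI mono) (auto simp: field_simps)
  qed auto
  also have "prob (\<Inter>n. escape \<epsilon> (inverse (real (Suc n)))) = 0"
  proof -
    have "AE \<omega> in M. \<omega> \<notin> (\<Inter>n. escape \<epsilon> (inverse (real (Suc n))))"
      using X_0 right_continuous AE_space
    proof eventually_elim
      case (elim \<omega>)
      have "((\<lambda>s. \<bar>X s \<omega>\<bar>) \<longlongrightarrow> \<bar>X 0 \<omega>\<bar>) (at_right 0)" using elim by (intro tendsto_intros) auto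
      then have "\<forall>\<^sub>F s in at_right 0. \<bar>X s \<omega>\<bar> < \<epsilon>" using \<epsilon> elim by (intro order_tendstoD) auto
      then obtain e where e: "0 < e" "\<And>s. 0 < s \<Longrightarrow> s < e \<Longrightarrow> \<bar>X s \<omega>\<bar> < \<epsilon>"
        by (auto simp: eventually_at_right_field)
      obtain n where n: "inverse (real (Suc n)) < e" using reals_Archimedean[OF e(1)] by auto
      have "\<omega> \<notin> escape \<epsilon> (inverse (real (Suc n)))"
      proof
        assume "\<omega> \<in> escape \<epsilon> (inverse (real (Suc n)))"
        then obtain q :: rat where q: "0 \<le> q" "of_rat q < inverse (real (Suc n))" "\<epsilon> < \<bar>X (of_rat q) \<omega>\<bar>"
          by (auto simp: escape_def)
        show False
        proof (cases "q = 0")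
          case True then show False using q elim \<epsilon> by simp
        next
          case False
          then have "(0::real) < of_rat q" using q by (simp add: zero_less_of_rat_iff)
          then show False using e(2)[of "of_rat q"] q n by simp
        qed
      qed
      then show ?case by blast
    qed
    then show ?thesis by (intro measure_eq_0_null_sets) (auto simp: AE_iff_null_sets)
  qed
  finally have lim: "(\<lambda>n. prob (escape \<epsilon> (inverse (real (Suc n))))) \<longlonglongrightarrow> 0" .
  show ?thesis
  proof (rule order_tendstoI)
    fix a :: real assume "a < 0"
    then show "\<forall>\<^sub>F h in at_right 0. a < prob (escape \<epsilon> h)"
      by (intro always_eventually allI less_le_trans[OF _ measure_nonneg])
  next
    fix a :: real assume "0 < a"
    from order_tendstoD(2)[OF lim this] obtain n where n: "prob (escape \<epsilon> (inverse (real (Suc n)))) < a"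
      by (auto simp: eventually_sequentially)
    have "prob (escape \<epsilon> h) < a" if "h < inverse (real (Suc n))" for h
      using finite_measure_mono[OF mono[OF less_imp_le[OF that]]] n by simp
    then show "\<forall>\<^sub>F h in at_right 0. prob (escape \<epsilon> h) < a"
      unfolding eventually_at_right_field by (intro exI[of _ "inverse (real (Suc n))"]) auto
  qed
qed

lemma tail_tendsto_0:
  assumes \<epsilon>: "0 < \<epsilon>"
  shows "((\<lambda>h. prob {\<omega> \<in> space M. \<epsilon> < \<bar>X h \<omega>\<bar>}) \<longlongrightarrow> 0) (at_right 0)"
proof (rule tendsto_sandwich[OF _ _ tendsto_const])
  have pos: "\<forall>\<^sub>F h::real in at_right 0. 0 < h" by (auto simp: eventually_at_right_field intro: exI[of _ 1])
  have "filterlim (\<lambda>h::real. 2 * h) (at_right 0) (at_right 0)"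
    unfolding filterlim_at using pos by (auto intro!: tendsto_eq_intros elim!: eventually_mono)
  then show "((\<lambda>h. prob (escape \<epsilon> (2 * h))) \<longlongrightarrow> 0) (at_right 0)"
    by (rule filterlim_compose[OF escape_tendsto_0[OF \<epsilon>]])
  show "\<forall>\<^sub>F h in at_right 0. prob {\<omega> \<in> space M. \<epsilon> < \<bar>X h \<omega>\<bar>} \<le> prob (escape \<epsilon> (2 * h))"
    using pos
  proof eventually_elim
    case (elim h)
    show ?case
    proof (rule finite_measure_mono_AE)
      show "AE \<omega> in M. \<omega> \<in> {\<omega> \<in> space M. \<epsilon> < \<bar>X h \<omega>\<bar>} \<longrightarrow> \<omega> \<in> escape \<epsilon> (2 * h)"
        using right_continuous by eventually_elim (use not_escape_imp[of _ \<epsilon> "2*h" h] elim in force)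
    qed simp
  qed
qed (simp add: measure_nonneg)

lemma increments:
  assumes "0 \<le> s" "0 \<le> t"
  shows "indep_vars (\<lambda>_. borel) (\<lambda>i \<omega>. if i = 0 then X s \<omega> - X 0 \<omega> else X (s + t) \<omega> - X s \<omega>) {..<2::nat}"
    and "distr M borel (\<lambda>\<omega>. X (s + t) \<omega> - X s \<omega>) = distr M borel (X t)"
proof -
  define \<tau> where "\<tau> = (\<lambda>i::nat. if i = 0 then 0 else if i = 1 then s else s + t)"
  have "mono \<tau>" by (rule monoI) (use assms in \<open>simp add: \<tau>_def\<close>)
  moreover have "0 \<le> \<tau> 0" by (simp add: \<tau>_def)
  ultimately have *: "indep_vars (\<lambda>_. borel) (\<lambda>i \<omega>. X (\<tau> (Suc i)) \<omega> - X (\<tau> i) \<omega>) {..<2}"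
    using levy by (simp add: levy_process_def)
  show "indep_vars (\<lambda>_. borel) (\<lambda>i \<omega>. if i = 0 then X s \<omega> - X 0 \<omega> else X (s + t) \<omega> - X s \<omega>) {..<2::nat}"
    by (rule indep_vars_cong[THEN iffD1, OF refl _ refl *]) (auto simp: \<tau>_def fun_eq_iff less_2_cases_iff)
  show "distr M borel (\<lambda>\<omega>. X (s + t) \<omega> - X s \<omega>) = distr M borel (X t)"
    using levy assms by (simp add: levy_process_def)
qed

definition nn_moment :: "real \<Rightarrow> real \<Rightarrow> ennreal" where
  "nn_moment p t = (\<integral>\<^sup>+\<omega>. ennreal (exp (p * X t \<omega>)) \<partial>M)"

lemma nn_moment_add:
  assumes st: "0 \<le> s" "0 \<le> t"
  shows "nn_moment p (s + t) = nn_moment p s * nn_moment p t"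
proof -
  let ?I = "\<lambda>i \<omega>. if i = (0::nat) then X s \<omega> - X 0 \<omega> else X (s + t) \<omega> - X s \<omega>"
  note [measurable] = X_measurable[OF st(1)] X_measurable[OF st(2)] X_measurable[OF add_nonneg_nonneg[OF st]] X_measurable[of 0]
  have "nn_moment p (s + t) = (\<integral>\<^sup>+\<omega>. (\<Prod>i\<in>{..<2}. ennreal (exp (p * ?I i \<omega>))) \<partial>M)"
    unfolding nn_moment_def
    by (intro nn_integral_cong_AE, use X_0 in eventually_elim)
       (simp add: numeral_2_eq_2 ennreal_mult[symmetric] exp_add[symmetric] algebra_simps)
  also have "\<dots> = (\<Prod>i\<in>{..<2}. \<integral>\<^sup>+\<omega>. ennreal (exp (p * ?I i \<omega>)) \<partial>M)"
    by (rule indep_vars_nn_integral[OF _ indep_vars_compose2[OF increments(1)[OF st], where Y="\<lambda>_ x. ennreal (exp (p * x))" and N="\<lambda>_. borel"]])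
       auto
  also have "\<dots> = (\<integral>\<^sup>+\<omega>. ennreal (exp (p * (X s \<omega> - X 0 \<omega>))) \<partial>M) *
      (\<integral>\<^sup>+\<omega>. ennreal (exp (p * (X (s + t) \<omega> - X s \<omega>))) \<partial>M)"
    by (simp add: numeral_2_eq_2 mult.commute)
  also have "(\<integral>\<^sup>+\<omega>. ennreal (exp (p * (X s \<omega> - X 0 \<omega>))) \<partial>M) = nn_moment p s"
    unfolding nn_moment_def by (intro nn_integral_cong_AE, use X_0 in eventually_elim) simp
  also have "(\<integral>\<^sup>+\<omega>. ennreal (exp (p * (X (s + t) \<omega> - X s \<omega>))) \<partial>M) =
      (\<integral>\<^sup>+x. ennreal (exp (p * x)) \<partial>distr M borel (\<lambda>\<omega>. X (s + t) \<omega> - X s \<omega>))"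
    by (subst nn_integral_distr) auto
  also have "\<dots> = nn_moment p t"
    unfolding increments(2)[OF st] nn_moment_def by (subst nn_integral_distr) auto
  finally show ?thesis .
qed

lemma nn_moment_0: "nn_moment p 0 = 1"
proof -
  have "nn_moment p 0 = (\<integral>\<^sup>+\<omega>. 1 \<partial>M)"
    unfolding nn_moment_def by (intro nn_integral_cong_AE, use X_0 in eventually_elim) simp
  then show ?thesis by (simp add: emeasure_space_1)
qed

lemma nn_moment_power: "0 \<le> t \<Longrightarrow> nn_moment p (real n * t) = nn_moment p t ^ n"
proof (induction n)
  case (Suc n)
  have "nn_moment p (real (Suc n) * t) = nn_moment p (t + real n * t)" by (simp add: distrib_right)
  also have "\<dots> = nn_moment p t * nn_moment p (real n * t)" using Suc by (intro nn_moment_add) auto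
  finally show ?case using Suc by simp
qed (simp add: nn_moment_0)

text \<open>Finiteness spreads from small times to all times, since \<open>X\<^sub>t\<close> is a sum of \<open>n\<close> independent copies of
  \<open>X\<^sub>t\<^sub>/\<^sub>n\<close>.\<close>

lemma nn_moment_finite:
  assumes small: "\<forall>\<^sub>F h in at_right 0. nn_moment p h < \<infinity>" and t: "0 \<le> t"
  shows "nn_moment p t < \<infinity>"
proof (cases "t = 0")
  case False
  obtain d where d: "0 < d" "\<And>h. 0 < h \<Longrightarrow> h < d \<Longrightarrow> nn_moment p h < \<infinity>"
    using small by (auto simp: eventually_at_right_field)
  obtain n where n: "t / d < real n" using reals_Archimedean2 by blast
  have t': "0 < t" using False t by simp
  then have "0 < real n" using n d by (meson divide_pos_pos less_trans)
  then have "nn_moment p (t / real n) < \<infinity>" using n d t' by (intro d(2)) (auto simp: field_simps)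
  then have "nn_moment p (real n * (t / real n)) < \<infinity>"
    using t by (subst nn_moment_power) (auto intro: power_less_top_ennreal[THEN iffD2])
  then show ?thesis using \<open>0 < real n\<close> by simp
qed (simp add: nn_moment_0)

end

text \<open>The exponential moment of order \<open>p\<close> is finite. Laplace exponents are studied at the orders
  \<open>\<theta> p\<close> with \<open>0 \<le> \<theta> < 1\<close>, where this moment gives uniform integrability.\<close>

locale levy_moment = levy +
  fixes p :: real
  assumes moment_finite: "\<forall>\<^sub>F h in at_right 0. nn_moment p h < \<infinity>"
begin

lemma moment_integrable: "0 \<le> t \<Longrightarrow> integrable M (\<lambda>\<omega>. exp (p * X t \<omega>))"
  using nn_moment_finite[OF moment_finite, of t] unfolding nn_moment_def
  by (intro integrableI_bounded) auto

definition moment :: "real \<Rightarrow> real" where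
  "moment t = (\<integral>\<omega>. exp (p * X t \<omega>) \<partial>M)"

lemma ennreal_moment: "0 \<le> t \<Longrightarrow> ennreal (moment t) = nn_moment p t"
  unfolding moment_def nn_moment_def using moment_integrable by (subst nn_integral_eq_integral) auto

lemma moment_nonneg: "0 \<le> moment t"
  unfolding moment_def by (rule integral_nonneg_AE) simp

lemma moment_add: "0 \<le> s \<Longrightarrow> 0 \<le> t \<Longrightarrow> moment (s + t) = moment s * moment t"
  using nn_moment_add[of s t p]
  by (simp add: ennreal_moment[symmetric] ennreal_mult[symmetric] moment_nonneg)

lemma moment_power: "0 \<le> t \<Longrightarrow> moment (real n * t) = moment t ^ n"
  using nn_moment_power[of t p n]
  by (simp add: ennreal_moment[symmetric] ennreal_power moment_nonneg)

text \<open>For small \<open>t\<close> the process stays within distance 1 of its start with probability at least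
  one half.\<close>

lemma moment_lower_bound:
  obtains \<delta> where "0 < \<delta>" "\<And>t. 0 < t \<Longrightarrow> t \<le> \<delta> \<Longrightarrow> exp (- \<bar>p\<bar>) / 2 \<le> moment t"
proof -
  have "\<forall>\<^sub>F h in at_right 0. prob {\<omega> \<in> space M. 1 < \<bar>X h \<omega>\<bar>} < 1/2"
    by (rule order_tendstoD(2)[OF tail_tendsto_0]) auto
  then obtain d where d: "0 < d" "\<And>h. 0 < h \<Longrightarrow> h < d \<Longrightarrow> prob {\<omega> \<in> space M. 1 < \<bar>X h \<omega>\<bar>} < 1/2"
    by (auto simp: eventually_at_right_field)
  have "exp (- \<bar>p\<bar>) / 2 \<le> moment t" if t: "0 < t" "t \<le> d / 2" for t
  proof -
    note [measurable] = X_measurable[OF less_imp_le[OF t(1)]]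
    define A where "A = {\<omega> \<in> space M. \<bar>X t \<omega>\<bar> \<le> 1}"
    have A[measurable]: "A \<in> sets M" unfolding A_def by measurable
    have "A = space M - {\<omega> \<in> space M. 1 < \<bar>X t \<omega>\<bar>}" by (auto simp: A_def)
    then have "prob A = 1 - prob {\<omega> \<in> space M. 1 < \<bar>X t \<omega>\<bar>}" by (simp add: prob_compl)
    then have pA: "1/2 \<le> prob A" using d(2)[of t] t d(1) by simp
    have "exp (- \<bar>p\<bar>) / 2 \<le> exp (- \<bar>p\<bar>) * prob A" using mult_left_mono[OF pA, of "exp (- \<bar>p\<bar>)"] by simp
    also have "\<dots> = (\<integral>\<omega>. exp (- \<bar>p\<bar>) * indicat_real A \<omega> \<partial>M)" by simp
    also have "\<dots> \<le> moment t"
      unfolding moment_def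
    proof (rule integral_mono[OF _ moment_integrable])
      fix \<omega>
      have "- \<bar>p\<bar> \<le> p * X t \<omega>" if "\<bar>X t \<omega>\<bar> \<le> 1"
        using mult_left_mono[OF that, of "\<bar>p\<bar>"] by (simp add: abs_mult[symmetric])
      then show "exp (- \<bar>p\<bar>) * indicat_real A \<omega> \<le> exp (p * X t \<omega>)"
        by (auto simp: A_def indicator_def)
    qed (use t in \<open>auto intro!: integrable_mult_right integrable_real_indicator simp: less_top[symmetric]\<close>)
    finally show ?thesis .
  qed
  then show ?thesis using d(1) by (intro that[of "d/2"]) auto
qed

text \<open>The moments of \<open>X\<^sub>n\<^sub>h\<close>, that is, the powers of that of \<open>X\<^sub>h\<close>, are bounded below as long as \<open>n h \<le> \<delta>\<close>.\<close>

lemma moment_ge: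
  obtains \<delta> K where "0 < \<delta>" "0 \<le> K" "\<And>h. 0 < h \<Longrightarrow> h \<le> \<delta> \<Longrightarrow> 1 - K * h \<le> moment h"
proof -
  obtain \<delta> where \<delta>: "0 < \<delta>" and lb: "\<And>t. 0 < t \<Longrightarrow> t \<le> \<delta> \<Longrightarrow> exp (- \<bar>p\<bar>) / 2 \<le> moment t"
    using moment_lower_bound by blast
  let ?c = "exp (- \<bar>p\<bar>) / 2"
  have "1 - 2 / (?c * \<delta>) * h \<le> moment h" if h: "0 < h" "h \<le> \<delta>" for h
  proof (rule power_lower_bound_imp[OF h])
    show c0: "0 < ?c" by simp
    show "0 < moment h" using lb[OF h] c0 by (rule less_le_trans[rotated])
    fix n assume n: "real n * h \<le> \<delta>"
    show "?c \<le> moment h ^ n"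
    proof (cases "n = 0")
      case False
      then show ?thesis using lb[of "real n * h"] n h by (simp add: moment_power)
    next
      case True
      have "exp (- \<bar>p\<bar>) \<le> 1" by simp
      then have "exp (- \<bar>p\<bar>) \<le> 2" by linarith
      then show ?thesis using True by simp
    qed
  qed
  then show ?thesis using \<delta> by (intro that[of \<delta> "2 / (?c * \<delta>)"]) auto
qed

text \<open>The lower bound at the complementary time \<open>\<delta> - h\<close> bounds the factor at time \<open>h\<close> from above.\<close>

lemma moment_bounded:
  obtains \<delta> K where "0 < \<delta>" "\<And>h. 0 < h \<Longrightarrow> h < \<delta> \<Longrightarrow> moment h \<le> K"
proof -
  obtain \<delta> where \<delta>: "0 < \<delta>" and lb: "\<And>t. 0 < t \<Longrightarrow> t \<le> \<delta> \<Longrightarrow> exp (- \<bar>p\<bar>) / 2 \<le> moment t"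
    using moment_lower_bound by blast
  let ?c = "exp (- \<bar>p\<bar>) / 2"
  have "moment h \<le> moment \<delta> / ?c" if h: "0 < h" "h < \<delta>" for h
  proof -
    have "moment h * ?c \<le> moment h * moment (\<delta> - h)"
      using lb[of "\<delta> - h"] h moment_nonneg by (intro mult_left_mono) auto
    also have "\<dots> = moment \<delta>" using moment_add[of h "\<delta> - h"] h by simp
    finally show ?thesis by (simp add: field_simps)
  qed
  then show ?thesis using \<delta> by (intro that)
qed

lemma moment_gf_integrable:
  assumes \<theta>: "0 \<le> \<theta>" "\<theta> < 1" and z: "Re z = \<theta> * p" and t: "0 \<le> t"
  shows "integrable M (\<lambda>\<omega>. exp (z * complex_of_real (X t \<omega>)))"
proof -
  note [measurable] = X_measurable[OF t]
  have "integrable M (\<lambda>\<omega>. norm (exp (z * complex_of_real (X t \<omega>))))"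
    using exp_moment_split(1)[OF finite_measure_axioms X_measurable[OF t] moment_integrable[OF t] \<theta>]
    by (simp add: norm_exp_eq_Re z)
  then show ?thesis by (subst (asm) integrable_norm_iff) auto
qed

lemma moment_gf_add:
  assumes \<theta>: "0 \<le> \<theta>" "\<theta> < 1" and z: "Re z = \<theta> * p" and st: "0 \<le> s" "0 \<le> t"
  shows "moment_gf M (X (s + t)) z = moment_gf M (X s) z * moment_gf M (X t) z"
proof -
  let ?I = "\<lambda>i \<omega>. if i = (0::nat) then X s \<omega> - X 0 \<omega> else X (s + t) \<omega> - X s \<omega>"
  let ?e = "\<lambda>x::real. exp (z * complex_of_real x)"
  note [measurable] = X_measurable[OF st(1)] X_measurable[OF st(2)] X_measurable[OF add_nonneg_nonneg[OF st]] X_measurable[of 0]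
  have inc: "(\<integral>\<omega>. ?e (X (s + t) \<omega> - X s \<omega>) \<partial>M) = moment_gf M (X t) z"
    "integrable M (\<lambda>\<omega>. ?e (X (s + t) \<omega> - X s \<omega>))"
  proof -
    have "(\<integral>\<omega>. ?e (X (s + t) \<omega> - X s \<omega>) \<partial>M) = (\<integral>x. ?e x \<partial>distr M borel (\<lambda>\<omega>. X (s + t) \<omega> - X s \<omega>))"
      by (subst integral_distr) auto
    also have "\<dots> = moment_gf M (X t) z"
      unfolding increments(2)[OF st] moment_gf_def by (subst integral_distr) auto
    finally show "(\<integral>\<omega>. ?e (X (s + t) \<omega> - X s \<omega>) \<partial>M) = moment_gf M (X t) z" .
    have "integrable (distr M borel (\<lambda>\<omega>. X (s + t) \<omega> - X s \<omega>)) ?e"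
      unfolding increments(2)[OF st] using moment_gf_integrable[OF \<theta> z st(2)]
      by (subst integrable_distr_eq) auto
    then show "integrable M (\<lambda>\<omega>. ?e (X (s + t) \<omega> - X s \<omega>))"
      by (subst (asm) integrable_distr_eq) auto
  qed
  have first: "(\<integral>\<omega>. ?e (X s \<omega> - X 0 \<omega>) \<partial>M) = moment_gf M (X s) z" "integrable M (\<lambda>\<omega>. ?e (X s \<omega> - X 0 \<omega>))"
  proof -
    have ae: "AE \<omega> in M. ?e (X s \<omega> - X 0 \<omega>) = ?e (X s \<omega>)" using X_0 by eventually_elim simp
    show "(\<integral>\<omega>. ?e (X s \<omega> - X 0 \<omega>) \<partial>M) = moment_gf M (X s) z"
      unfolding moment_gf_def by (rule integral_cong_AE[OF _ _ ae]) measurable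
    show "integrable M (\<lambda>\<omega>. ?e (X s \<omega> - X 0 \<omega>))"
      using moment_gf_integrable[OF \<theta> z st(1)] by (subst integrable_cong_AE[OF _ _ ae]) auto
  qed
  have int: "integrable M (\<lambda>\<omega>. ?e (?I i \<omega>))" for i
    using inc(2) first(2) by (cases "i = 0") simp_all
  have "moment_gf M (X (s + t)) z = (\<integral>\<omega>. (\<Prod>i\<in>{..<2}. ?e (?I i \<omega>)) \<partial>M)"
    unfolding moment_gf_def
  proof (rule integral_cong_AE)
    show "AE \<omega> in M. ?e (X (s + t) \<omega>) = (\<Prod>i\<in>{..<2}. ?e (?I i \<omega>))"
      using X_0 by eventually_elim (simp add: numeral_2_eq_2 exp_add[symmetric] algebra_simps)
    show "(\<lambda>\<omega>. \<Prod>i\<in>{..<2}. ?e (?I i \<omega>)) \<in> borel_measurable M" by (simp add: numeral_2_eq_2)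
  qed measurable
  also have "\<dots> = (\<Prod>i\<in>{..<2}. \<integral>\<omega>. ?e (?I i \<omega>) \<partial>M)"
    by (rule indep_vars_lebesgue_integral[OF _ indep_vars_compose2[OF increments(1)[OF st], where Y="\<lambda>_. ?e" and N="\<lambda>_. borel"]])
       (use int in auto)
  also have "\<dots> = moment_gf M (X s) z * moment_gf M (X t) z"
    using inc first by (simp add: numeral_2_eq_2 mult.commute)
  finally show ?thesis .
qed

text \<open>Where \<open>X\<^sub>h\<close> is small the integrand is close to 1. The rest has small probability and, by
  \<open>exp_moment_split\<close>, a small share of the moment.\<close>

lemma moment_gf_tendsto_1:
  assumes \<theta>: "0 \<le> \<theta>" "\<theta> < 1" and z: "Re z = \<theta> * p"
  shows "((\<lambda>h. moment_gf M (X h) z) \<longlongrightarrow> 1) (at_right 0)"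
proof (rule tendstoI)
  fix e :: real assume e: "0 < e"
  have pos: "\<forall>\<^sub>F h::real in at_right 0. 0 < h" by (auto simp: eventually_at_right_field intro: exI[of _ 1])
  have "((\<lambda>x. exp (z * complex_of_real x)) \<longlongrightarrow> exp (z * complex_of_real 0)) (at 0)" by (intro tendsto_intros)
  then have "\<forall>\<^sub>F x in at 0. dist (exp (z * complex_of_real x)) (exp (z * complex_of_real 0)) < e / 2"
    using e by (intro tendstoD) auto
  then obtain d where d: "0 < d" "\<And>x. x \<noteq> 0 \<Longrightarrow> \<bar>x\<bar> < d \<Longrightarrow> norm (exp (z * complex_of_real x) - 1) < e / 2"
    by (auto simp: eventually_at dist_norm)
  define \<epsilon> where "\<epsilon> = d / 2"
  have \<epsilon>: "0 < \<epsilon>" "\<And>x. \<bar>x\<bar> \<le> \<epsilon> \<Longrightarrow> norm (exp (z * complex_of_real x) - 1) \<le> e / 2"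
  proof -
    fix x :: real assume "\<bar>x\<bar> \<le> \<epsilon>"
    then show "norm (exp (z * complex_of_real x) - 1) \<le> e / 2"
      using d(1) d(2)[of x] e by (cases "x = 0") (auto simp: \<epsilon>_def)
  qed (use d in \<open>simp add: \<epsilon>_def\<close>)
  define C where "C = (\<lambda>h. {\<omega> \<in> space M. \<epsilon> < \<bar>X h \<omega>\<bar>})"
  define f where "f = (\<lambda>h. \<integral>\<omega>. indicat_real (C h) \<omega> * exp (\<theta> * p * X h \<omega>) \<partial>M)"
  have C: "C h \<in> sets M" if "0 \<le> h" for h
    using X_measurable[OF that] unfolding C_def by measurable
  have tail: "((\<lambda>h. prob (C h)) \<longlongrightarrow> 0) (at_right 0)" unfolding C_def by (rule tail_tendsto_0[OF \<epsilon>(1)])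
  obtain \<delta> K where \<delta>: "0 < \<delta>" and K: "\<And>h. 0 < h \<Longrightarrow> h < \<delta> \<Longrightarrow> moment h \<le> K"
    using moment_bounded by blast
  have lt: "\<forall>\<^sub>F h in at_right 0. 0 < h \<and> h < \<delta>" using \<delta> by (auto simp: eventually_at_right_field)
  have f: "(f \<longlongrightarrow> 0) (at_right 0)"
  proof (rule tendsto_0_split[OF \<theta>(2) tail])
    show "\<forall>\<^sub>F h in at_right 0. 0 \<le> f h"
      unfolding f_def by (intro always_eventually allI integral_nonneg_AE) auto
    fix R :: real assume R: "0 < R"
    show "\<forall>\<^sub>F h in at_right 0. f h \<le> R powr \<theta> * prob (C h) + R powr (\<theta> - 1) * K"
      using lt
    proof eventually_elim
      case (elim h)
      then have h: "0 \<le> h" by simp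
      have "f h \<le> R powr \<theta> * prob (C h) + R powr (\<theta> - 1) * (\<integral>\<omega>. indicat_real (C h) \<omega> * exp (p * X h \<omega>) \<partial>M)"
        unfolding f_def
        by (rule exp_moment_split(2)[OF finite_measure_axioms X_measurable[OF h] moment_integrable[OF h] \<theta> C[OF h] R])
      also have "(\<integral>\<omega>. indicat_real (C h) \<omega> * exp (p * X h \<omega>) \<partial>M) \<le> moment h"
        unfolding moment_def
        using integrable_mult_indicator[OF C[OF h] moment_integrable[OF h]] moment_integrable[OF h]
        by (intro integral_mono) (auto simp: indicator_def)
      also have "moment h \<le> K" using K elim by simp
      finally show ?case by (simp add: mult_left_mono)
    qed
  qed
  have "((\<lambda>h. e / 2 + (f h + prob (C h))) \<longlongrightarrow> e / 2 + (0 + 0)) (at_right 0)" by (intro tendsto_intros f tail)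
  then have "\<forall>\<^sub>F h in at_right 0. e / 2 + (f h + prob (C h)) < e" by (rule order_tendstoD(2)) (use e in simp)
  then show "\<forall>\<^sub>F h in at_right 0. dist (moment_gf M (X h) z) 1 < e" using pos
  proof eventually_elim
    case (elim h)
    then have h: "0 \<le> h" by simp
    note [measurable] = X_measurable[OF h] C[OF h]
    note int = moment_gf_integrable[OF \<theta> z h]
    note int' = exp_moment_split(1)[OF finite_measure_axioms X_measurable[OF h] moment_integrable[OF h] \<theta>]
    have "moment_gf M (X h) z - 1 = (\<integral>\<omega>. (exp (z * complex_of_real (X h \<omega>)) - 1) \<partial>M)"
      unfolding moment_gf_def using int by (simp add: prob_space)
    also have "norm \<dots> \<le> (\<integral>\<omega>. norm (exp (z * complex_of_real (X h \<omega>)) - 1) \<partial>M)" by (rule integral_norm_bound)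
    also have "\<dots> \<le> (\<integral>\<omega>. e / 2 + (indicat_real (C h) \<omega> * exp (\<theta> * p * X h \<omega>) + indicat_real (C h) \<omega>) \<partial>M)"
    proof (rule integral_mono_AE)
      show "AE \<omega> in M. norm (exp (z * complex_of_real (X h \<omega>)) - 1) \<le>
          e / 2 + (indicat_real (C h) \<omega> * exp (\<theta> * p * X h \<omega>) + indicat_real (C h) \<omega>)"
      proof (rule AE_I2)
        fix \<omega> assume \<omega>: "\<omega> \<in> space M"
        show "norm (exp (z * complex_of_real (X h \<omega>)) - 1) \<le>
          e / 2 + (indicat_real (C h) \<omega> * exp (\<theta> * p * X h \<omega>) + indicat_real (C h) \<omega>)"
        proof (cases "\<omega> \<in> C h")
          case True
          have "norm (exp (z * complex_of_real (X h \<omega>)) - 1) \<le> norm (exp (z * complex_of_real (X h \<omega>))) + norm (1::complex)"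
            by (rule norm_triangle_ineq4)
          then show ?thesis using True e by (simp add: norm_exp_eq_Re z)
        next
          case False
          then show ?thesis using \<omega> \<epsilon>(2)[of "X h \<omega>"] by (simp add: C_def)
        qed
      qed
      show "integrable M (\<lambda>\<omega>. e / 2 + (indicat_real (C h) \<omega> * exp (\<theta> * p * X h \<omega>) + indicat_real (C h) \<omega>))"
        using integrable_mult_indicator[OF C[OF h] int'] by (simp add: less_top[symmetric])
      show "integrable M (\<lambda>\<omega>. norm (exp (z * complex_of_real (X h \<omega>)) - 1))" using int by simp
    qed
    also have "\<dots> = e / 2 + (f h + prob (C h))"
      unfolding f_def using integrable_mult_indicator[OF C[OF h] int']
      by (simp add: prob_space less_top[symmetric])
    finally show ?case using elim by (simp add: dist_norm)
  qed
qed

text \<open>A continuous multiplicative function is an exponential, and its exponent is the unique one that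
  the definite description in the definition can pick.\<close>

lemma moment_gf_eq_exp:
  assumes \<theta>: "0 \<le> \<theta>" "\<theta> < 1" and z: "Re z = \<theta> * p" and t: "0 \<le> t"
  shows "moment_gf M (X t) z = exp (complex_of_real t * laplace_exponent M X z)"
proof -
  have "moment_gf M (X 0) z = (\<integral>\<omega>. 1 \<partial>M)"
    unfolding moment_gf_def by (rule integral_cong_AE) (use X_0 in \<open>auto elim!: eventually_mono\<close>)
  then have f0: "moment_gf M (X 0) z = 1" by (simp add: prob_space)
  obtain w where w: "\<And>t. 0 \<le> t \<Longrightarrow> moment_gf M (X t) z = exp (complex_of_real t * w)"
    using continuous_multiplicative_imp_exp[of "\<lambda>t. moment_gf M (X t) z"]
      moment_gf_add[OF \<theta> z] f0 moment_gf_tendsto_1[OF \<theta> z] by auto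
  have "laplace_exponent M X z = w"
    unfolding laplace_exponent_def
  proof (rule the_equality)
    fix w' assume w': "\<forall>t\<ge>0. moment_gf M (X t) z = exp (complex_of_real t * w')"
    \<comment> \<open>Both exponents are the derivative at time 0.\<close>
    have d: "((\<lambda>t. exp (complex_of_real t * v)) has_vector_derivative v) (at 0 within {0..})" for v
      by (rule has_vector_derivative_real_field) (auto intro!: derivative_eq_intros)
    have "((\<lambda>t. exp (complex_of_real t * w)) has_vector_derivative w') (at 0 within {0..})"
      by (rule has_vector_derivative_transform[OF _ _ d[of w']]) (use w w' in auto)
    then show "w' = w"
      using d[of w] vector_derivative_unique_within[of 0 "{0..}"]
      by (metis at_within_Ici_at_right trivial_limit_at_right_real)
  qed (use w in auto)
  then show ?thesis using w[OF t] by simp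
qed

end

section \<open>The chain at small times\<close>

text \<open>The reverse Fatou lemma for events: a limit superior of events is at least as probable as
  the events are in the limit.\<close>

lemma (in finite_measure) measure_frequently_ge:
  fixes c :: "nat \<Rightarrow> real"
  assumes A[measurable]: "\<And>n. A n \<in> sets M"
    and c: "c \<longlonglongrightarrow> l" "\<forall>\<^sub>F n in sequentially. c n \<le> measure M (A n)"
  shows "{\<omega> \<in> space M. \<exists>\<^sub>F n in sequentially. \<omega> \<in> A n} \<in> sets M"
    and "l \<le> measure M {\<omega> \<in> space M. \<exists>\<^sub>F n in sequentially. \<omega> \<in> A n}"
proof -
  define B where "B = (\<lambda>m. \<Union>n\<in>{m..}. A n)"
  have B: "B m \<in> sets M" for m unfolding B_def by measurable
  have eq: "{\<omega> \<in> space M. \<exists>\<^sub>F n in sequentially. \<omega> \<in> A n} = (\<Inter>m. B m)"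
    using sets.sets_into_space[OF A] by (auto simp: B_def frequently_sequentially) blast
  show "{\<omega> \<in> space M. \<exists>\<^sub>F n in sequentially. \<omega> \<in> A n} \<in> sets M"
    unfolding eq using B by (intro sets.countable_INT) auto
  have "(\<lambda>m. measure M (B m)) \<longlonglongrightarrow> measure M (\<Inter>m. B m)"
  proof (rule finite_Lim_measure_decseq)
    show "decseq B" unfolding B_def decseq_def by (intro allI impI UN_mono) auto
  qed (use B in auto)
  then show "l \<le> measure M {\<omega> \<in> space M. \<exists>\<^sub>F n in sequentially. \<omega> \<in> A n}"
    unfolding eq
  proof (rule LIMSEQ_le_const)
    have "l \<le> measure M (B m)" for m
    proof (rule tendsto_upperbound[OF c(1)])
      show "\<forall>\<^sub>F n in sequentially. c n \<le> measure M (B m)"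
        using c(2) eventually_ge_at_top[of m]
      proof eventually_elim
        case (elim n)
        have "measure M (A n) \<le> measure M (B m)"
          by (rule finite_measure_mono[OF _ B]) (use elim in \<open>auto simp: B_def\<close>)
        with elim show ?case by simp
      qed
    qed simp
    then show "\<exists>N. \<forall>n\<ge>N. l \<le> measure M (B n)" by blast
  qed
qed

locale markov_additive_chain = markov_additive_process M P \<F> J \<xi>
  for M :: "'w measure" and P :: "'e::finite \<Rightarrow> 'w measure" and \<F> J \<xi> +
  fixes q :: "'e \<Rightarrow> 'e \<Rightarrow> real"
  assumes rates: "ctmc_with_rates P \<F> J q" and irreducible: "irreducible_rates q"
begin

definition trans_prob :: "real \<Rightarrow> 'e \<Rightarrow> 'e \<Rightarrow> real" where
  "trans_prob t \<alpha> \<beta> = measure (P \<alpha>) (in_state t \<beta>)"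

definition exit_rate :: "'e \<Rightarrow> real" where
  "exit_rate \<alpha> = (\<Sum>\<gamma>\<in>UNIV - {\<alpha>}. q \<alpha> \<gamma>)"

lemma right_pos: "\<forall>\<^sub>F h::real in at_right 0. 0 < h"
  by (auto simp: eventually_at_right_field intro: exI[of _ 1])

lemma trans_prob_nonneg: "0 \<le> trans_prob t \<alpha> \<beta>"
  by (simp add: trans_prob_def)

lemma trans_prob_le_1: "trans_prob t \<alpha> \<beta> \<le> 1"
  unfolding trans_prob_def by (rule prob_space.prob_le_1[OF prob])

lemma sum_trans_prob: "0 \<le> t \<Longrightarrow> (\<Sum>\<beta>\<in>UNIV. trans_prob t \<alpha> \<beta>) = 1"
proof -
  assume t: "0 \<le> t"
  interpret prob_space "P \<alpha>" by (rule prob)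
  have "(\<Sum>\<beta>\<in>UNIV. trans_prob t \<alpha> \<beta>) = prob (\<Union>\<beta>\<in>UNIV. (in_state t \<beta>))"
    unfolding trans_prob_def using t by (intro finite_measure_finite_Union[symmetric]) (auto simp: disjoint_family_on_def)
  also have "(\<Union>\<beta>\<in>UNIV. (in_state t \<beta>)) = space (P \<alpha>)" by (auto simp: space_P)
  finally show ?thesis by (simp add: prob_space)
qed

lemma one_minus_trans_prob: "0 \<le> t \<Longrightarrow> 1 - trans_prob t \<alpha> \<alpha> = (\<Sum>\<beta>\<in>UNIV - {\<alpha>}. trans_prob t \<alpha> \<beta>)"
  using sum_trans_prob[of t \<alpha>] sum.remove[of UNIV \<alpha> "trans_prob t \<alpha>"] by simp

lemma trans_prob_rate: "\<alpha> \<noteq> \<beta> \<Longrightarrow> ((\<lambda>h. trans_prob h \<alpha> \<beta> / h) \<longlongrightarrow> q \<alpha> \<beta>) (at_right 0)"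
  using rates by (simp add: ctmc_with_rates_def trans_prob_def space_P)

lemma q_nonneg: "\<alpha> \<noteq> \<beta> \<Longrightarrow> 0 \<le> q \<alpha> \<beta>"
  by (rule tendsto_lowerbound[OF trans_prob_rate _ trivial_limit_at_right_real], assumption)
     (rule eventually_mono[OF right_pos], simp add: trans_prob_nonneg)

lemma exit_rate_nonneg: "0 \<le> exit_rate \<alpha>"
  unfolding exit_rate_def by (intro sum_nonneg) (auto intro: q_nonneg)

lemma trans_prob_exit_rate: "((\<lambda>h. (1 - trans_prob h \<alpha> \<alpha>) / h) \<longlongrightarrow> exit_rate \<alpha>) (at_right 0)"
proof -
  have "((\<lambda>h. \<Sum>\<beta>\<in>UNIV - {\<alpha>}. trans_prob h \<alpha> \<beta> / h) \<longlongrightarrow> exit_rate \<alpha>) (at_right 0)"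
    unfolding exit_rate_def by (intro tendsto_sum trans_prob_rate) auto
  then show ?thesis
    by (rule tendsto_eventually_eq)
       (rule eventually_mono[OF right_pos], simp_all add: one_minus_trans_prob sum_divide_distrib)
qed

lemma trans_prob_tendsto_1: "((\<lambda>h. trans_prob h \<alpha> \<alpha>) \<longlongrightarrow> 1) (at_right 0)"
proof -
  have "((\<lambda>h. 1 - h * ((1 - trans_prob h \<alpha> \<alpha>) / h)) \<longlongrightarrow> 1 - 0 * exit_rate \<alpha>) (at_right 0)"
    by (intro tendsto_intros trans_prob_exit_rate)
  then show ?thesis
    by (rule tendsto_eventually_eq[OF _ eventually_mono[OF right_pos]]) simp_all
qed

lemma markov_chain_event:
  assumes "0 < t" "0 < s" "H \<in> sets (\<F> t)" "\<And>\<omega>. \<omega> \<in> H \<Longrightarrow> J t \<omega> = \<beta>"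
  shows "measure (P \<alpha>) {\<omega> \<in> H. J (t + s) \<omega> = \<gamma>} = measure (P \<alpha>) H * trans_prob s \<beta> \<gamma>"
proof -
  have "measure (P \<alpha>) {\<omega> \<in> H. J (t + s) \<omega> = \<gamma> \<and> \<xi> (t + s) \<omega> - \<xi> t \<omega> \<in> UNIV} =
      measure (P \<alpha>) H * measure (P \<beta>) {\<omega> \<in> space M. J s \<omega> = \<gamma> \<and> \<xi> s \<omega> \<in> UNIV}"
    unfolding measure_def by (subst markov_measure[OF assms]) (simp_all add: enn2real_mult)
  then show ?thesis by (simp add: trans_prob_def)
qed

lemma grid_event_sets:
  assumes \<delta>: "0 \<le> \<delta>"
  shows "{\<omega> \<in> space M. \<forall>i\<le>n. J (real i * \<delta>) \<omega> = e i} \<in> sets (\<F> (real n * \<delta>))"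
proof -
  have eq: "{\<omega> \<in> space M. \<forall>i\<le>n. J (real i * \<delta>) \<omega> = e i} =
      (\<Inter>i\<in>{..n}. {\<omega> \<in> space M. J (real i * \<delta>) \<omega> = e i})" by auto
  have "{\<omega> \<in> space M. J (real i * \<delta>) \<omega> = e i} \<in> sets (\<F> (real n * \<delta>))" if i: "i \<le> n" for i
  proof -
    have "{\<omega> \<in> space M. J (real i * \<delta>) \<omega> = e i} \<in> sets (\<F> (real i * \<delta>))"
      using measurable_sets[OF J_measurable_\<F>[of "real i * \<delta>"], of "{e i}"] \<delta>
      by (simp add: space_\<F> vimage_def Int_def conj_commute)
    moreover have "real i * \<delta> \<le> real n * \<delta>" using i \<delta> by (intro mult_right_mono) auto
    ultimately show ?thesis using sets_\<F>_mono by blast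
  qed
  then show ?thesis unfolding eq by (intro sets.finite_INT) auto
qed

lemma grid_event_sets_P:
  "0 \<le> \<delta> \<Longrightarrow> {\<omega> \<in> space M. \<forall>i\<le>n. J (real i * \<delta>) \<omega> = e i} \<in> sets (P \<alpha>)"
  by (rule sets_\<F>_P[OF _ grid_event_sets]) simp_all

lemma grid_event_prob:
  assumes \<delta>: "0 < \<delta>"
  shows "measure (P \<alpha>) {\<omega> \<in> space M. \<forall>i\<le>n. J (real i * \<delta>) \<omega> = e i} =
    of_bool (e 0 = \<alpha>) * (\<Prod>i<n. trans_prob \<delta> (e i) (e (Suc i)))"
proof (induction n)
  case 0
  interpret prob_space "P \<alpha>" by (rule prob)
  show ?case
  proof (cases "e 0 = \<alpha>")
    case True
    have "AE \<omega> in P \<alpha>. \<omega> \<in> {\<omega> \<in> space M. J 0 \<omega> = e 0}"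
      using start AE_space by eventually_elim (use True in \<open>simp add: space_P\<close>)
    then have "prob {\<omega> \<in> space M. J 0 \<omega> = e 0} = 1"
      by (subst prob_eq_1) auto
    then show ?thesis using True by simp
  next
    case False
    have "AE \<omega> in P \<alpha>. \<omega> \<notin> {\<omega> \<in> space M. J 0 \<omega> = e 0}"
      using start by eventually_elim (use False in auto)
    then have "prob {\<omega> \<in> space M. J 0 \<omega> = e 0} = 0"
      by (subst prob_eq_0) auto
    then show ?thesis using False by simp
  qed
next
  case (Suc n)
  interpret prob_space "P \<alpha>" by (rule prob)
  let ?H = "{\<omega> \<in> space M. \<forall>i\<le>n. J (real i * \<delta>) \<omega> = e i}"
  have eq: "{\<omega> \<in> space M. \<forall>i\<le>Suc n. J (real i * \<delta>) \<omega> = e i} = {\<omega> \<in> ?H. J (real n * \<delta> + \<delta>) \<omega> = e (Suc n)}"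
    by (auto simp: le_Suc_eq distrib_right add.commute)
  show ?case
  proof (cases "n = 0")
    case False
    have "measure (P \<alpha>) {\<omega> \<in> ?H. J (real n * \<delta> + \<delta>) \<omega> = e (Suc n)} = measure (P \<alpha>) ?H * trans_prob \<delta> (e n) (e (Suc n))"
    proof (rule markov_chain_event)
      show "0 < real n * \<delta>" "0 < \<delta>" using False \<delta> by simp_all
      show "?H \<in> sets (\<F> (real n * \<delta>))" using \<delta> by (intro grid_event_sets) simp
      show "\<And>\<omega>. \<omega> \<in> ?H \<Longrightarrow> J (real n * \<delta>) \<omega> = e n" by blast
    qed
    then show ?thesis by (simp only: eq Suc.IH prod.lessThan_Suc mult.assoc)
  next
    case True
    have "prob {\<omega> \<in> ?H. J (real n * \<delta> + \<delta>) \<omega> = e (Suc n)} = of_bool (e 0 = \<alpha>) * trans_prob \<delta> (e 0) (e 1)"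
    proof (cases "e 0 = \<alpha>")
      case e: True
      have "prob {\<omega> \<in> ?H. J (real n * \<delta> + \<delta>) \<omega> = e (Suc n)} = prob {\<omega> \<in> space M. J \<delta> \<omega> = e 1}"
      proof (rule finite_measure_eq_AE)
        show "AE \<omega> in P \<alpha>. (\<omega> \<in> {\<omega> \<in> ?H. J (real n * \<delta> + \<delta>) \<omega> = e (Suc n)}) = (\<omega> \<in> {\<omega> \<in> space M. J \<delta> \<omega> = e 1})"
          using start by eventually_elim (simp add: True e conj_commute)
        show "{\<omega> \<in> ?H. J (real n * \<delta> + \<delta>) \<omega> = e (Suc n)} \<in> events"
          unfolding eq[symmetric] using \<delta> by (intro grid_event_sets_P) auto
      qed (use \<delta> in auto)
      then show ?thesis using e by (simp add: trans_prob_def)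
    next
      case e: False
      have "AE \<omega> in P \<alpha>. \<omega> \<notin> {\<omega> \<in> ?H. J (real n * \<delta> + \<delta>) \<omega> = e (Suc n)}"
        using start by eventually_elim (use e in \<open>simp add: True\<close>)
      moreover have "{\<omega> \<in> ?H. J (real n * \<delta> + \<delta>) \<omega> = e (Suc n)} \<in> events"
        unfolding eq[symmetric] using \<delta> by (intro grid_event_sets_P) auto
      ultimately have "prob {\<omega> \<in> ?H. J (real n * \<delta> + \<delta>) \<omega> = e (Suc n)} = 0"
        using prob_eq_0 by blast
      then show ?thesis using e by (simp only: of_bool_eq mult_zero_left)
    qed
    moreover have "(\<Prod>i<Suc n. trans_prob \<delta> (e i) (e (Suc i))) = trans_prob \<delta> (e 0) (e 1)" using True by simp
    ultimately show ?thesis by (simp only: eq)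
  qed
qed

text \<open>These events say that the chain stays in \<open>\<alpha>\<close> up to time \<open>h\<close>, respectively that it makes exactly one
  jump, from \<open>\<alpha>\<close> to \<open>\<beta>\<close>, up to time \<open>h\<close>. As limits superior of grid events they are measurable with
  respect to the chain, and for right-continuous paths they have the stated meaning.\<close>

definition const_event :: "real \<Rightarrow> 'e \<Rightarrow> 'w set" where
  "const_event h \<alpha> = {\<omega> \<in> space M. \<exists>\<^sub>F n in sequentially. grid_const (\<lambda>t. J t \<omega>) h \<alpha> n}"

definition switch_event :: "real \<Rightarrow> 'e \<Rightarrow> 'e \<Rightarrow> 'w set" where
  "switch_event h \<alpha> \<beta> = {\<omega> \<in> space M. \<exists>\<^sub>F n in sequentially. grid_switch (\<lambda>t. J t \<omega>) h \<alpha> \<beta> n}"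

lemma tendsto_grid_step:
  assumes h: "0 < h"
  shows "filterlim (\<lambda>n. h / real n) (at_right 0) sequentially"
proof -
  have "\<forall>\<^sub>F n in sequentially. h / real n \<in> {0<..} \<and> h / real n \<noteq> 0"
    using eventually_gt_at_top[of "0::nat"]
  proof eventually_elim
    case (elim n)
    then have "0 < h / real n" using h by simp
    then show ?case by (metis greaterThan_iff less_irrefl)
  qed
  then show ?thesis unfolding filterlim_at by (rule conjI[OF _ lim_const_over_n])
qed

lemma tendsto_grid_rate:
  assumes h: "0 < h" and f: "((\<lambda>h. f h / h) \<longlongrightarrow> r) (at_right 0)"
  shows "(\<lambda>n. real n * f (h / real n)) \<longlonglongrightarrow> h * r"
proof -
  have "(\<lambda>n. h * (f (h / real n) / (h / real n))) \<longlonglongrightarrow> h * r"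
    by (intro tendsto_intros filterlim_compose[OF f tendsto_grid_step[OF h]])
  then show ?thesis
    by (rule tendsto_eventually_eq[OF _ always_eventually]) (use h in simp_all)
qed

text \<open>The chain is constant on the \<open>n\<close>-th grid with probability \<open>P\<^sub>h\<^sub>/\<^sub>n(\<alpha>, \<alpha>)\<^sup>n\<close>, which Bernoulli's inequality
  bounds below by \<open>1 - n (1 - P\<^sub>h\<^sub>/\<^sub>n(\<alpha>, \<alpha>))\<close>.\<close>

lemma const_event_sets: "0 < h \<Longrightarrow> const_event h \<alpha> \<in> sets (P \<gamma>)"
  and const_event_prob: "0 < h \<Longrightarrow> 1 - h * exit_rate \<alpha> \<le> measure (P \<alpha>) (const_event h \<alpha>)"
proof -
  assume h: "0 < h"
  define A where "A = (\<lambda>n. {\<omega> \<in> space M. grid_const (\<lambda>t. J t \<omega>) h \<alpha> n})"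
  have A: "A n \<in> sets (P \<gamma>)" for n \<gamma>
    unfolding A_def grid_const_def using h by (intro grid_event_sets_P) auto
  have eq: "const_event h \<alpha> = {\<omega> \<in> space (P \<gamma>). \<exists>\<^sub>F n in sequentially. \<omega> \<in> A n}" for \<gamma>
    by (auto simp: const_event_def A_def space_P)
  have pA: "\<forall>\<^sub>F n in sequentially. 1 - real n * (1 - trans_prob (h / real n) \<alpha> \<alpha>) \<le> measure (P \<alpha>) (A n)"
    using eventually_gt_at_top[of 0]
  proof eventually_elim
    case (elim n)
    have "measure (P \<alpha>) (A n) = trans_prob (h / real n) \<alpha> \<alpha> ^ n"
      unfolding A_def grid_const_def using h elim by (subst grid_event_prob) auto
    moreover have "1 + real n * (trans_prob (h / real n) \<alpha> \<alpha> - 1) \<le> (1 + (trans_prob (h / real n) \<alpha> \<alpha> - 1)) ^ n"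
      using trans_prob_nonneg[of "h / real n" \<alpha> \<alpha>] by (intro Bernoulli_inequality) simp
    ultimately show ?case by (simp add: algebra_simps)
  qed
  have lim: "(\<lambda>n. 1 - real n * (1 - trans_prob (h / real n) \<alpha> \<alpha>)) \<longlonglongrightarrow> 1 - h * exit_rate \<alpha>"
    by (intro tendsto_intros tendsto_grid_rate[OF h trans_prob_exit_rate])
  interpret prob_space "P \<alpha>" by (rule prob)
  show "const_event h \<alpha> \<in> sets (P \<gamma>)"
  proof -
    interpret g: prob_space "P \<gamma>" by (rule prob)
    show ?thesis
      unfolding eq[of \<gamma>] by (rule g.measure_frequently_ge(1)[OF A, of "\<lambda>_. 0" 0]) auto
  qed
  show "1 - h * exit_rate \<alpha> \<le> measure (P \<alpha>) (const_event h \<alpha>)"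
    unfolding eq[of \<alpha>] by (rule measure_frequently_ge(2)[OF A lim pA])
qed

lemma const_event_imp: "0 < h \<Longrightarrow> \<omega> \<in> const_event h \<alpha> \<Longrightarrow> J h \<omega> = \<alpha>"
proof -
  assume h: "0 < h" and "\<omega> \<in> const_event h \<alpha>"
  then have "\<exists>\<^sub>F n in sequentially. grid_const (\<lambda>t. J t \<omega>) h \<alpha> n \<and> 0 < n"
    by (intro frequently_eventually_frequently eventually_gt_at_top) (simp add: const_event_def)
  then obtain n where "grid_const (\<lambda>t. J t \<omega>) h \<alpha> n" "0 < n" using frequently_ex by blast
  then show ?thesis unfolding grid_const_def by (auto dest: spec[of _ n])
qed

text \<open>The jump takes place in one of the \<open>n\<close> steps of the grid. With \<open>a\<close>, \<open>b\<close>, \<open>c\<close> the transition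
  probabilities \<open>\<alpha> \<rightarrow> \<alpha>\<close>, \<open>\<alpha> \<rightarrow> \<beta>\<close>, \<open>\<beta> \<rightarrow> \<beta>\<close> of a step, each of these disjoint events has probability
  at least \<open>b (a c)\<^sup>n\<close>.\<close>

lemma grid_switch_prob:
  assumes h: "0 < h" and n: "0 < n" and ab: "\<alpha> \<noteq> \<beta>"
  defines "\<delta> \<equiv> h / real n"
  shows "{\<omega> \<in> space M. grid_switch (\<lambda>t. J t \<omega>) h \<alpha> \<beta> n} \<in> sets (P \<gamma>)"
    and "real n * trans_prob \<delta> \<alpha> \<beta> * (1 - real n * (1 - trans_prob \<delta> \<alpha> \<alpha>) - real n * (1 - trans_prob \<delta> \<beta> \<beta>)) \<le>
      measure (P \<alpha>) {\<omega> \<in> space M. grid_switch (\<lambda>t. J t \<omega>) h \<alpha> \<beta> n}"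
proof -
  define e where "e = (\<lambda>k i::nat. if i \<le> k then \<alpha> else \<beta>)"
  define E where "E = (\<lambda>k. {\<omega> \<in> space M. \<forall>i\<le>n. J (real i * \<delta>) \<omega> = e k i})"
  have \<delta>: "0 < \<delta>" using h n by (simp add: \<delta>_def)
  have eq: "{\<omega> \<in> space M. grid_switch (\<lambda>t. J t \<omega>) h \<alpha> \<beta> n} = (\<Union>k<n. E k)"
    by (auto simp: grid_switch_def E_def e_def \<delta>_def)
  have E: "E k \<in> sets (P \<gamma>)" for k \<gamma>
    unfolding E_def using \<delta> by (intro grid_event_sets_P) auto
  show "{\<omega> \<in> space M. grid_switch (\<lambda>t. J t \<omega>) h \<alpha> \<beta> n} \<in> sets (P \<gamma>)"
    unfolding eq using E by auto
  have disj: "E k \<inter> E l = {}" if "k < l" "l < n" for k l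
  proof -
    have "e k l \<noteq> e l l" using that ab by (auto simp: e_def)
    then show ?thesis using that unfolding E_def by (auto dest!: spec[of _ l])
  qed
  interpret prob_space "P \<alpha>" by (rule prob)
  let ?a = "trans_prob \<delta> \<alpha> \<alpha>" and ?b = "trans_prob \<delta> \<alpha> \<beta>" and ?c = "trans_prob \<delta> \<beta> \<beta>"
  have lb: "?b * (?a * ?c) ^ n \<le> prob (E k)" if k: "k < n" for k
  proof -
    have "prob (E k) = (\<Prod>i<n. trans_prob \<delta> (e k i) (e k (Suc i)))"
      unfolding E_def by (subst grid_event_prob[OF \<delta>]) (simp add: e_def)
    also have "\<dots> = trans_prob \<delta> (e k k) (e k (Suc k)) * (\<Prod>i\<in>{..<n} - {k}. trans_prob \<delta> (e k i) (e k (Suc i)))"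
      using k by (intro prod.remove) auto
    also have "trans_prob \<delta> (e k k) (e k (Suc k)) = ?b" by (simp add: e_def)
    finally have eqp: "prob (E k) = ?b * (\<Prod>i\<in>{..<n} - {k}. trans_prob \<delta> (e k i) (e k (Suc i)))" .
    have ac: "0 \<le> ?a * ?c" "?a * ?c \<le> 1" "?a * ?c \<le> ?a" "?a * ?c \<le> ?c"
      using trans_prob_nonneg[of \<delta>] trans_prob_le_1[of \<delta>] by (auto intro: mult_le_one mult_left_le mult_left_le_one_le)
    have "(?a * ?c) ^ n \<le> (?a * ?c) ^ (n - 1)" by (rule power_decreasing) (use ac in auto)
    also have "\<dots> = (\<Prod>i\<in>{..<n} - {k}. ?a * ?c)" using k by simp
    also have "\<dots> \<le> (\<Prod>i\<in>{..<n} - {k}. trans_prob \<delta> (e k i) (e k (Suc i)))"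
    proof (rule prod_mono)
      fix i assume "i \<in> {..<n} - {k}"
      then have "trans_prob \<delta> (e k i) (e k (Suc i)) \<in> {?a, ?c}" by (auto simp: e_def)
      then show "0 \<le> ?a * ?c \<and> ?a * ?c \<le> trans_prob \<delta> (e k i) (e k (Suc i))" using ac by auto
    qed
    finally show ?thesis unfolding eqp using trans_prob_nonneg by (intro mult_left_mono)
  qed
  have ac: "0 \<le> ?a" "?a \<le> 1" "0 \<le> ?c" "?c \<le> 1" using trans_prob_nonneg[of \<delta>] trans_prob_le_1[of \<delta>] by auto
  have "1 - real n * (1 - ?a) - real n * (1 - ?c) \<le> (?a * ?c) ^ n"
  proof -
    have "0 \<le> (1 - ?a) * (1 - ?c)" using ac by (intro mult_nonneg_nonneg) auto
    then have *: "?a + ?c - 1 \<le> ?a * ?c" by (simp add: algebra_simps)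
    have "1 - real n * (1 - ?a) - real n * (1 - ?c) = 1 + real n * (?a + ?c - 1 - 1)" by (simp add: algebra_simps)
    also have "\<dots> \<le> 1 + real n * (?a * ?c - 1)" using * by (intro add_left_mono mult_left_mono) auto
    also have "\<dots> \<le> (1 + (?a * ?c - 1)) ^ n" using ac by (intro Bernoulli_inequality) simp
    finally show ?thesis by simp
  qed
  then have "real n * ?b * (1 - real n * (1 - ?a) - real n * (1 - ?c)) \<le> real n * ?b * (?a * ?c) ^ n"
    using trans_prob_nonneg by (intro mult_left_mono) auto
  also have "\<dots> = (\<Sum>k<n. ?b * (?a * ?c) ^ n)" by simp
  also have "\<dots> \<le> (\<Sum>k<n. prob (E k))" by (rule sum_mono) (use lb in auto)
  also have "\<dots> = prob (\<Union>k<n. E k)"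
  proof (rule finite_measure_finite_Union[symmetric])
    show "disjoint_family_on E {..<n}"
      unfolding disjoint_family_on_def
    proof (intro ballI impI)
      fix k l assume "k \<in> {..<n}" "l \<in> {..<n}" "k \<noteq> l"
      then have "k < l \<and> l < n \<or> l < k \<and> k < n" by auto
      then show "E k \<inter> E l = {}" using disj[of k l] disj[of l k] by (elim disjE conjE) (simp_all add: Int_commute)
    qed
    show "E ` {..<n} \<subseteq> events" using E by blast
  qed simp
  finally show "real n * ?b * (1 - real n * (1 - ?a) - real n * (1 - ?c)) \<le>
      prob {\<omega> \<in> space M. grid_switch (\<lambda>t. J t \<omega>) h \<alpha> \<beta> n}" unfolding eq .
qed

text \<open>To first order in \<open>h\<close> this lower bound is the whole probability of \<open>{J\<^sub>h = \<beta>}\<close>, so two or more jumps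
  before time \<open>h\<close> that lead to \<open>\<beta>\<close> have probability \<open>o(h)\<close>.\<close>

lemma switch_event_sets: "0 < h \<Longrightarrow> \<alpha> \<noteq> \<beta> \<Longrightarrow> switch_event h \<alpha> \<beta> \<in> sets (P \<gamma>)"
  and switch_event_prob: "0 < h \<Longrightarrow> \<alpha> \<noteq> \<beta> \<Longrightarrow>
    h * q \<alpha> \<beta> * (1 - h * exit_rate \<alpha> - h * exit_rate \<beta>) \<le> measure (P \<alpha>) (switch_event h \<alpha> \<beta>)"
proof -
  assume h: "0 < h" and ab: "\<alpha> \<noteq> \<beta>"
  \<comment> \<open>The grid with \<open>n = 0\<close> has step \<open>h / 0 = 0\<close> and is left out.\<close>
  define A where "A = (\<lambda>n. if n = 0 then {} else {\<omega> \<in> space M. grid_switch (\<lambda>t. J t \<omega>) h \<alpha> \<beta> n})"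
  have A: "A n \<in> sets (P \<gamma>)" for n \<gamma>
    using grid_switch_prob(1)[OF h _ ab, of n \<gamma>] by (cases "n = 0") (auto simp: A_def)
  have eq: "switch_event h \<alpha> \<beta> = {\<omega> \<in> space (P \<gamma>). \<exists>\<^sub>F n in sequentially. \<omega> \<in> A n}" for \<gamma>
  proof -
    have "(\<exists>\<^sub>F n in sequentially. grid_switch (\<lambda>t. J t \<omega>) h \<alpha> \<beta> n) \<longleftrightarrow> (\<exists>\<^sub>F n in sequentially. \<omega> \<in> A n)"
      if "\<omega> \<in> space M" for \<omega>
    proof (rule frequently_cong[OF eventually_gt_at_top[of 0]])
      fix n :: nat assume "0 < n"
      then show "grid_switch (\<lambda>t. J t \<omega>) h \<alpha> \<beta> n \<longleftrightarrow> \<omega> \<in> A n" using that by (simp add: A_def)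
    qed
    then show ?thesis unfolding switch_event_def space_P by blast
  qed
  let ?c = "\<lambda>n. real n * trans_prob (h / real n) \<alpha> \<beta> * (1 - real n * (1 - trans_prob (h / real n) \<alpha> \<alpha>) - real n * (1 - trans_prob (h / real n) \<beta> \<beta>))"
  have pA: "\<forall>\<^sub>F n in sequentially. ?c n \<le> measure (P \<alpha>) (A n)"
    using eventually_gt_at_top[of 0]
    by eventually_elim (use grid_switch_prob(2)[OF h _ ab] in \<open>auto simp: A_def\<close>)
  have lim: "?c \<longlonglongrightarrow> h * q \<alpha> \<beta> * (1 - h * exit_rate \<alpha> - h * exit_rate \<beta>)"
    by (intro tendsto_intros tendsto_grid_rate[OF h trans_prob_exit_rate] tendsto_grid_rate[OF h trans_prob_rate[OF ab]])
  show "switch_event h \<alpha> \<beta> \<in> sets (P \<gamma>)"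
  proof -
    interpret g: prob_space "P \<gamma>" by (rule prob)
    show ?thesis
      unfolding eq[of \<gamma>] by (rule g.measure_frequently_ge(1)[OF A, of "\<lambda>_. 0" 0]) auto
  qed
  interpret prob_space "P \<alpha>" by (rule prob)
  show "h * q \<alpha> \<beta> * (1 - h * exit_rate \<alpha> - h * exit_rate \<beta>) \<le> measure (P \<alpha>) (switch_event h \<alpha> \<beta>)"
    unfolding eq[of \<alpha>] by (rule measure_frequently_ge(2)[OF A lim pA])
qed

lemma switch_event_imp: "0 < h \<Longrightarrow> \<omega> \<in> switch_event h \<alpha> \<beta> \<Longrightarrow> J h \<omega> = \<beta>"
proof -
  assume h: "0 < h" and "\<omega> \<in> switch_event h \<alpha> \<beta>"
  then have "\<exists>\<^sub>F n in sequentially. grid_switch (\<lambda>t. J t \<omega>) h \<alpha> \<beta> n \<and> 0 < n"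
    by (intro frequently_eventually_frequently eventually_gt_at_top) (simp add: switch_event_def)
  then obtain n where "grid_switch (\<lambda>t. J t \<omega>) h \<alpha> \<beta> n" "0 < n" using frequently_ex by blast
  then show ?thesis unfolding grid_switch_def by (auto dest!: spec[of _ n])
qed

lemma right_continuous_path_J: "AE \<omega> in P \<alpha>. right_continuous_path (\<lambda>t. J t \<omega>)"
  using cadlag
proof eventually_elim
  case (elim \<omega>)
  show ?case unfolding right_continuous_path_def
  proof (intro allI impI)
    fix t :: real assume "0 \<le> t"
    then have "limitin (discrete_topology UNIV) (\<lambda>t. J t \<omega>) (J t \<omega>) (at_right t)"
      using elim by (auto simp: cadlag_def limitin_pairwise o_def)
    then have "\<forall>\<^sub>F s in at_right t. J s \<omega> \<in> {J t \<omega>}"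
      unfolding limitin_def by (elim conjE allE[of _ "{J t \<omega>}"]) simp
    then show "\<forall>\<^sub>F s in at_right t. J s \<omega> = J t \<omega>" by simp
  qed
qed

subsection \<open>Positivity and finiteness of moments\<close>

lemma nn_mgf_0: "0 \<le> t \<Longrightarrow> nn_mgf 0 t \<alpha> \<beta> = ennreal (trans_prob t \<alpha> \<beta>)"
proof -
  assume t: "0 \<le> t"
  interpret prob_space "P \<alpha>" by (rule prob)
  show ?thesis using t emeasure_law[OF t, of UNIV \<alpha> \<beta>] by (simp add: nn_mgf_def trans_prob_def emeasure_eq_measure)
qed

lemma trans_prob_semigroup: "0 < t \<Longrightarrow> 0 < s \<Longrightarrow> trans_prob (t + s) \<alpha> \<gamma> = (\<Sum>\<beta>\<in>UNIV. trans_prob t \<alpha> \<beta> * trans_prob s \<beta> \<gamma>)"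
  using nn_mgf_semigroup[of t s 0 \<alpha> \<gamma>]
  by (simp add: nn_mgf_0 trans_prob_nonneg ennreal_mult[symmetric] sum_ennreal sum_nonneg)

text \<open>Split \<open>t\<close> into many small steps: along a path of positive rates from \<open>\<alpha>\<close> to \<open>\<beta>\<close>, padded by steps
  that stay, every step has positive probability.\<close>

lemma trans_prob_pos:
  assumes t: "0 < t"
  shows "0 < trans_prob t \<alpha> \<beta>"
proof -
  have "\<forall>\<^sub>F h in at_right 0. \<forall>a b. a = b \<or> 0 < q a b \<longrightarrow> 0 < trans_prob h a b"
  proof (intro eventually_all_finite)
    fix a b
    show "\<forall>\<^sub>F h in at_right 0. a = b \<or> 0 < q a b \<longrightarrow> 0 < trans_prob h a b"
    proof (cases "a = b")
      case True
      then show ?thesis using order_tendstoD(1)[OF trans_prob_tendsto_1[of a], of 0] by (auto elim!: eventually_mono)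
    next
      case False
      show ?thesis
      proof (cases "0 < q a b")
        case q: True
        from order_tendstoD(1)[OF trans_prob_rate[OF False] this] right_pos show ?thesis
          by eventually_elim (auto simp: zero_less_divide_iff)
      qed (use False in simp)
    qed
  qed
  then obtain d where d: "0 < d" "\<And>h a b. 0 < h \<Longrightarrow> h < d \<Longrightarrow> a = b \<or> 0 < q a b \<Longrightarrow> 0 < trans_prob h a b"
    by (auto simp: eventually_at_right_field)
  have step: "0 < trans_prob (t + s) a c" if "0 < trans_prob t a b" "0 < trans_prob s b c" "0 < t" "0 < s" for t s a b c
  proof -
    have "0 < trans_prob t a b * trans_prob s b c" using that by simp
    also have "\<dots> \<le> trans_prob (t + s) a c"
      unfolding trans_prob_semigroup[OF that(3,4)]
      by (rule member_le_sum) (auto intro: mult_nonneg_nonneg trans_prob_nonneg)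
    finally show ?thesis .
  qed
  have stay: "0 < trans_prob (real (Suc n) * h) a b" if "0 < h" "h < d" "a = b \<or> 0 < q a b" for n h a b
  proof (induction n)
    case 0 show ?case using d(2) that by simp
  next
    case (Suc n)
    have "0 < trans_prob (real (Suc n) * h + h) a b"
      by (rule step[OF Suc]) (use d(2)[of h b b] that in auto)
    then show ?case by (simp add: algebra_simps)
  qed
  have "(\<alpha>, \<beta>) \<in> {(a, b). a \<noteq> b \<and> 0 < q a b}\<^sup>*" using irreducible by (simp add: irreducible_rates_def)
  then have "\<exists>n. \<forall>m h. 0 < h \<longrightarrow> h < d \<longrightarrow> 0 < trans_prob (real (Suc (n + m)) * h) \<alpha> \<beta>"
  proof (induction rule: rtrancl_induct)
    case base
    then show ?case using stay[of _ \<alpha> \<alpha>] by (intro exI[of _ 0]) auto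
  next
    case (step b c)
    then obtain n where n: "\<And>m h. 0 < h \<Longrightarrow> h < d \<Longrightarrow> 0 < trans_prob (real (Suc (n + m)) * h) \<alpha> b" by blast
    have "0 < trans_prob (real (Suc (Suc n + m)) * h) \<alpha> c" if h: "0 < h" "h < d" for m h
    proof -
      have "0 < trans_prob (real (Suc (n + m)) * h + h) \<alpha> c"
        by (rule \<open>\<And>t s a b c. 0 < trans_prob t a b \<Longrightarrow> 0 < trans_prob s b c \<Longrightarrow> 0 < t \<Longrightarrow> 0 < s \<Longrightarrow> 0 < trans_prob (t + s) a c\<close>[OF n[OF h]])
           (use d(2)[OF h, of b c] step.hyps h in auto)
      then show ?thesis by (simp add: algebra_simps)
    qed
    then show ?case by blast
  qed
  then obtain n where n: "\<And>m h. 0 < h \<Longrightarrow> h < d \<Longrightarrow> 0 < trans_prob (real (Suc (n + m)) * h) \<alpha> \<beta>" by blast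
  obtain m where m: "t / d < real m" using reals_Archimedean2 by blast
  define h where "h = t / real (Suc (n + m))"
  have "t < d * real (Suc (n + m))" using m d(1) by (simp add: field_simps) (smt (verit) mult_nonneg_nonneg of_nat_0_le_iff)
  then have "0 < h" "h < d" using t by (auto simp: h_def field_simps)
  from n[OF this, of m] show ?thesis by (simp add: h_def del: of_nat_Suc)
qed

lemma nn_mgf_pos: "0 < t \<Longrightarrow> 0 < nn_mgf p t \<alpha> \<beta>"
proof -
  assume t: "0 < t"
  interpret prob_space "P \<alpha>" by (rule prob)
  have "nn_mgf p t \<alpha> \<beta> \<noteq> 0"
  proof
    assume "nn_mgf p t \<alpha> \<beta> = 0"
    then have "AE x in law t \<alpha> \<beta>. False" unfolding nn_mgf_def by (subst (asm) nn_integral_0_iff_AE) auto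
    then have "emeasure (law t \<alpha> \<beta>) UNIV = 0" by (auto simp: AE_iff_null null_sets_def)
    then show False using trans_prob_pos[OF t, of \<alpha> \<beta>] t
      by (simp add: emeasure_law emeasure_eq_measure trans_prob_def)
  qed
  then show ?thesis by (simp add: zero_less_iff_neq_zero)
qed

text \<open>A moment that is finite at one time from one initial state is finite at all positive times
  from all states: the summands of the Chapman-Kolmogorov sum are products with positive factors.\<close>

lemma nn_mgf_finite:
  assumes T: "0 < T" and fin: "\<And>\<beta>. nn_mgf p T \<alpha> \<beta> < \<infinity>" and t: "0 < t"
  shows "nn_mgf p t \<beta> \<gamma> < \<infinity>"
proof -
  have small: "nn_mgf p s \<beta> \<gamma> < \<infinity>" if s: "0 < s" "s < T" for s \<beta> \<gamma>
  proof (rule ccontr)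
    assume "\<not> nn_mgf p s \<beta> \<gamma> < \<infinity>"
    then have "nn_mgf p s \<beta> \<gamma> = \<infinity>" by (simp add: less_top[symmetric])
    then have "nn_mgf p (T - s) \<alpha> \<beta> * nn_mgf p s \<beta> \<gamma> = \<infinity>"
      using nn_mgf_pos[of "T - s" p \<alpha> \<beta>] s by (simp add: ennreal_mult_eq_top_iff)
    moreover have "nn_mgf p (T - s) \<alpha> \<beta> * nn_mgf p s \<beta> \<gamma> \<le> nn_mgf p T \<alpha> \<gamma>"
      using nn_mgf_semigroup[of "T - s" s p \<alpha> \<gamma>] s
        member_le_sum[of \<beta> UNIV "\<lambda>\<beta>. nn_mgf p (T - s) \<alpha> \<beta> * nn_mgf p s \<beta> \<gamma>"] by simp
    ultimately show False using fin[of \<gamma>] by (simp add: top_unique)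
  qed
  have "nn_mgf p (real (Suc n) * s) \<beta> \<gamma> < \<infinity>" if s: "0 < s" "s < T" for n s \<beta> \<gamma>
  proof (induction n arbitrary: \<beta> \<gamma>)
    case 0 show ?case using small[OF s] by simp
  next
    case (Suc n)
    have "nn_mgf p (real (Suc (Suc n)) * s) \<beta> \<gamma> = nn_mgf p (real (Suc n) * s + s) \<beta> \<gamma>"
      by (simp add: algebra_simps)
    also have "\<dots> = (\<Sum>c\<in>UNIV. nn_mgf p (real (Suc n) * s) \<beta> c * nn_mgf p s c \<gamma>)"
      by (rule nn_mgf_semigroup) (use s in auto)
    also have "\<dots> < \<infinity>" using Suc small[OF s] by (auto simp: ennreal_mult_less_top)
    finally show ?case .
  qed
  note multiple = this
  obtain m where m: "t / T < real m" using reals_Archimedean2 by blast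
  define h where "h = t / real (Suc m)"
  have "t < T * real (Suc m)" using m T by (simp add: field_simps)
  then have "0 < h" "h < T" using t by (auto simp: h_def field_simps)
  from multiple[OF this, of m] show ?thesis by (simp add: h_def del: of_nat_Suc)
qed

end

section \<open>First-order bounds for the real moments\<close>

context markov_additive_chain
begin

definition real_mgf :: "real \<Rightarrow> real \<Rightarrow> 'e \<Rightarrow> 'e \<Rightarrow> real" where
  "real_mgf p t \<alpha> \<beta> = enn2real (nn_mgf p t \<alpha> \<beta>)"

lemma real_mgf_nonneg: "0 \<le> real_mgf p t \<alpha> \<beta>"
  by (simp add: real_mgf_def)

end

text \<open>The exponential moment of order \<open>p\<close> of \<open>\<xi>\<close> is finite; the matrix exponent is identified at the
  orders \<open>\<theta> p\<close> with \<open>0 \<le> \<theta> < 1\<close>.\<close>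

locale markov_additive_moment = markov_additive_chain M P \<F> J \<xi> q
  for M :: "'w measure" and P :: "'e::finite \<Rightarrow> 'w measure" and \<F> J \<xi> q +
  fixes p :: real
  assumes fin: "\<And>t \<alpha> \<beta>. 0 < t \<Longrightarrow> nn_mgf p t \<alpha> \<beta> < \<infinity>"
begin

lemma ennreal_rm: "0 < t \<Longrightarrow> ennreal (real_mgf p t \<alpha> \<beta>) = nn_mgf p t \<alpha> \<beta>"
  unfolding real_mgf_def using fin[of t \<alpha> \<beta>] by simp

lemma real_mgf_semigroup: "0 < t \<Longrightarrow> 0 < s \<Longrightarrow> real_mgf p (t + s) \<alpha> \<gamma> = (\<Sum>\<beta>\<in>UNIV. real_mgf p t \<alpha> \<beta> * real_mgf p s \<beta> \<gamma>)"
  using nn_mgf_semigroup[of t s p \<alpha> \<gamma>]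
  by (simp add: ennreal_rm[symmetric] real_mgf_nonneg ennreal_mult[symmetric] sum_ennreal sum_nonneg)

lemma real_mgf_ge_product: "0 < t \<Longrightarrow> 0 < s \<Longrightarrow> real_mgf p t \<alpha> \<beta> * real_mgf p s \<beta> \<gamma> \<le> real_mgf p (t + s) \<alpha> \<gamma>"
  using member_le_sum[of \<beta> UNIV "\<lambda>\<beta>. real_mgf p t \<alpha> \<beta> * real_mgf p s \<beta> \<gamma>"] by (simp add: real_mgf_semigroup real_mgf_nonneg)

lemma real_mgf_power_diag: "0 < h \<Longrightarrow> real_mgf p h \<alpha> \<alpha> ^ Suc n \<le> real_mgf p (real (Suc n) * h) \<alpha> \<alpha>"
proof (induction n)
  case (Suc n)
  have "real_mgf p h \<alpha> \<alpha> ^ Suc (Suc n) = real_mgf p h \<alpha> \<alpha> ^ Suc n * real_mgf p h \<alpha> \<alpha>" by simp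
  also have "\<dots> \<le> real_mgf p (real (Suc n) * h) \<alpha> \<alpha> * real_mgf p h \<alpha> \<alpha>"
    using Suc by (intro mult_right_mono real_mgf_nonneg) simp
  also have "\<dots> \<le> real_mgf p (real (Suc n) * h + h) \<alpha> \<alpha>" using Suc.prems by (intro real_mgf_ge_product) simp_all
  also have "real (Suc n) * h + h = real (Suc (Suc n)) * h" by (simp add: distrib_right)
  finally show ?case .
qed simp

text \<open>The right-hand side collects the paths that go from \<open>\<alpha>\<close> to \<open>\<beta>\<close> in a single one of the steps.\<close>

lemma real_mgf_power_offdiag:
  assumes h: "0 < h" and ab: "\<alpha> \<noteq> \<beta>" and d: "0 \<le> d" "d \<le> real_mgf p h \<alpha> \<alpha>" "d \<le> real_mgf p h \<beta> \<beta>"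
  shows "real (Suc n) * real_mgf p h \<alpha> \<beta> * d ^ n \<le> real_mgf p (real (Suc n) * h) \<alpha> \<beta>"
proof (induction n)
  case (Suc n)
  let ?t = "real (Suc n) * h"
  have t: "0 < ?t" using h by simp
  have "d * d ^ n \<le> real_mgf p h \<alpha> \<alpha> * real_mgf p h \<alpha> \<alpha> ^ n" using d by (intro mult_mono power_mono) auto
  also have "\<dots> \<le> real_mgf p ?t \<alpha> \<alpha>" using real_mgf_power_diag[OF h, of \<alpha> n] by simp
  finally have 1: "d ^ Suc n * real_mgf p h \<alpha> \<beta> \<le> real_mgf p ?t \<alpha> \<alpha> * real_mgf p h \<alpha> \<beta>" by (intro mult_right_mono real_mgf_nonneg) simp
  have 2: "real (Suc n) * real_mgf p h \<alpha> \<beta> * d ^ n * d \<le> real_mgf p ?t \<alpha> \<beta> * real_mgf p h \<beta> \<beta>"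
    using Suc d real_mgf_nonneg by (intro mult_mono) auto
  have "real (Suc (Suc n)) * real_mgf p h \<alpha> \<beta> * d ^ Suc n = d ^ Suc n * real_mgf p h \<alpha> \<beta> + real (Suc n) * real_mgf p h \<alpha> \<beta> * d ^ n * d"
    by (simp add: algebra_simps)
  also have "\<dots> \<le> real_mgf p ?t \<alpha> \<alpha> * real_mgf p h \<alpha> \<beta> + real_mgf p ?t \<alpha> \<beta> * real_mgf p h \<beta> \<beta>" using 1 2 by linarith
  also have "\<dots> = (\<Sum>\<gamma>\<in>{\<alpha>, \<beta>}. real_mgf p ?t \<alpha> \<gamma> * real_mgf p h \<gamma> \<beta>)" using ab by simp
  also have "\<dots> \<le> (\<Sum>\<gamma>\<in>UNIV. real_mgf p ?t \<alpha> \<gamma> * real_mgf p h \<gamma> \<beta>)"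
    by (rule sum_mono2) (auto intro: mult_nonneg_nonneg real_mgf_nonneg)
  also have "\<dots> = real_mgf p (?t + h) \<alpha> \<beta>" using real_mgf_semigroup[OF t h] by simp
  also have "?t + h = real (Suc (Suc n)) * h" by (simp add: distrib_right)
  finally show ?case .
qed simp

text \<open>First-order lower bounds on the diagonal imply first-order upper bounds everywhere. They make the
  entries bounded near 0, as \<open>K\<^sub>h K\<^sub>\<delta>\<^sub>-\<^sub>h \<le> K\<^sub>\<delta>\<close> entrywise; and if \<open>n h\<close> is of the order of \<open>\<delta>\<close>, then a
  diagonal entry of \<open>K\<^sub>n\<^sub>h = K\<^sub>h\<^sup>n\<close> is at least the \<open>n\<close>-th power of that of \<open>K\<^sub>h\<close>, and an off-diagonal one is at least a constant
  times \<open>n\<close> times the entry of \<open>K\<^sub>h\<close>.\<close>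

lemma real_mgf_upper_bounds:
  assumes lower: "\<And>\<alpha>. \<exists>K. \<forall>\<^sub>F h in at_right 0. 1 - K * h \<le> real_mgf p h \<alpha> \<alpha>"
  shows "\<exists>K. \<forall>\<^sub>F h in at_right 0. real_mgf p h \<alpha> \<alpha> \<le> 1 + K * h"
    and "\<alpha> \<noteq> \<beta> \<Longrightarrow> \<exists>K. \<forall>\<^sub>F h in at_right 0. real_mgf p h \<alpha> \<beta> \<le> K * h"
proof -
  obtain K1 K2 where "\<forall>\<^sub>F h in at_right 0. 1 - K1 * h \<le> real_mgf p h \<alpha> \<alpha>" "\<forall>\<^sub>F h in at_right 0. 1 - K2 * h \<le> real_mgf p h \<beta> \<beta>"
    using lower by meson
  then have "\<forall>\<^sub>F h in at_right 0. 1 - K1 * h \<le> real_mgf p h \<alpha> \<alpha> \<and> 1 - K2 * h \<le> real_mgf p h \<beta> \<beta>"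
    by (rule eventually_conj)
  then obtain d where d: "0 < d" "\<And>h. 0 < h \<Longrightarrow> h < d \<Longrightarrow> 1 - K1 * h \<le> real_mgf p h \<alpha> \<alpha> \<and> 1 - K2 * h \<le> real_mgf p h \<beta> \<beta>"
    unfolding eventually_at_right_field by blast
  define K where "K = max 1 (max K1 K2)"
  define \<delta> where "\<delta> = min (d / 2) (1 / (2 * K))"
  have K: "1 \<le> K" "K1 \<le> K" "K2 \<le> K" by (auto simp: K_def)
  have \<delta>: "0 < \<delta>" "\<delta> < d" "K * \<delta> \<le> 1 / 2"
  proof -
    have "K * \<delta> \<le> K * (1 / (2 * K))" unfolding \<delta>_def using K by (intro mult_left_mono) auto
    then show "K * \<delta> \<le> 1 / 2" using K by simp
  qed (use d K in \<open>auto simp: \<delta>_def min_def\<close>)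
  have lb: "1 - K * h \<le> real_mgf p h \<alpha> \<alpha>" "1 - K * h \<le> real_mgf p h \<beta> \<beta>" if h: "0 < h" "h \<le> \<delta>" for h
  proof -
    have "K1 * h \<le> K * h" "K2 * h \<le> K * h" using K h by (auto intro: mult_right_mono)
    then show "1 - K * h \<le> real_mgf p h \<alpha> \<alpha>" "1 - K * h \<le> real_mgf p h \<beta> \<beta>" using d(2)[of h] h \<delta> by linarith+
  qed
  have half: "1 / 2 \<le> 1 - K * h" if "h \<le> \<delta>" for h
    using mult_left_mono[OF that, of K] K \<delta>(3) by linarith
  have bounded: "real_mgf p h \<alpha> \<gamma> \<le> 2 * real_mgf p \<delta> \<alpha> \<gamma>" if h: "0 < h" "h \<le> \<delta>" and \<gamma>: "\<gamma> = \<alpha> \<or> \<gamma> = \<beta>" for h \<gamma>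
  proof (cases "h = \<delta>")
    case False
    then have h': "0 < \<delta> - h" "\<delta> - h \<le> \<delta>" using h by auto
    have "1 / 2 \<le> real_mgf p (\<delta> - h) \<gamma> \<gamma>" using lb[OF h'] half[OF h'(2)] \<gamma> by auto
    then have "real_mgf p h \<alpha> \<gamma> * (1 / 2) \<le> real_mgf p h \<alpha> \<gamma> * real_mgf p (\<delta> - h) \<gamma> \<gamma>" by (intro mult_left_mono real_mgf_nonneg)
    also have "\<dots> \<le> real_mgf p \<delta> \<alpha> \<gamma>" using real_mgf_ge_product[OF h(1) h'(1), of \<alpha> \<gamma> \<gamma>] by simp
    finally show ?thesis by simp
  qed (use real_mgf_nonneg[of p \<delta> \<alpha> \<gamma>] in simp)
  have near: "\<forall>\<^sub>F h in at_right 0. 0 < h \<and> h \<le> \<delta>"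
    unfolding eventually_at_right_field using \<delta>(1) by (intro exI[of _ \<delta>]) auto
  define A where "A = max 1 (2 * real_mgf p \<delta> \<alpha> \<alpha>)"
  have "real_mgf p h \<alpha> \<alpha> \<le> 1 + 2 * A / \<delta> * h" if h: "0 < h" "h \<le> \<delta>" for h
  proof (rule power_upper_bound_imp[OF h])
    show "0 \<le> A" by (simp add: A_def)
    fix n :: nat assume n: "real n * h \<le> \<delta>"
    show "real_mgf p h \<alpha> \<alpha> ^ n \<le> A"
    proof (cases n)
      case (Suc m)
      have "real_mgf p h \<alpha> \<alpha> ^ n \<le> real_mgf p (real n * h) \<alpha> \<alpha>" unfolding Suc by (rule real_mgf_power_diag[OF h(1)])
      also have "\<dots> \<le> 2 * real_mgf p \<delta> \<alpha> \<alpha>" using n h Suc by (intro bounded) auto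
      finally show ?thesis by (simp add: A_def)
    qed (simp add: A_def)
  qed
  then show "\<exists>K. \<forall>\<^sub>F h in at_right 0. real_mgf p h \<alpha> \<alpha> \<le> 1 + K * h"
    using near by (intro exI[of _ "2 * A / \<delta>"]) (auto elim: eventually_mono)
  assume ab: "\<alpha> \<noteq> \<beta>"
  let ?B = "2 * real_mgf p \<delta> \<alpha> \<beta>"
  have "real_mgf p h \<alpha> \<beta> \<le> (4 * ?B / \<delta>) * h" if h: "0 < h" "h \<le> \<delta>" for h
  proof -
    obtain n where n: "1 \<le> n" "real n * h \<le> \<delta>" "\<delta> \<le> 2 * real n * h" using obtain_multiple[OF h] .
    obtain m where m: "n = Suc m" using n(1) by (cases n) auto
    let ?d = "1 - K * h"
    have dh: "0 \<le> ?d" using half[OF h(2)] by simp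
    have "real m * h \<le> real n * h" using m h by simp
    then have "1 / 2 \<le> 1 - K * (real m * h)" using n(2) by (intro half) simp
    also have "\<dots> = 1 + real m * (?d - 1)" by simp
    also have "\<dots> \<le> (1 + (?d - 1)) ^ m" using dh by (intro Bernoulli_inequality) simp
    finally have dm: "1 / 2 \<le> ?d ^ m" by simp
    have "real n * real_mgf p h \<alpha> \<beta> * (1 / 2) \<le> real n * real_mgf p h \<alpha> \<beta> * ?d ^ m"
      using dm real_mgf_nonneg by (intro mult_left_mono) auto
    also have "\<dots> \<le> real_mgf p (real n * h) \<alpha> \<beta>"
      unfolding m by (rule real_mgf_power_offdiag[OF h(1) ab dh lb[OF h]])
    also have "\<dots> \<le> ?B" using n h by (intro bounded) auto
    finally have nb: "real n * real_mgf p h \<alpha> \<beta> \<le> 2 * ?B" by simp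
    have "\<delta> * real_mgf p h \<alpha> \<beta> \<le> 2 * real n * h * real_mgf p h \<alpha> \<beta>" using n(3) by (intro mult_right_mono real_mgf_nonneg)
    also have "\<dots> = 2 * h * (real n * real_mgf p h \<alpha> \<beta>)" by simp
    also have "\<dots> \<le> 2 * h * (2 * ?B)" using nb h by (intro mult_left_mono) auto
    finally show ?thesis using \<delta>(1) by (simp add: field_simps)
  qed
  then show "\<exists>K. \<forall>\<^sub>F h in at_right 0. real_mgf p h \<alpha> \<beta> \<le> K * h"
    using near by (intro exI[of _ "4 * ?B / \<delta>"]) (auto elim: eventually_mono)
qed

lemma exp_moment_integrable:
  assumes t: "0 < t"
  shows "integrable (P \<alpha>) (\<lambda>\<omega>. exp (p * \<xi> t \<omega>))"
proof -
  note [measurable] = \<xi>_measurable[OF less_imp_le[OF t]]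
  have "integrable (P \<alpha>) (\<lambda>\<omega>. indicat_real (in_state t \<beta>) \<omega> *\<^sub>R exp (p * \<xi> t \<omega>))" for \<beta>
  proof -
    have "integrable (law t \<alpha> \<beta>) (\<lambda>x. exp (p * x))"
      using fin[OF t, of \<alpha> \<beta>] unfolding nn_mgf_def by (intro integrableI_bounded) auto
    then show ?thesis using t by (subst (asm) integrable_law_iff) auto
  qed
  then have "integrable (P \<alpha>) (\<lambda>\<omega>. \<Sum>\<beta>\<in>UNIV. indicat_real (in_state t \<beta>) \<omega> *\<^sub>R exp (p * \<xi> t \<omega>))"
    by (rule Bochner_Integration.integrable_sum)
  also have "?this \<longleftrightarrow> ?thesis"
    by (rule Bochner_Integration.integrable_cong)
       (simp_all add: sum_distrib_right[symmetric] space_P indicator_def of_bool_def sum.delta)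
  finally show ?thesis .
qed

lemma real_mgf_eq_integral:
  assumes t: "0 < t"
  shows "real_mgf p t \<alpha> \<beta> = (\<integral>\<omega>. indicat_real (in_state t \<beta>) \<omega> * exp (p * \<xi> t \<omega>) \<partial>P \<alpha>)"
proof -
  have "real_mgf p t \<alpha> \<beta> = (\<integral>x. exp (p * x) \<partial>law t \<alpha> \<beta>)"
    unfolding real_mgf_def nn_mgf_def by (subst integral_eq_nn_integral) auto
  also have "\<dots> = (\<integral>\<omega>. indicat_real (in_state t \<beta>) \<omega> * exp (p * \<xi> t \<omega>) \<partial>P \<alpha>)"
    using t by (subst integral_law) auto
  finally show ?thesis .
qed

end

section \<open>Identification of the generator\<close>

text \<open>An event that is independent of \<open>Z\<close> rescales the distribution of \<open>Z\<close>; expectations over such an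
  event factorize for integrands with values in any Banach space.\<close>

lemma (in prob_space) indep_event_density:
  fixes Z :: "'a \<Rightarrow> real"
  assumes C[measurable]: "C \<in> events" and Z[measurable]: "Z \<in> borel_measurable M"
    and indep: "\<And>S. S \<in> sets borel \<Longrightarrow> prob (C \<inter> {\<omega> \<in> space M. Z \<omega> \<in> S}) = prob C * prob {\<omega> \<in> space M. Z \<omega> \<in> S}"
  shows "distr (density M (\<lambda>\<omega>. ennreal (indicat_real C \<omega>))) borel Z = density (distr M borel Z) (\<lambda>_. ennreal (prob C))"
proof (rule measure_eqI)
  fix S assume "S \<in> sets (distr (density M (\<lambda>\<omega>. ennreal (indicat_real C \<omega>))) borel Z)"
  then have S[measurable]: "S \<in> sets borel" by simp
  have eq: "Z -` S \<inter> space M = {\<omega> \<in> space M. Z \<omega> \<in> S}" by auto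
  have "emeasure (distr (density M (\<lambda>\<omega>. ennreal (indicat_real C \<omega>))) borel Z) S =
      emeasure (density M (indicator C)) {\<omega> \<in> space M. Z \<omega> \<in> S}"
    unfolding ennreal_indicator by (subst emeasure_distr) (auto simp: eq)
  also have "\<dots> = emeasure M (C \<inter> {\<omega> \<in> space M. Z \<omega> \<in> S})" by (rule emeasure_restricted) measurable
  also have "\<dots> = ennreal (prob C) * emeasure M {\<omega> \<in> space M. Z \<omega> \<in> S}"
    by (simp add: emeasure_eq_measure indep ennreal_mult)
  also have "\<dots> = ennreal (prob C) * emeasure (distr M borel Z) S" by (simp add: emeasure_distr eq)
  also have "\<dots> = emeasure (density (distr M borel Z) (\<lambda>_. ennreal (prob C))) S"
    by (simp add: emeasure_density nn_integral_cmult_indicator)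
  finally show "emeasure (distr (density M (\<lambda>\<omega>. ennreal (indicat_real C \<omega>))) borel Z) S =
      emeasure (density (distr M borel Z) (\<lambda>_. ennreal (prob C))) S" .
qed simp

lemma (in prob_space) indep_event_nn_integral:
  fixes Z :: "'a \<Rightarrow> real"
  assumes C[measurable]: "C \<in> events" and Z[measurable]: "Z \<in> borel_measurable M"
    and indep: "\<And>S. S \<in> sets borel \<Longrightarrow> prob (C \<inter> {\<omega> \<in> space M. Z \<omega> \<in> S}) = prob C * prob {\<omega> \<in> space M. Z \<omega> \<in> S}"
    and f[measurable]: "f \<in> borel_measurable borel"
  shows "(\<integral>\<^sup>+\<omega>. ennreal (indicat_real C \<omega>) * f (Z \<omega>) \<partial>M) = ennreal (prob C) * (\<integral>\<^sup>+\<omega>. f (Z \<omega>) \<partial>M)"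
proof -
  have "(\<integral>\<^sup>+\<omega>. ennreal (indicat_real C \<omega>) * f (Z \<omega>) \<partial>M) =
      (\<integral>\<^sup>+x. f x \<partial>distr (density M (\<lambda>\<omega>. ennreal (indicat_real C \<omega>))) borel Z)"
    by (simp add: nn_integral_distr nn_integral_density)
  also have "\<dots> = (\<integral>\<^sup>+x. f x \<partial>density (distr M borel Z) (\<lambda>_. ennreal (prob C)))"
    by (simp only: indep_event_density[OF C Z indep])
  also have "\<dots> = ennreal (prob C) * (\<integral>\<^sup>+\<omega>. f (Z \<omega>) \<partial>M)"
    by (simp add: nn_integral_density nn_integral_cmult nn_integral_distr)
  finally show ?thesis .
qed

lemma (in prob_space) indep_event_integral:
  fixes Z :: "'a \<Rightarrow> real" and f :: "real \<Rightarrow> 'b::{banach, second_countable_topology}"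
  assumes C[measurable]: "C \<in> events" and Z[measurable]: "Z \<in> borel_measurable M"
    and indep: "\<And>S. S \<in> sets borel \<Longrightarrow> prob (C \<inter> {\<omega> \<in> space M. Z \<omega> \<in> S}) = prob C * prob {\<omega> \<in> space M. Z \<omega> \<in> S}"
    and f[measurable]: "f \<in> borel_measurable borel"
  shows "(\<integral>\<omega>. indicat_real C \<omega> *\<^sub>R f (Z \<omega>) \<partial>M) = prob C *\<^sub>R (\<integral>\<omega>. f (Z \<omega>) \<partial>M)"
proof -
  have "(\<integral>\<omega>. indicat_real C \<omega> *\<^sub>R f (Z \<omega>) \<partial>M) =
      (\<integral>x. f x \<partial>distr (density M (\<lambda>\<omega>. ennreal (indicat_real C \<omega>))) borel Z)"
    by (simp add: integral_distr integral_density)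
  also have "\<dots> = (\<integral>x. f x \<partial>density (distr M borel Z) (\<lambda>_. ennreal (prob C)))"
    by (simp only: indep_event_density[OF C Z indep])
  also have "\<dots> = prob C *\<^sub>R (\<integral>\<omega>. f (Z \<omega>) \<partial>M)"
    by (simp add: integral_density integral_distr)
  finally show ?thesis .
qed

text \<open>The decomposition of the process for one initial state \<open>a\<close>, with the copies of the Levy processes
  and of the jumps chosen.\<close>

locale decomposed_start = markov_additive_moment M P \<F> J \<xi> q p
  for M :: "'w measure" and P :: "'e::finite \<Rightarrow> 'w measure" and \<F> J \<xi> q p +
  fixes a :: 'e and N :: "'v measure" and \<pi> :: "'v \<Rightarrow> 'w"
    and X :: "'e \<Rightarrow> nat \<Rightarrow> real \<Rightarrow> 'v \<Rightarrow> real" and V :: "'e \<Rightarrow> 'e \<Rightarrow> nat \<Rightarrow> 'v \<Rightarrow> real"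
  assumes prob_N: "prob_space N"
    and \<pi>_measurable: "\<pi> \<in> N \<rightarrow>\<^sub>M P a" and distr_\<pi>: "distr N (P a) \<pi> = P a"
    and levy_X: "\<And>\<beta> n. levy_process N (X \<beta> n)"
    and V_measurable: "\<And>\<beta> \<gamma> n. V \<beta> \<gamma> n \<in> borel_measurable N"
    and indep: "prob_space.indep_sets N
            (\<lambda>c. case c of
                Chain \<Rightarrow> process_sigma N (count_space UNIV) (\<lambda>t \<eta>. J t (\<pi> \<eta>))
              | Levy \<beta> n \<Rightarrow> process_sigma N borel (X \<beta> n)
              | Jump \<beta> \<gamma> n \<Rightarrow> sets (vimage_algebra (space N) (V \<beta> \<gamma> n) borel)) UNIV"
    and path: "AE \<eta> in N. \<forall>t\<ge>0.
             \<xi> t (\<pi> \<eta>) = additive_path (\<lambda>s. J s (\<pi> \<eta>)) (\<lambda>\<beta> n s. X \<beta> n s \<eta>) (\<lambda>\<beta> \<gamma> n. V \<beta> \<gamma> n \<eta>) t"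
begin

sublocale N: prob_space N by (rule prob_N)

sublocale L: levy N "X a 0" by unfold_locales (rule levy_X)

definition lift :: "'w set \<Rightarrow> 'v set" where
  "lift A = \<pi> -` A \<inter> space N"

lemma \<pi>_space: "\<eta> \<in> space N \<Longrightarrow> \<pi> \<eta> \<in> space M"
  using measurable_space[OF \<pi>_measurable] by (simp add: space_P)

lemma lift_sets [measurable]: "A \<in> sets (P a) \<Longrightarrow> lift A \<in> sets N"
  unfolding lift_def by (rule measurable_sets[OF \<pi>_measurable])

lemma lift_prob: "A \<in> sets (P a) \<Longrightarrow> N.prob (lift A) = measure (P a) A"
  using measure_distr[OF \<pi>_measurable, of A] distr_\<pi> by (simp add: lift_def)

lemma lift_AE: "AE \<omega> in P a. Q \<omega> \<Longrightarrow> AE \<eta> in N. Q (\<pi> \<eta>)"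
  by (rule AE_distrD[OF \<pi>_measurable]) (simp only: distr_\<pi>)

lemma lift_integral:
  fixes f :: "'w \<Rightarrow> 'c::{banach, second_countable_topology}"
  shows "f \<in> borel_measurable (P a) \<Longrightarrow> (\<integral>\<omega>. f \<omega> \<partial>P a) = (\<integral>\<eta>. f (\<pi> \<eta>) \<partial>N)"
  using integral_distr[OF \<pi>_measurable, of f] distr_\<pi> by simp

lemma lift_integrable:
  fixes f :: "'w \<Rightarrow> 'c::{banach, second_countable_topology}"
  shows "f \<in> borel_measurable (P a) \<Longrightarrow> integrable (P a) f \<longleftrightarrow> integrable N (\<lambda>\<eta>. f (\<pi> \<eta>))"
  using integrable_distr_eq[OF \<pi>_measurable, of f] distr_\<pi> by simp

lemma lift_nn_integral:
  "f \<in> borel_measurable (P a) \<Longrightarrow> (\<integral>\<^sup>+\<omega>. f \<omega> \<partial>P a) = (\<integral>\<^sup>+\<eta>. f (\<pi> \<eta>) \<partial>N)"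
  using nn_integral_distr[OF \<pi>_measurable, of f] distr_\<pi> by simp

lemma J_\<pi>_measurable [measurable]: "0 \<le> t \<Longrightarrow> (\<lambda>\<eta>. J t (\<pi> \<eta>)) \<in> measurable N (count_space UNIV)"
  using measurable_compose[OF \<pi>_measurable J_measurable] .

lemma \<xi>_\<pi>_measurable [measurable]: "0 \<le> t \<Longrightarrow> (\<lambda>\<eta>. \<xi> t (\<pi> \<eta>)) \<in> borel_measurable N"
  using measurable_compose[OF \<pi>_measurable \<xi>_measurable] .

abbreviation chain_sigma :: "'v set set" where
  "chain_sigma \<equiv> process_sigma N (count_space UNIV) (\<lambda>t \<eta>. J t (\<pi> \<eta>))"

lemma chain_sigma_J: "0 \<le> t \<Longrightarrow> {\<eta> \<in> space N. J t (\<pi> \<eta>) = b} \<in> chain_sigma"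
  using process_sigma_event[of "\<lambda>t \<eta>. J t (\<pi> \<eta>)" N "count_space UNIV" t "{b}"] by simp

lemma lift_J: "lift (in_state t b) = {\<eta> \<in> space N. J t (\<pi> \<eta>) = b}"
  using \<pi>_space by (auto simp: lift_def)

lemma chain_sigma_const: "0 < h \<Longrightarrow> lift (const_event h b) \<in> chain_sigma"
proof -
  assume h: "0 < h"
  define A where "A = (\<lambda>n. \<Inter>i\<in>{..n}. {\<eta> \<in> space N. J (real i * (h / real n)) (\<pi> \<eta>) = b})"
  have A: "A n \<in> chain_sigma" for n
    unfolding A_def process_sigma_def
    by (intro sets.finite_INT) (use h in \<open>auto intro!: chain_sigma_J[unfolded process_sigma_def]\<close>)
  have mem: "\<eta> \<in> A n \<longleftrightarrow> \<eta> \<in> space N \<and> grid_const (\<lambda>t. J t (\<pi> \<eta>)) h b n" for \<eta> n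
    by (auto simp: A_def grid_const_def)
  have "lift (const_event h b) = (\<Inter>m. \<Union>n\<in>{m..}. A n)"
  proof (intro set_eqI)
    fix \<eta>
    show "\<eta> \<in> lift (const_event h b) \<longleftrightarrow> \<eta> \<in> (\<Inter>m. \<Union>n\<in>{m..}. A n)"
      using \<pi>_space[of \<eta>] by (simp add: lift_def const_event_def frequently_sequentially mem Bex_def) blast
  qed
  also have "\<dots> \<in> chain_sigma"
    using A unfolding process_sigma_def by (intro sets.countable_INT sets.countable_UN'') auto
  finally show ?thesis .
qed

lemma indep_two:
  assumes c: "c1 \<noteq> c2"
    and A: "A \<in> (case c1 of Chain \<Rightarrow> chain_sigma | Levy \<beta> n \<Rightarrow> process_sigma N borel (X \<beta> n)
              | Jump \<beta> \<gamma> n \<Rightarrow> sets (vimage_algebra (space N) (V \<beta> \<gamma> n) borel))"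
    and B: "B \<in> (case c2 of Chain \<Rightarrow> chain_sigma | Levy \<beta> n \<Rightarrow> process_sigma N borel (X \<beta> n)
              | Jump \<beta> \<gamma> n \<Rightarrow> sets (vimage_algebra (space N) (V \<beta> \<gamma> n) borel))"
  shows "N.prob (A \<inter> B) = N.prob A * N.prob B"
proof -
  have "N.prob (\<Inter>j\<in>{c1, c2}. if j = c1 then A else B) = (\<Prod>j\<in>{c1, c2}. N.prob (if j = c1 then A else B))"
    by (rule N.indep_setsD[OF indep]) (use A B c in auto)
  then show ?thesis using c by (simp add: Int_commute)
qed

lemma indep_chain_X:
  assumes C: "C \<in> chain_sigma" and t: "0 \<le> t" and S: "S \<in> sets borel"
  shows "N.prob (C \<inter> {\<eta> \<in> space N. X \<beta> n t \<eta> \<in> S}) = N.prob C * N.prob {\<eta> \<in> space N. X \<beta> n t \<eta> \<in> S}"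
proof (rule indep_two[of Chain "Levy \<beta> n"])
  interpret x: levy N "X \<beta> n" by unfold_locales (rule levy_X)
  show "{\<eta> \<in> space N. X \<beta> n t \<eta> \<in> S} \<in> (case Levy \<beta> n of Chain \<Rightarrow> chain_sigma | Levy \<beta> n \<Rightarrow> process_sigma N borel (X \<beta> n)
              | Jump \<beta> \<gamma> n \<Rightarrow> sets (vimage_algebra (space N) (V \<beta> \<gamma> n) borel))"
    using process_sigma_event[of "X \<beta> n" N borel t S] x.X_measurable t S by simp
qed (use C in simp_all)

lemma indep_chain_V:
  assumes C: "C \<in> chain_sigma" and S: "S \<in> sets borel"
  shows "N.prob (C \<inter> {\<eta> \<in> space N. V \<beta> \<gamma> n \<eta> \<in> S}) = N.prob C * N.prob {\<eta> \<in> space N. V \<beta> \<gamma> n \<eta> \<in> S}"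
proof (rule indep_two[of Chain "Jump \<beta> \<gamma> n"])
  have "{\<eta> \<in> space N. V \<beta> \<gamma> n \<eta> \<in> S} = V \<beta> \<gamma> n -` S \<inter> space N" by auto
  then show "{\<eta> \<in> space N. V \<beta> \<gamma> n \<eta> \<in> S} \<in> (case Jump \<beta> \<gamma> n of Chain \<Rightarrow> chain_sigma | Levy \<beta> n \<Rightarrow> process_sigma N borel (X \<beta> n)
              | Jump \<beta> \<gamma> n \<Rightarrow> sets (vimage_algebra (space N) (V \<beta> \<gamma> n) borel))"
    using S by (simp add: in_vimage_algebra)
qed (use C in simp_all)

lemma path_const:
  assumes h: "0 < h"
  shows "AE \<eta> in N. \<eta> \<in> lift (const_event h a) \<longrightarrow> \<xi> h (\<pi> \<eta>) = X a 0 h \<eta>"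
  using path lift_AE[OF right_continuous_path_J]
proof eventually_elim
  case (elim \<eta>)
  show ?case
  proof
    assume "\<eta> \<in> lift (const_event h a)"
    then have "\<exists>\<^sub>F n in sequentially. grid_const (\<lambda>t. J t (\<pi> \<eta>)) h a n" by (auto simp: lift_def const_event_def)
    from frequently_grid_const_imp[OF elim(2) h this]
    have "additive_path (\<lambda>s. J s (\<pi> \<eta>)) (\<lambda>\<beta> n s. X \<beta> n s \<eta>) (\<lambda>\<beta> \<gamma> n. V \<beta> \<gamma> n \<eta>) h = X a 0 h \<eta>"
      by (rule additive_path_const[OF elim(2) h])
    then show "\<xi> h (\<pi> \<eta>) = X a 0 h \<eta>" using elim(1) h by simp
  qed
qed

text \<open>The times go up to \<open>2 h\<close> because \<open>escape\<close> does not look at the right end point.\<close>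

definition wander :: "'e \<Rightarrow> real \<Rightarrow> real \<Rightarrow> 'v set" where
  "wander b \<epsilon> h = levy.escape N (X a 0) \<epsilon> (2 * h) \<union> levy.escape N (X b 1) \<epsilon> (2 * h)"

lemma path_switch:
  assumes h: "0 < h" and ab: "a \<noteq> b"
  shows "AE \<eta> in N. \<eta> \<in> lift (switch_event h a b) - wander b \<epsilon> h \<longrightarrow> \<bar>\<xi> h (\<pi> \<eta>) - V a b 0 \<eta>\<bar> \<le> 2 * \<epsilon>"
proof -
  interpret x1: levy N "X b 1" by unfold_locales (rule levy_X)
  show ?thesis
    using path lift_AE[OF right_continuous_path_J] L.right_continuous x1.right_continuous
  proof eventually_elim
    case (elim \<eta>)
    show ?case
    proof
      assume \<eta>: "\<eta> \<in> lift (switch_event h a b) - wander b \<epsilon> h"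
      then have sp: "\<eta> \<in> space N" and "\<exists>\<^sub>F n in sequentially. grid_switch (\<lambda>t. J t (\<pi> \<eta>)) h a b n"
        by (auto simp: lift_def switch_event_def)
      from frequently_grid_switch_imp[OF elim(2) h ab this(2)] obtain \<sigma> where \<sigma>: "0 < \<sigma>" "\<sigma> \<le> h"
        "\<And>s. 0 \<le> s \<Longrightarrow> s < \<sigma> \<Longrightarrow> J s (\<pi> \<eta>) = a" "\<And>s. \<sigma> \<le> s \<Longrightarrow> s \<le> h \<Longrightarrow> J s (\<pi> \<eta>) = b" by blast
      have "\<xi> h (\<pi> \<eta>) = X a 0 \<sigma> \<eta> + V a b 0 \<eta> + X b 1 (h - \<sigma>) \<eta>"
        using additive_path_switch[OF elim(2) ab \<sigma>] elim(1) h by simp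
      moreover have "\<bar>X a 0 \<sigma> \<eta>\<bar> \<le> \<epsilon>"
        by (rule L.not_escape_imp[OF elim(3) sp, of \<epsilon> "2 * h"]) (use \<eta> \<sigma> in \<open>auto simp: wander_def\<close>)
      moreover have "\<bar>X b 1 (h - \<sigma>) \<eta>\<bar> \<le> \<epsilon>"
        by (rule x1.not_escape_imp[OF elim(4) sp, of \<epsilon> "2 * h"]) (use \<eta> \<sigma> in \<open>auto simp: wander_def\<close>)
      ultimately show "\<bar>\<xi> h (\<pi> \<eta>) - V a b 0 \<eta>\<bar> \<le> 2 * \<epsilon>" by linarith
    qed
  qed
qed

lemma wander_sets [measurable]: "wander b \<epsilon> h \<in> sets N"
proof -
  interpret x1: levy N "X b 1" by unfold_locales (rule levy_X)
  show ?thesis unfolding wander_def by measurable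
qed

lemma wander_tendsto_0:
  assumes "0 < \<epsilon>"
  shows "((\<lambda>h. N.prob (levy.escape N (X a 0) \<epsilon> (2 * h)) + N.prob (levy.escape N (X b 1) \<epsilon> (2 * h))) \<longlongrightarrow> 0) (at_right 0)"
proof -
  interpret x1: levy N "X b 1" by unfold_locales (rule levy_X)
  have "filterlim (\<lambda>h::real. 2 * h) (at_right 0) (at_right 0)"
    unfolding filterlim_at using right_pos by (auto intro!: tendsto_eq_intros elim!: eventually_mono)
  from filterlim_compose[OF L.escape_tendsto_0[OF assms] this]
    filterlim_compose[OF x1.escape_tendsto_0[OF assms] this]
  show ?thesis using tendsto_add by fastforce
qed

lemma prob_J_wander:
  assumes h: "0 < h"
  shows "N.prob (lift (in_state h b) \<inter> wander b \<epsilon> h) \<le>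
    trans_prob h a b * (N.prob (levy.escape N (X a 0) \<epsilon> (2 * h)) + N.prob (levy.escape N (X b 1) \<epsilon> (2 * h)))"
proof -
  interpret x1: levy N "X b 1" by unfold_locales (rule levy_X)
  let ?E = "lift (in_state h b)"
  have E: "?E \<in> chain_sigma" unfolding lift_J using h by (intro chain_sigma_J) simp
  have Em[measurable]: "?E \<in> sets N" using h by (intro lift_sets J_event) simp
  have pE: "N.prob ?E = trans_prob h a b" unfolding trans_prob_def using h by (intro lift_prob J_event) simp
  have 1: "N.prob (?E \<inter> L.escape \<epsilon> (2 * h)) = N.prob ?E * N.prob (L.escape \<epsilon> (2 * h))"
    by (rule indep_two[of Chain "Levy a 0"]) (use E L.escape_process_sigma in auto)
  have 2: "N.prob (?E \<inter> x1.escape \<epsilon> (2 * h)) = N.prob ?E * N.prob (x1.escape \<epsilon> (2 * h))"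
    by (rule indep_two[of Chain "Levy b 1"]) (use E x1.escape_process_sigma in auto)
  have "N.prob (?E \<inter> wander b \<epsilon> h) \<le> N.prob (?E \<inter> L.escape \<epsilon> (2 * h)) + N.prob (?E \<inter> x1.escape \<epsilon> (2 * h))"
    unfolding wander_def Int_Un_distrib by (intro measure_Un_le sets.Int Em L.escape_sets x1.escape_sets)
  then show ?thesis unfolding 1 2 pE by (simp add: distrib_left)
qed

subsection \<open>The diagonal entry\<close>

text \<open>The first sojourn is \<open>X a 0\<close>, so a finite moment of \<open>\<xi>\<close> forces a finite moment of this Levy process.\<close>

lemma const_event_nn_moment:
  assumes h: "0 < h"
  shows "ennreal (measure (P a) (const_event h a)) * L.nn_moment p h \<le> nn_mgf p h a a"
proof -
  let ?C = "const_event h a"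
  have h0: "0 \<le> h" using h by simp
  have C[measurable]: "?C \<in> sets (P a)" by (rule const_event_sets[OF h])
  note [measurable] = \<xi>_measurable[OF h0] \<xi>_\<pi>_measurable[OF h0] L.X_measurable[OF h0] J_event[OF h0]
  have "ennreal (measure (P a) ?C) * L.nn_moment p h =
      (\<integral>\<^sup>+\<eta>. ennreal (indicat_real (lift ?C) \<eta>) * ennreal (exp (p * X a 0 h \<eta>)) \<partial>N)"
    unfolding L.nn_moment_def lift_prob[OF C, symmetric]
    by (rule N.indep_event_nn_integral[symmetric])
       (use indep_chain_X[OF chain_sigma_const[OF h] h0] lift_sets[OF C] in auto)
  also have "\<dots> = (\<integral>\<^sup>+\<eta>. ennreal (indicat_real ?C (\<pi> \<eta>)) * ennreal (exp (p * \<xi> h (\<pi> \<eta>))) \<partial>N)"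
    by (rule nn_integral_cong_AE, use path_const[OF h] AE_space in eventually_elim)
       (auto simp: lift_def indicator_def)
  also have "\<dots> = (\<integral>\<^sup>+\<omega>. ennreal (indicat_real ?C \<omega>) * ennreal (exp (p * \<xi> h \<omega>)) \<partial>P a)"
    by (rule lift_nn_integral[symmetric]) measurable
  also have "\<dots> \<le> (\<integral>\<^sup>+\<omega>. indicator (in_state h a) \<omega> * ennreal (exp (p * \<xi> h \<omega>)) \<partial>P a)"
    by (rule nn_integral_mono) (use const_event_imp[OF h] in \<open>auto simp: indicator_def space_P const_event_def\<close>)
  also have "\<dots> = nn_mgf p h a a" unfolding nn_mgf_def using h0 by (simp add: nn_integral_law)
  finally show ?thesis .
qed

lemma const_event_integral:
  fixes f :: "real \<Rightarrow> 'c::{banach, second_countable_topology}"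
  assumes h: "0 < h" and f[measurable]: "f \<in> borel_measurable borel"
  shows "(\<integral>\<omega>. indicat_real (const_event h a) \<omega> *\<^sub>R f (\<xi> h \<omega>) \<partial>P a) =
    measure (P a) (const_event h a) *\<^sub>R (\<integral>\<eta>. f (X a 0 h \<eta>) \<partial>N)"
proof -
  let ?C = "const_event h a"
  have h0: "0 \<le> h" using h by simp
  have C[measurable]: "?C \<in> sets (P a)" by (rule const_event_sets[OF h])
  note [measurable] = \<xi>_measurable[OF h0] L.X_measurable[OF h0]
  have "(\<integral>\<omega>. indicat_real ?C \<omega> *\<^sub>R f (\<xi> h \<omega>) \<partial>P a) = (\<integral>\<eta>. indicat_real ?C (\<pi> \<eta>) *\<^sub>R f (\<xi> h (\<pi> \<eta>)) \<partial>N)"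
    by (rule lift_integral) measurable
  also have "\<dots> = (\<integral>\<eta>. indicat_real (lift ?C) \<eta> *\<^sub>R f (X a 0 h \<eta>) \<partial>N)"
  proof (rule integral_cong_AE)
    show "AE \<eta> in N. indicat_real ?C (\<pi> \<eta>) *\<^sub>R f (\<xi> h (\<pi> \<eta>)) = indicat_real (lift ?C) \<eta> *\<^sub>R f (X a 0 h \<eta>)"
      using path_const[OF h] AE_space by eventually_elim (auto simp: lift_def indicator_def)
    show "(\<lambda>\<eta>. indicat_real ?C (\<pi> \<eta>) *\<^sub>R f (\<xi> h (\<pi> \<eta>))) \<in> borel_measurable N"
      by (rule measurable_compose[OF \<pi>_measurable]) measurable
  qed measurable
  also have "\<dots> = measure (P a) ?C *\<^sub>R (\<integral>\<eta>. f (X a 0 h \<eta>) \<partial>N)"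
    unfolding lift_prob[OF C, symmetric]
    by (rule N.indep_event_integral)
       (use indep_chain_X[OF chain_sigma_const[OF h] h0] lift_sets[OF C] in auto)
  finally show ?thesis .
qed

lemma const_event_pos: "\<forall>\<^sub>F h in at_right 0. 0 < measure (P a) (const_event h a)"
proof -
  have "((\<lambda>h. 1 - h * exit_rate a) \<longlongrightarrow> 1 - 0 * exit_rate a) (at_right 0)" by (intro tendsto_intros)
  then have "\<forall>\<^sub>F h in at_right 0. 0 < 1 - h * exit_rate a" by (rule order_tendstoD(1)) simp
  then show ?thesis using right_pos by eventually_elim (rule less_le_trans[OF _ const_event_prob])
qed

lemma levy_moment_X: "levy_moment N (X a 0) p"
proof unfold_locales
  show "\<forall>\<^sub>F h in at_right 0. L.nn_moment p h < \<infinity>"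
    using const_event_pos right_pos
  proof eventually_elim
    case (elim h)
    have "ennreal (measure (P a) (const_event h a)) * L.nn_moment p h < \<infinity>"
      using const_event_nn_moment[OF elim(2)] fin[OF elim(2), of a a] by (rule le_less_trans)
    then show ?case using elim(1) by (auto simp: ennreal_mult_less_top)
  qed
qed

sublocale LM: levy_moment N "X a 0" p by (rule levy_moment_X)

lemma real_mgf_diag_ge: "0 < h \<Longrightarrow> measure (P a) (const_event h a) * LM.moment h \<le> real_mgf p h a a"
  using const_event_nn_moment[of h]
  by (simp add: ennreal_rm[symmetric] LM.ennreal_moment[symmetric] ennreal_mult[symmetric] LM.moment_nonneg real_mgf_nonneg)

lemma real_mgf_diag_lower:
  obtains K where "\<forall>\<^sub>F h in at_right 0. 1 - K * h \<le> measure (P a) (const_event h a) * LM.moment h"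
proof -
  obtain \<delta> K where \<delta>: "0 < \<delta>" "0 \<le> K" and K: "\<And>h. 0 < h \<Longrightarrow> h \<le> \<delta> \<Longrightarrow> 1 - K * h \<le> LM.moment h"
    using LM.moment_ge by blast
  have t: "((\<lambda>h. 1 - h * exit_rate a) \<longlongrightarrow> 1 - 0 * exit_rate a) (at_right 0)"
    "((\<lambda>h. 1 - K * h) \<longlongrightarrow> 1 - K * 0) (at_right 0)" by (intro tendsto_intros)+
  have ev: "\<forall>\<^sub>F h in at_right 0. 0 < 1 - h * exit_rate a" "\<forall>\<^sub>F h in at_right 0. 0 < 1 - K * h"
    by (rule order_tendstoD(1)[OF t(1)], simp) (rule order_tendstoD(1)[OF t(2)], simp)
  have near: "\<forall>\<^sub>F h in at_right 0. 0 < h \<and> h \<le> \<delta>"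
    unfolding eventually_at_right_field using \<delta>(1) by (intro exI[of _ \<delta>]) auto
  have "\<forall>\<^sub>F h in at_right 0. 1 - (exit_rate a + K) * h \<le> measure (P a) (const_event h a) * LM.moment h"
    using ev near
  proof eventually_elim
    case (elim h)
    then have h: "0 < h" "h \<le> \<delta>" by auto
    have "0 \<le> h * exit_rate a * (K * h)" using h \<delta> exit_rate_nonneg by simp
    then have "1 - (exit_rate a + K) * h \<le> (1 - h * exit_rate a) * (1 - K * h)" by (simp add: algebra_simps)
    also have "\<dots> \<le> measure (P a) (const_event h a) * LM.moment h"
      using elim const_event_prob[OF h(1), of a] K[OF h] by (intro mult_mono) auto
    finally show ?case .
  qed
  then show ?thesis by (rule that)
qed

text \<open>Without a jump, \<open>\<xi>\<^sub>h\<close> is the Levy process of the state \<open>a\<close>, independent of the chain; this contributes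
  \<open>P(no jump) exp (h \<psi>)\<close>. The remaining event has probability \<open>o(h)\<close>, and the bounds on the real moments
  say that its share of the moment of order \<open>p\<close> is \<open>O(h)\<close>, so its contribution is \<open>o(h)\<close>.\<close>

lemma mgf_diag_derivative:
  assumes \<theta>: "0 \<le> \<theta>" "\<theta> < 1" and z: "Re z = \<theta> * p"
    and upper: "\<exists>K. \<forall>\<^sub>F h in at_right 0. real_mgf p h a a \<le> 1 + K * h"
  shows "((\<lambda>h. (mgf z h a a - 1) /\<^sub>R h) \<longlongrightarrow> laplace_exponent N (X a 0) z - of_real (exit_rate a)) (at_right 0)"
proof -
  define \<psi> where "\<psi> = laplace_exponent N (X a 0) z"
  define c where "c = (\<lambda>h. measure (P a) (const_event h a))"
  define E where "E = (\<lambda>h. (in_state h a))"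
  define R where "R = (\<lambda>h. E h - const_event h a)"
  define f where "f = (\<lambda>h. \<integral>\<omega>. indicat_real (R h) \<omega> * exp (\<theta> * p * \<xi> h \<omega>) \<partial>P a)"
  interpret Pa: prob_space "P a" by (rule prob)
  obtain K1 where K1: "\<forall>\<^sub>F h in at_right 0. 1 - K1 * h \<le> c h * LM.moment h"
    unfolding c_def using real_mgf_diag_lower by blast
  obtain K2 where K2: "\<forall>\<^sub>F h in at_right 0. real_mgf p h a a \<le> 1 + K2 * h" using upper by blast
  have sets: "const_event h a \<in> sets (P a)" "E h \<in> sets (P a)" "R h \<in> sets (P a)" if "0 < h" for h
    using const_event_sets[OF that] J_event[of h] that unfolding E_def R_def by auto
  have sub: "const_event h a \<subseteq> E h" if "0 < h" for h
    using const_event_imp[OF that] unfolding E_def by (auto simp: const_event_def)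
  have trans_probE: "trans_prob h a a = measure (P a) (E h)" for h by (simp add: trans_prob_def E_def)
  have pR: "measure (P a) (R h) = trans_prob h a a - c h" if "0 < h" for h
    unfolding R_def c_def trans_probE using sets[OF that] sub[OF that] by (intro Pa.finite_measure_Diff) auto
  have cle: "c h \<le> trans_prob h a a" if "0 < h" for h
    unfolding c_def trans_probE using sets[OF that] sub[OF that] by (intro Pa.finite_measure_mono) auto
  \<comment> \<open>The first-order behaviour of the probability of no jump is squeezed.\<close>
  have c': "((\<lambda>h. (1 - c h) / h) \<longlongrightarrow> exit_rate a) (at_right 0)"
  proof (rule tendsto_sandwich[OF _ _ trans_prob_exit_rate[of a] tendsto_const])
    show "\<forall>\<^sub>F h in at_right 0. (1 - trans_prob h a a) / h \<le> (1 - c h) / h"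
      using right_pos by eventually_elim (use cle in \<open>auto intro!: divide_right_mono\<close>)
    show "\<forall>\<^sub>F h in at_right 0. (1 - c h) / h \<le> exit_rate a"
      using right_pos
    proof eventually_elim
      case (elim h)
      then show ?case using const_event_prob[of h a] by (simp add: c_def field_simps)
    qed
  qed
  have c1: "(c \<longlongrightarrow> 1) (at_right 0)"
  proof -
    have "((\<lambda>h. 1 - h * ((1 - c h) / h)) \<longlongrightarrow> 1 - 0 * exit_rate a) (at_right 0)" by (intro tendsto_intros c')
    then show ?thesis by (rule tendsto_eventually_eq[OF _ eventually_mono[OF right_pos]]) simp_all
  qed
  have split: "mgf z h a a = of_real (c h) * exp (of_real h * \<psi>) +
      (\<integral>\<omega>. indicat_real (R h) \<omega> *\<^sub>R exp (z * of_real (\<xi> h \<omega>)) \<partial>P a)" if h: "0 < h" for h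
  proof -
    have h0: "0 \<le> h" using h by simp
    note [measurable] = \<xi>_measurable[OF h0] \<xi>_\<pi>_measurable[OF h0] L.X_measurable[OF h0] sets[OF h]
    let ?e = "\<lambda>x::real. exp (z * of_real x) :: complex"
    have int: "integrable (P a) (\<lambda>\<omega>. ?e (\<xi> h \<omega>))"
    proof -
      have "integrable (P a) (\<lambda>\<omega>. norm (?e (\<xi> h \<omega>)))"
        using exp_moment_split(1)[OF Pa.finite_measure_axioms \<xi>_measurable[OF h0] exp_moment_integrable[OF h] \<theta>]
        by (simp add: norm_exp_eq_Re z)
      then show ?thesis by (subst (asm) integrable_norm_iff) auto
    qed
    have "mgf z h a a = (\<integral>\<omega>. indicat_real (E h) \<omega> *\<^sub>R ?e (\<xi> h \<omega>) \<partial>P a)"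
      unfolding mgf_def E_def using h0 by (simp add: integral_law)
    also have "\<dots> = (\<integral>\<omega>. indicat_real (const_event h a) \<omega> *\<^sub>R ?e (\<xi> h \<omega>) + indicat_real (R h) \<omega> *\<^sub>R ?e (\<xi> h \<omega>) \<partial>P a)"
      by (rule Bochner_Integration.integral_cong) (use sub[OF h] in \<open>auto simp: R_def indicator_def\<close>)
    also have "\<dots> = (\<integral>\<omega>. indicat_real (const_event h a) \<omega> *\<^sub>R ?e (\<xi> h \<omega>) \<partial>P a) + (\<integral>\<omega>. indicat_real (R h) \<omega> *\<^sub>R ?e (\<xi> h \<omega>) \<partial>P a)"
      using integrable_mult_indicator[OF sets(1)[OF h] int] integrable_mult_indicator[OF sets(3)[OF h] int]
      by (rule Bochner_Integration.integral_add)
    also have "(\<integral>\<omega>. indicat_real (const_event h a) \<omega> *\<^sub>R ?e (\<xi> h \<omega>) \<partial>P a) =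
        c h *\<^sub>R (\<integral>\<eta>. ?e (X a 0 h \<eta>) \<partial>N)"
      unfolding c_def by (rule const_event_integral[OF h]) measurable
    also have "(\<integral>\<eta>. ?e (X a 0 h \<eta>) \<partial>N) = exp (of_real h * \<psi>)"
      using LM.moment_gf_eq_exp[OF \<theta> z h0] by (simp add: moment_gf_def \<psi>_def)
    finally show ?thesis by (simp add: scaleR_conv_of_real)
  qed
  have R0: "((\<lambda>h. measure (P a) (R h) / h) \<longlongrightarrow> 0) (at_right 0)"
  proof -
    have "((\<lambda>h. (1 - c h) / h - (1 - trans_prob h a a) / h) \<longlongrightarrow> exit_rate a - exit_rate a) (at_right 0)"
      by (intro tendsto_intros c' trans_prob_exit_rate)
    then show ?thesis
      by (rule tendsto_eventually_eq[OF _ eventually_mono[OF right_pos]])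
         (simp_all add: pR diff_divide_distrib[symmetric])
  qed
  have rest: "((\<lambda>h. f h / h) \<longlongrightarrow> 0) (at_right 0)"
  proof (rule tendsto_0_split[OF \<theta>(2) R0])
    show "\<forall>\<^sub>F h in at_right 0. 0 \<le> f h / h"
      using right_pos by eventually_elim (auto simp: f_def intro!: divide_nonneg_pos integral_nonneg_AE)
    fix r :: real assume r: "0 < r"
    show "\<forall>\<^sub>F h in at_right 0. f h / h \<le> r powr \<theta> * (measure (P a) (R h) / h) + r powr (\<theta> - 1) * (K1 + K2)"
      using right_pos K1 K2
    proof eventually_elim
      case (elim h)
      then have h: "0 < h" and h0: "0 \<le> h" by auto
      note [measurable] = \<xi>_measurable[OF h0] \<xi>_\<pi>_measurable[OF h0] L.X_measurable[OF h0] sets[OF h]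
      note int = exp_moment_integrable[OF h, of a]
      have Eeq: "E h = in_state h a" by (simp add: E_def)
      have "(\<integral>\<omega>. indicat_real (R h) \<omega> * exp (p * \<xi> h \<omega>) \<partial>P a) =
          (\<integral>\<omega>. indicat_real (E h) \<omega> * exp (p * \<xi> h \<omega>) - indicat_real (const_event h a) \<omega> * exp (p * \<xi> h \<omega>) \<partial>P a)"
        by (rule Bochner_Integration.integral_cong) (use sub[OF h] in \<open>auto simp: R_def indicator_def\<close>)
      also have "\<dots> = real_mgf p h a a - (\<integral>\<omega>. indicat_real (const_event h a) \<omega> * exp (p * \<xi> h \<omega>) \<partial>P a)"
        unfolding real_mgf_eq_integral[OF h] Eeq[symmetric]
        using integrable_mult_indicator[OF sets(1)[OF h] int] integrable_mult_indicator[OF sets(2)[OF h] int]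
        by (intro Bochner_Integration.integral_diff) simp_all
      also have "(\<integral>\<omega>. indicat_real (const_event h a) \<omega> * exp (p * \<xi> h \<omega>) \<partial>P a) =
          c h *\<^sub>R (\<integral>\<eta>. exp (p * X a 0 h \<eta>) \<partial>N)"
        unfolding c_def using const_event_integral[OF h, of "\<lambda>x. exp (p * x)"] by simp
      finally have "(\<integral>\<omega>. indicat_real (R h) \<omega> * exp (p * \<xi> h \<omega>) \<partial>P a) = real_mgf p h a a - c h * LM.moment h"
        by (simp add: LM.moment_def)
      then have b: "(\<integral>\<omega>. indicat_real (R h) \<omega> * exp (p * \<xi> h \<omega>) \<partial>P a) \<le> (K1 + K2) * h"
        using elim by (simp add: distrib_right)
      have "f h \<le> r powr \<theta> * measure (P a) (R h) + r powr (\<theta> - 1) * (\<integral>\<omega>. indicat_real (R h) \<omega> * exp (p * \<xi> h \<omega>) \<partial>P a)"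
        unfolding f_def
        by (rule exp_moment_split(2)[OF Pa.finite_measure_axioms \<xi>_measurable[OF h0] int \<theta> sets(3)[OF h] r])
      also have "\<dots> \<le> r powr \<theta> * measure (P a) (R h) + r powr (\<theta> - 1) * ((K1 + K2) * h)"
        using b by (intro add_left_mono mult_left_mono) auto
      finally show ?case using h by (simp add: field_simps)
    qed
  qed
  have restc: "((\<lambda>h. (\<integral>\<omega>. indicat_real (R h) \<omega> *\<^sub>R exp (z * of_real (\<xi> h \<omega>)) \<partial>P a) /\<^sub>R h) \<longlongrightarrow> (0::complex)) (at_right 0)"
  proof (rule Lim_null_comparison[OF _ rest])
    show "\<forall>\<^sub>F h in at_right 0. norm ((\<integral>\<omega>. indicat_real (R h) \<omega> *\<^sub>R exp (z * of_real (\<xi> h \<omega>)) \<partial>P a) /\<^sub>R h :: complex) \<le> f h / h"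
      using right_pos
    proof eventually_elim
      case (elim h)
      have "norm (\<integral>\<omega>. indicat_real (R h) \<omega> *\<^sub>R exp (z * of_real (\<xi> h \<omega>)) \<partial>P a :: complex) \<le>
          (\<integral>\<omega>. norm (indicat_real (R h) \<omega> *\<^sub>R exp (z * of_real (\<xi> h \<omega>)) :: complex) \<partial>P a)"
        by (rule integral_norm_bound)
      also have "\<dots> = f h" unfolding f_def by (simp add: norm_exp_eq_Re z)
      finally show ?case using elim by (simp add: divide_inverse mult.commute)
    qed
  qed
  have expd: "((\<lambda>h. (exp (of_real h * \<psi>) - 1) /\<^sub>R h) \<longlongrightarrow> \<psi>) (at_right 0)"
  proof -
    have "((\<lambda>t. exp (of_real t * \<psi>)) has_vector_derivative \<psi>) (at 0 within {0<..})"
      by (rule has_vector_derivative_real_field) (auto intro!: derivative_eq_intros)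
    then show ?thesis unfolding has_vector_derivative_iff_quotient by simp
  qed
  have "((\<lambda>h. of_real (c h) * ((exp (of_real h * \<psi>) - 1) /\<^sub>R h) - of_real ((1 - c h) / h) +
      (\<integral>\<omega>. indicat_real (R h) \<omega> *\<^sub>R exp (z * of_real (\<xi> h \<omega>)) \<partial>P a) /\<^sub>R h) \<longlongrightarrow>
      of_real 1 * \<psi> - of_real (exit_rate a) + 0) (at_right 0)"
    by (intro tendsto_intros expd c' c1 restc)
  then show ?thesis unfolding \<psi>_def[symmetric]
  proof (rule tendsto_eventually_eq[OF _ eventually_mono[OF right_pos]])
    fix h :: real assume h: "0 < h"
    show "of_real (c h) * ((exp (of_real h * \<psi>) - 1) /\<^sub>R h) - of_real ((1 - c h) / h) +
      (\<integral>\<omega>. indicat_real (R h) \<omega> *\<^sub>R exp (z * of_real (\<xi> h \<omega>)) \<partial>P a) /\<^sub>R h = (mgf z h a a - 1) /\<^sub>R h"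
      unfolding split[OF h] using h by (simp add: scaleR_conv_of_real field_simps)
  qed simp
qed

end

context decomposed_start
begin

subsection \<open>The off-diagonal entries\<close>

text \<open>The part of \<open>{J\<^sub>h = b}\<close> on which \<open>\<xi>\<^sub>h\<close> may be far from the jump \<open>V a b 0\<close>: the chain jumps more than
  once, or one of the two Levy processes involved moves away from its start.\<close>

definition rare :: "'e \<Rightarrow> real \<Rightarrow> real \<Rightarrow> 'v set" where
  "rare b \<epsilon> h = (lift (in_state h b) - lift (switch_event h a b)) \<union>
     (lift (in_state h b) \<inter> wander b \<epsilon> h)"

lemma rare_sets: "0 < h \<Longrightarrow> a \<noteq> b \<Longrightarrow> rare b \<epsilon> h \<in> sets N"
  unfolding rare_def
  by (intro sets.Un sets.Diff sets.Int lift_sets wander_sets switch_event_sets J_event) simp_all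

lemma rare_subset: "rare b \<epsilon> h \<subseteq> lift (in_state h b)"
  by (auto simp: rare_def)

lemma not_rare:
  assumes h: "0 < h" and ab: "a \<noteq> b"
  shows "AE \<eta> in N. \<eta> \<in> lift (in_state h b) - rare b \<epsilon> h \<longrightarrow> \<bar>\<xi> h (\<pi> \<eta>) - V a b 0 \<eta>\<bar> \<le> 2 * \<epsilon>"
  using path_switch[OF h ab, of \<epsilon>] by eventually_elim (auto simp: rare_def)

text \<open>Multiple jumps have probability \<open>o(h)\<close>, and the movement of the Levy processes is independent of
  \<open>{J\<^sub>h = b}\<close>, an event of probability \<open>O(h)\<close>.\<close>

lemma rare_tendsto_0:
  assumes ab: "a \<noteq> b" and \<epsilon>: "0 < \<epsilon>"
  shows "((\<lambda>h. N.prob (rare b \<epsilon> h) / h) \<longlongrightarrow> 0) (at_right 0)"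
proof -
  define W where "W = (\<lambda>h. N.prob (levy.escape N (X a 0) \<epsilon> (2 * h)) + N.prob (levy.escape N (X b 1) \<epsilon> (2 * h)))"
  have W: "(W \<longlongrightarrow> 0) (at_right 0)" unfolding W_def by (rule wander_tendsto_0[OF \<epsilon>])
  have id: "((\<lambda>h::real. h) \<longlongrightarrow> 0) (at_right 0)" by (rule tendsto_ident_at)
  have lim: "((\<lambda>h. trans_prob h a b / h - q a b * (1 - h * exit_rate a - h * exit_rate b) + trans_prob h a b / h * W h) \<longlongrightarrow>
      q a b - q a b * (1 - 0 * exit_rate a - 0 * exit_rate b) + q a b * 0) (at_right 0)"
    by (intro tendsto_intros trans_prob_rate[OF ab] W id)
  show ?thesis
  proof (rule tendsto_sandwich[OF _ _ tendsto_const])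
    show "\<forall>\<^sub>F h in at_right 0. 0 \<le> N.prob (rare b \<epsilon> h) / h"
      using right_pos by eventually_elim simp
    show "((\<lambda>h. trans_prob h a b / h - q a b * (1 - h * exit_rate a - h * exit_rate b) + trans_prob h a b / h * W h) \<longlongrightarrow> 0) (at_right 0)"
      using lim by simp
    show "\<forall>\<^sub>F h in at_right 0. N.prob (rare b \<epsilon> h) / h \<le>
        trans_prob h a b / h - q a b * (1 - h * exit_rate a - h * exit_rate b) + trans_prob h a b / h * W h"
      using right_pos
    proof eventually_elim
      case (elim h)
      let ?E = "(in_state h b)" and ?S = "switch_event h a b"
      have E: "?E \<in> sets (P a)" using elim by (intro J_event) simp
      have S: "?S \<in> sets (P a)" by (rule switch_event_sets[OF elim ab])
      have sub: "?S \<subseteq> ?E" using switch_event_imp[OF elim] by (auto simp: switch_event_def)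
      have "N.prob (lift ?E - lift ?S) = N.prob (lift ?E) - N.prob (lift ?S)"
        using sub by (intro N.finite_measure_Diff lift_sets E S) (auto simp: lift_def)
      then have 1: "N.prob (lift ?E - lift ?S) \<le> trans_prob h a b - h * q a b * (1 - h * exit_rate a - h * exit_rate b)"
        using switch_event_prob[OF elim ab] by (simp add: lift_prob E S trans_prob_def)
      have "N.prob (rare b \<epsilon> h) \<le> N.prob (lift ?E - lift ?S) + N.prob (lift ?E \<inter> wander b \<epsilon> h)"
        unfolding rare_def by (intro measure_Un_le sets.Diff sets.Int lift_sets E S wander_sets)
      also have "\<dots> \<le> trans_prob h a b - h * q a b * (1 - h * exit_rate a - h * exit_rate b) + trans_prob h a b * W h"
        using 1 prob_J_wander[OF elim, of b \<epsilon>] unfolding W_def by linarith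
      finally show ?case using elim by (simp add: field_simps)
    qed
  qed
qed

lemma J_V_integral:
  fixes f :: "real \<Rightarrow> 'c::{banach, second_countable_topology}"
  assumes h: "0 < h" and f: "f \<in> borel_measurable borel"
  shows "(\<integral>\<eta>. indicat_real (lift (in_state h b)) \<eta> *\<^sub>R f (V a b 0 \<eta>) \<partial>N) =
    trans_prob h a b *\<^sub>R (\<integral>\<eta>. f (V a b 0 \<eta>) \<partial>N)"
proof -
  have E: "(in_state h b) \<in> sets (P a)" using h by (intro J_event) simp
  have C: "lift (in_state h b) \<in> chain_sigma" unfolding lift_J using h by (intro chain_sigma_J) simp
  have "N.prob (lift (in_state h b)) = trans_prob h a b"
    unfolding trans_prob_def by (rule lift_prob[OF E])
  then show ?thesis
    using N.indep_event_integral[OF lift_sets[OF E] V_measurable[of a b 0] indep_chain_V[OF C] f] by (simp only:)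
qed

lemma J_lift_integral:
  fixes f :: "real \<Rightarrow> 'c::{banach, second_countable_topology}"
  assumes h: "0 < h" and [measurable]: "f \<in> borel_measurable borel"
  shows "(\<integral>\<omega>. indicat_real (in_state h b) \<omega> *\<^sub>R f (\<xi> h \<omega>) \<partial>P a) =
    (\<integral>\<eta>. indicat_real (lift (in_state h b)) \<eta> *\<^sub>R f (\<xi> h (\<pi> \<eta>)) \<partial>N)"
proof -
  have h0: "0 \<le> h" using h by simp
  note [measurable] = \<xi>_measurable[OF h0] J_event[OF h0]
  have "(\<integral>\<omega>. indicat_real (in_state h b) \<omega> *\<^sub>R f (\<xi> h \<omega>) \<partial>P a) =
      (\<integral>\<eta>. indicat_real (in_state h b) (\<pi> \<eta>) *\<^sub>R f (\<xi> h (\<pi> \<eta>)) \<partial>N)"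
    by (rule lift_integral) measurable
  also have "\<dots> = (\<integral>\<eta>. indicat_real (lift (in_state h b)) \<eta> *\<^sub>R f (\<xi> h (\<pi> \<eta>)) \<partial>N)"
    by (rule Bochner_Integration.integral_cong) (auto simp: lift_def indicator_def)
  finally show ?thesis .
qed

lemma real_mgf_eq_lift:
  assumes h: "0 < h"
  shows "real_mgf p h a b = (\<integral>\<eta>. indicat_real (lift (in_state h b)) \<eta> * exp (p * \<xi> h (\<pi> \<eta>)) \<partial>N)"
    and "integrable N (\<lambda>\<eta>. exp (p * \<xi> h (\<pi> \<eta>)))"
proof -
  have h0: "0 \<le> h" using h by simp
  note [measurable] = \<xi>_measurable[OF h0] J_event[OF h0]
  show "real_mgf p h a b = (\<integral>\<eta>. indicat_real (lift (in_state h b)) \<eta> * exp (p * \<xi> h (\<pi> \<eta>)) \<partial>N)"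
    unfolding real_mgf_eq_integral[OF h] using J_lift_integral[OF h, of "\<lambda>x. exp (p * x)" b] by simp
  show "integrable N (\<lambda>\<eta>. exp (p * \<xi> h (\<pi> \<eta>)))"
    using exp_moment_integrable[OF h, of a] by (subst (asm) lift_integrable) auto
qed

text \<open>The truncated moments of the jump are bounded by the slope of the moment of \<open>\<xi>\<^sub>h\<close> over
  \<open>{J\<^sub>h = b}\<close>, because on most of this event \<open>\<xi>\<^sub>h\<close> is within distance 2 of the jump.\<close>

lemma jump_moment_integrable:
  assumes ab: "a \<noteq> b" and q: "0 < q a b"
    and upper: "\<exists>K. \<forall>\<^sub>F h in at_right 0. real_mgf p h a b \<le> K * h"
  shows "integrable N (\<lambda>\<eta>. exp (p * V a b 0 \<eta>))"
proof -
  note [measurable] = V_measurable[of a b 0]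
  obtain K where K: "\<forall>\<^sub>F h in at_right 0. real_mgf p h a b \<le> K * h" using upper by blast
  define g where "g = (\<lambda>n v. min (exp (p * v)) (real n))"
  have g01: "0 \<le> g n v" "g n v \<le> real n" "g n v \<le> exp (p * v)" for n v by (auto simp: g_def)
  have gm[measurable]: "g n \<in> borel_measurable borel" for n unfolding g_def by measurable
  have gi: "integrable N (\<lambda>\<eta>. g n (V a b 0 \<eta>))" for n
    by (rule N.integrable_const_bound[of _ "real n"]) (use g01 in auto)
  define B where "B = K * exp (2 * \<bar>p\<bar>) / q a b"
  have bound: "(\<integral>\<eta>. g n (V a b 0 \<eta>) \<partial>N) \<le> B" for n
  proof -
    define G where "G = (\<integral>\<eta>. g n (V a b 0 \<eta>) \<partial>N)"
    let ?c = "exp (- (2 * \<bar>p\<bar>))"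
    have "((\<lambda>h. ?c * (trans_prob h a b / h * G - real n * (N.prob (rare b 1 h) / h))) \<longlongrightarrow>
        ?c * (q a b * G - real n * 0)) (at_right 0)"
      by (intro tendsto_intros trans_prob_rate[OF ab] rare_tendsto_0[OF ab]) simp
    moreover have "\<forall>\<^sub>F h in at_right 0. ?c * (trans_prob h a b / h * G - real n * (N.prob (rare b 1 h) / h)) \<le> K"
      using right_pos K
    proof eventually_elim
      case (elim h)
      then have h: "0 < h" and h0: "0 \<le> h" by auto
      let ?E = "lift (in_state h b)" and ?R = "rare b 1 h"
      have E[measurable]: "?E \<in> sets N" using h by (intro lift_sets J_event) simp
      have R[measurable]: "?R \<in> sets N" by (rule rare_sets[OF h ab])
      note [measurable] = \<xi>_\<pi>_measurable[OF h0]
      have iR: "integrable N (indicat_real ?R)"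
        by (rule integrable_real_indicator[OF R]) (simp add: less_top[symmetric])
      have "trans_prob h a b * G - real n * N.prob ?R =
          (\<integral>\<eta>. indicat_real ?E \<eta> * g n (V a b 0 \<eta>) - real n * indicat_real ?R \<eta> \<partial>N)"
        using J_V_integral[OF h gm[of n], of b] integrable_mult_indicator[OF E gi] iR
        by (subst Bochner_Integration.integral_diff) (simp_all add: G_def)
      also have "\<dots> \<le> (\<integral>\<eta>. exp (2 * \<bar>p\<bar>) * (indicat_real ?E \<eta> * exp (p * \<xi> h (\<pi> \<eta>))) \<partial>N)"
      proof (rule integral_mono_AE)
        show "integrable N (\<lambda>\<eta>. indicat_real ?E \<eta> * g n (V a b 0 \<eta>) - real n * indicat_real ?R \<eta>)"
          using integrable_mult_indicator[OF E gi] iR by simp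
        show "integrable N (\<lambda>\<eta>. exp (2 * \<bar>p\<bar>) * (indicat_real ?E \<eta> * exp (p * \<xi> h (\<pi> \<eta>))))"
          using integrable_mult_indicator[OF E real_mgf_eq_lift(2)[OF h]] by simp
        show "AE \<eta> in N. indicat_real ?E \<eta> * g n (V a b 0 \<eta>) - real n * indicat_real ?R \<eta> \<le>
            exp (2 * \<bar>p\<bar>) * (indicat_real ?E \<eta> * exp (p * \<xi> h (\<pi> \<eta>)))"
          using not_rare[OF h ab, of 1]
        proof eventually_elim
          case (elim \<eta>)
          consider "\<eta> \<in> ?R" | "\<eta> \<in> ?E - ?R" | "\<eta> \<notin> ?E" by auto
          then show ?case
          proof cases
            case 1
            then have "\<eta> \<in> ?E" using rare_subset by blast
            then have "indicat_real ?E \<eta> * g n (V a b 0 \<eta>) - real n * indicat_real ?R \<eta> \<le> 0"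
              using 1 g01(2)[of n] by simp
            also have "0 \<le> exp (2 * \<bar>p\<bar>) * (indicat_real ?E \<eta> * exp (p * \<xi> h (\<pi> \<eta>)))" by simp
            finally show ?thesis .
          next
            case 2
            then have d: "\<bar>V a b 0 \<eta> - \<xi> h (\<pi> \<eta>)\<bar> \<le> 2" using elim by auto
            have "p * (V a b 0 \<eta> - \<xi> h (\<pi> \<eta>)) \<le> \<bar>p\<bar> * \<bar>V a b 0 \<eta> - \<xi> h (\<pi> \<eta>)\<bar>" by (simp flip: abs_mult)
            also have "\<dots> \<le> \<bar>p\<bar> * 2" using d by (intro mult_left_mono) auto
            finally have "exp (p * V a b 0 \<eta>) \<le> exp (2 * \<bar>p\<bar> + p * \<xi> h (\<pi> \<eta>))" by (simp add: right_diff_distrib)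
            then have "g n (V a b 0 \<eta>) \<le> exp (2 * \<bar>p\<bar>) * exp (p * \<xi> h (\<pi> \<eta>))"
              using g01(3)[of n "V a b 0 \<eta>"] by (simp add: exp_add)
            then show ?thesis using 2 by simp
          next
            case 3
            then have "\<eta> \<notin> ?R" using rare_subset by blast
            with 3 show ?thesis by simp
          qed
        qed
      qed
      also have "\<dots> = exp (2 * \<bar>p\<bar>) * real_mgf p h a b" by (simp add: real_mgf_eq_lift(1)[OF h])
      also have "\<dots> \<le> exp (2 * \<bar>p\<bar>) * (K * h)" using elim by (intro mult_left_mono) auto
      finally have *: "trans_prob h a b * G - real n * N.prob ?R \<le> exp (2 * \<bar>p\<bar>) * (K * h)" .
      have "?c * (trans_prob h a b / h * G - real n * (N.prob (rare b 1 h) / h)) = ?c * ((trans_prob h a b * G - real n * N.prob ?R) / h)"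
        using h by (simp add: field_simps)
      also have "\<dots> \<le> ?c * (exp (2 * \<bar>p\<bar>) * (K * h) / h)"
        using * h by (intro mult_left_mono divide_right_mono) auto
      also have "\<dots> = K" using h by (simp add: exp_minus)
      finally show ?case .
    qed
    ultimately have "?c * (q a b * G - real n * 0) \<le> K" by (rule tendsto_upperbound) simp
    then show ?thesis using q by (simp add: B_def G_def exp_minus field_simps)
  qed
  have "(\<lambda>n. \<integral>\<^sup>+\<eta>. ennreal (g n (V a b 0 \<eta>)) \<partial>N) \<longlonglongrightarrow> (\<integral>\<^sup>+\<eta>. ennreal (exp (p * V a b 0 \<eta>)) \<partial>N)"
  proof (rule nn_integral_LIMSEQ)
    show "incseq (\<lambda>n \<eta>. ennreal (g n (V a b 0 \<eta>)))"
      by (auto simp: incseq_def le_fun_def g_def intro!: ennreal_leI)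
    show "(\<lambda>n. ennreal (g n (V a b 0 \<eta>))) \<longlonglongrightarrow> ennreal (exp (p * V a b 0 \<eta>))" for \<eta>
    proof (rule tendsto_eventually)
      obtain m where m: "exp (p * V a b 0 \<eta>) \<le> real m" using real_arch_simple by blast
      show "\<forall>\<^sub>F n in sequentially. ennreal (g n (V a b 0 \<eta>)) = ennreal (exp (p * V a b 0 \<eta>))"
        using eventually_ge_at_top[of m]
      proof eventually_elim
        case (elim n)
        then have "exp (p * V a b 0 \<eta>) \<le> real n" using m by (meson of_nat_mono order_trans)
        then show ?case by (simp add: g_def)
      qed
    qed
  qed measurable
  moreover have "(\<integral>\<^sup>+\<eta>. ennreal (g n (V a b 0 \<eta>)) \<partial>N) \<le> ennreal B" for n
    using bound[of n] g01(1) gi by (subst nn_integral_eq_integral) (auto intro!: ennreal_leI)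
  ultimately have "(\<integral>\<^sup>+\<eta>. ennreal (exp (p * V a b 0 \<eta>)) \<partial>N) \<le> ennreal B"
    by (intro LIMSEQ_le_const2) auto
  then show ?thesis by (intro integrableI_bounded) (auto simp: le_less_trans[OF _ ennreal_less_top])
qed

text \<open>Up to \<open>o(h)\<close>, \<open>\<xi>\<^sub>h\<close> may be replaced by the jump, which is independent of the chain. This avoids
  the evaluation of the Levy processes at the random jump time. If the rate is 0, the jump may fail
  to have exponential moments, but then \<open>{J\<^sub>h = b}\<close> itself has probability \<open>o(h)\<close>.\<close>

lemma mgf_offdiag_derivative:
  assumes \<theta>: "0 \<le> \<theta>" "\<theta> < 1" and z: "Re z = \<theta> * p" and ab: "a \<noteq> b"
    and upper: "\<exists>K. \<forall>\<^sub>F h in at_right 0. real_mgf p h a b \<le> K * h"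
  shows "((\<lambda>h. mgf z h a b /\<^sub>R h) \<longlongrightarrow> of_real (q a b) * moment_gf N (V a b 0) z) (at_right 0)"
proof -
  note [measurable] = V_measurable[of a b 0]
  obtain K where K: "\<forall>\<^sub>F h in at_right 0. real_mgf p h a b \<le> K * h" using upper by blast
  let ?E = "\<lambda>h. lift (in_state h b)"
  let ?e = "\<lambda>x::real. exp (z * of_real x) :: complex"
  have ne: "norm (?e x) = exp (\<theta> * p * x)" for x by (simp add: norm_exp_eq_Re z)
  have E: "?E h \<in> sets N" if "0 < h" for h using that by (intro lift_sets J_event) simp
  have \<xi>m: "(\<lambda>\<eta>. \<xi> h (\<pi> \<eta>)) \<in> borel_measurable N" if "0 < h" for h using that by (intro \<xi>_\<pi>_measurable) simp
  have int\<theta>: "integrable N (\<lambda>\<eta>. exp (\<theta> * p * \<xi> h (\<pi> \<eta>)))" if "0 < h" for h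
    by (rule exp_moment_split(1)[OF N.finite_measure_axioms \<xi>m[OF that] real_mgf_eq_lift(2)[OF that] \<theta>])
  have inte: "integrable N (\<lambda>\<eta>. ?e (\<xi> h (\<pi> \<eta>)))" if h: "0 < h" for h
  proof -
    note [measurable] = \<xi>m[OF h]
    have "integrable N (\<lambda>\<eta>. norm (?e (\<xi> h (\<pi> \<eta>))))" unfolding ne by (rule int\<theta>[OF h])
    then show ?thesis by (subst (asm) integrable_norm_iff) auto
  qed
  have mgf_eq: "mgf z h a b = (\<integral>\<eta>. indicat_real (?E h) \<eta> *\<^sub>R ?e (\<xi> h (\<pi> \<eta>)) \<partial>N)" if h: "0 < h" for h
    unfolding mgf_def using h J_lift_integral[OF h, of ?e b] by (simp add: integral_law)
  \<comment> \<open>Sub-events of \<open>{J\<^sub>h = b}\<close> of probability \<open>o(h)\<close> contribute \<open>o(h)\<close>.\<close>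
  have small: "((\<lambda>h. (\<integral>\<eta>. indicat_real (C h) \<eta> * exp (\<theta> * p * Z h \<eta>) \<partial>N) / h) \<longlongrightarrow> 0) (at_right 0)"
    if C: "\<And>h. 0 < h \<Longrightarrow> C h \<in> sets N" "((\<lambda>h. N.prob (C h) / h) \<longlongrightarrow> 0) (at_right 0)"
      and Z: "\<And>h. 0 < h \<Longrightarrow> Z h \<in> borel_measurable N" "\<And>h. 0 < h \<Longrightarrow> integrable N (\<lambda>\<eta>. exp (p * Z h \<eta>))"
      and L: "\<forall>\<^sub>F h in at_right 0. (\<integral>\<eta>. indicat_real (C h) \<eta> * exp (p * Z h \<eta>) \<partial>N) \<le> L * h"
    for C :: "real \<Rightarrow> 'v set" and Z L
  proof (rule tendsto_0_split[OF \<theta>(2) C(2)])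
    show "\<forall>\<^sub>F h in at_right 0. 0 \<le> (\<integral>\<eta>. indicat_real (C h) \<eta> * exp (\<theta> * p * Z h \<eta>) \<partial>N) / h"
      using right_pos by eventually_elim (auto intro!: divide_nonneg_pos integral_nonneg_AE)
    fix r :: real assume r: "0 < r"
    show "\<forall>\<^sub>F h in at_right 0. (\<integral>\<eta>. indicat_real (C h) \<eta> * exp (\<theta> * p * Z h \<eta>) \<partial>N) / h \<le>
        r powr \<theta> * (N.prob (C h) / h) + r powr (\<theta> - 1) * L"
      using right_pos L
    proof eventually_elim
      case (elim h)
      have "(\<integral>\<eta>. indicat_real (C h) \<eta> * exp (\<theta> * p * Z h \<eta>) \<partial>N) \<le>
          r powr \<theta> * N.prob (C h) + r powr (\<theta> - 1) * (\<integral>\<eta>. indicat_real (C h) \<eta> * exp (p * Z h \<eta>) \<partial>N)"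
        by (rule exp_moment_split(2)[OF N.finite_measure_axioms Z(1)[OF elim(1)] Z(2)[OF elim(1)] \<theta> C(1)[OF elim(1)] r])
      also have "\<dots> \<le> r powr \<theta> * N.prob (C h) + r powr (\<theta> - 1) * (L * h)"
        using elim by (intro add_left_mono mult_left_mono) auto
      finally show ?case using elim by (simp add: field_simps)
    qed
  qed
  have sub_le: "\<forall>\<^sub>F h in at_right 0. (\<integral>\<eta>. indicat_real (C h) \<eta> * exp (p * \<xi> h (\<pi> \<eta>)) \<partial>N) \<le> K * h"
    if C: "\<And>h. 0 < h \<Longrightarrow> C h \<in> sets N" "\<And>h. C h \<subseteq> ?E h" for C
    using right_pos K
  proof eventually_elim
    case (elim h)
    have "(\<integral>\<eta>. indicat_real (C h) \<eta> * exp (p * \<xi> h (\<pi> \<eta>)) \<partial>N) \<le> real_mgf p h a b"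
      unfolding real_mgf_eq_lift(1)[OF elim(1)]
      using integrable_mult_indicator[OF C(1)[OF elim(1)] real_mgf_eq_lift(2)[OF elim(1)]]
        integrable_mult_indicator[OF E[OF elim(1)] real_mgf_eq_lift(2)[OF elim(1)]] C(2)[of h]
      by (intro integral_mono) (auto simp: indicator_def)
    with elim show ?case by simp
  qed
  show ?thesis
  proof (cases "q a b = 0")
    case True
    have "((\<lambda>h. N.prob (?E h) / h) \<longlongrightarrow> q a b) (at_right 0)"
    proof (rule tendsto_eventually_eq[OF trans_prob_rate[OF ab] eventually_mono[OF right_pos]])
      fix h :: real assume h: "0 < h"
      have "(in_state h b) \<in> sets (P a)" using h by (intro J_event) simp
      then show "trans_prob h a b / h = N.prob (?E h) / h" by (simp add: lift_prob trans_prob_def)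
    qed simp
    then have E0: "((\<lambda>h. N.prob (?E h) / h) \<longlongrightarrow> 0) (at_right 0)" using True by simp
    have "((\<lambda>h. (\<integral>\<eta>. indicat_real (?E h) \<eta> * exp (\<theta> * p * \<xi> h (\<pi> \<eta>)) \<partial>N) / h) \<longlongrightarrow> 0) (at_right 0)"
      by (rule small[OF E E0 \<xi>m real_mgf_eq_lift(2) sub_le[OF E order_refl]])
    then have "((\<lambda>h. mgf z h a b /\<^sub>R h) \<longlongrightarrow> 0) (at_right 0)"
    proof (rule Lim_null_comparison[rotated])
      show "\<forall>\<^sub>F h in at_right 0. norm (mgf z h a b /\<^sub>R h) \<le> (\<integral>\<eta>. indicat_real (?E h) \<eta> * exp (\<theta> * p * \<xi> h (\<pi> \<eta>)) \<partial>N) / h"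
        using right_pos
      proof eventually_elim
        case (elim h)
        have "norm (mgf z h a b) \<le> (\<integral>\<eta>. norm (indicat_real (?E h) \<eta> *\<^sub>R ?e (\<xi> h (\<pi> \<eta>))) \<partial>N)"
          unfolding mgf_eq[OF elim] by (rule integral_norm_bound)
        then show ?case using elim by (simp add: z divide_inverse mult.commute)
      qed
    qed
    with True show ?thesis by simp
  next
    case False
    then have q: "0 < q a b" using q_nonneg[OF ab] by simp
    have iV: "integrable N (\<lambda>\<eta>. exp (p * V a b 0 \<eta>))" by (rule jump_moment_integrable[OF ab q upper])
    have iV\<theta>: "integrable N (\<lambda>\<eta>. exp (\<theta> * p * V a b 0 \<eta>))"
      by (rule exp_moment_split(1)[OF N.finite_measure_axioms V_measurable iV \<theta>])
    have iVe: "integrable N (\<lambda>\<eta>. ?e (V a b 0 \<eta>))"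
    proof -
      have "integrable N (\<lambda>\<eta>. norm (?e (V a b 0 \<eta>)))" unfolding ne by (rule iV\<theta>)
      then show ?thesis by (subst (asm) integrable_norm_iff) auto
    qed
    define A where "A = (\<integral>\<eta>. exp (\<theta> * p * V a b 0 \<eta>) \<partial>N)"
    have A0: "0 \<le> A" unfolding A_def by (rule integral_nonneg_AE) simp
    have diff: "((\<lambda>h. mgf z h a b /\<^sub>R h - of_real (trans_prob h a b / h) * moment_gf N (V a b 0) z) \<longlongrightarrow> 0) (at_right 0)"
    proof (rule tendstoI)
      fix e :: real assume e: "0 < e"
      define D where "D = (q a b + 1) * A"
      have D0: "0 \<le> D" unfolding D_def using q A0 by (intro mult_nonneg_nonneg) auto
      define \<kappa> where "\<kappa> = e / (2 * (D + 1))"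
      have \<kappa>: "0 < \<kappa>" unfolding \<kappa>_def using e D0 by (intro divide_pos_pos) auto
      have "\<kappa> * (D + 1) = e / 2" unfolding \<kappa>_def using D0 by (simp add: field_simps)
      then have "\<kappa> * D + \<kappa> = e / 2" by (simp only: distrib_left mult_1_right)
      then have \<kappa>2: "\<kappa> * D < e" using \<kappa> e by linarith
      have "((\<lambda>x. ?e x) \<longlongrightarrow> ?e 0) (at 0)" by (intro tendsto_intros)
      then have "\<forall>\<^sub>F x in at 0. dist (?e x) (?e 0) < \<kappa>" using \<kappa> by (intro tendstoD) auto
      then obtain d where d: "0 < d" "\<And>x. x \<noteq> 0 \<Longrightarrow> \<bar>x\<bar> < d \<Longrightarrow> norm (?e x - 1) < \<kappa>"
        by (auto simp: eventually_at dist_norm)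
      define \<epsilon> where "\<epsilon> = d / 4"
      have \<epsilon>: "0 < \<epsilon>" "\<And>x. \<bar>x\<bar> \<le> 2 * \<epsilon> \<Longrightarrow> norm (?e x - 1) \<le> \<kappa>"
      proof -
        fix x :: real assume "\<bar>x\<bar> \<le> 2 * \<epsilon>"
        then show "norm (?e x - 1) \<le> \<kappa>"
          using d(1) d(2)[of x] \<kappa> by (cases "x = 0") (auto simp: \<epsilon>_def)
      qed (use d in \<open>simp add: \<epsilon>_def\<close>)
      let ?R = "rare b \<epsilon>"
      have R: "?R h \<in> sets N" if "0 < h" for h by (rule rare_sets[OF that ab])
      define f1 where "f1 = (\<lambda>h. \<integral>\<eta>. indicat_real (?R h) \<eta> * exp (\<theta> * p * \<xi> h (\<pi> \<eta>)) \<partial>N)"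
      define f2 where "f2 = (\<lambda>h. \<integral>\<eta>. indicat_real (?R h) \<eta> * exp (\<theta> * p * V a b 0 \<eta>) \<partial>N)"
      have f1: "((\<lambda>h. f1 h / h) \<longlongrightarrow> 0) (at_right 0)"
        unfolding f1_def
        by (rule small[OF R rare_tendsto_0[OF ab \<epsilon>(1)] \<xi>m real_mgf_eq_lift(2) sub_le[OF R rare_subset]])
      have trans_prob_le: "\<forall>\<^sub>F h in at_right 0. trans_prob h a b \<le> (q a b + 1) * h"
      proof -
        have "\<forall>\<^sub>F h in at_right 0. trans_prob h a b / h < q a b + 1" by (rule order_tendstoD(2)[OF trans_prob_rate[OF ab]]) simp
        then show ?thesis using right_pos by eventually_elim (simp add: field_simps)
      qed
      have f2: "((\<lambda>h. f2 h / h) \<longlongrightarrow> 0) (at_right 0)"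
        unfolding f2_def
      proof (rule small[OF R rare_tendsto_0[OF ab \<epsilon>(1)] V_measurable iV])
        show "\<forall>\<^sub>F h in at_right 0. (\<integral>\<eta>. indicat_real (?R h) \<eta> * exp (p * V a b 0 \<eta>) \<partial>N) \<le>
            (q a b + 1) * (\<integral>\<eta>. exp (p * V a b 0 \<eta>) \<partial>N) * h"
          using right_pos trans_prob_le
        proof eventually_elim
          case (elim h)
          have "(\<integral>\<eta>. indicat_real (?R h) \<eta> * exp (p * V a b 0 \<eta>) \<partial>N) \<le> (\<integral>\<eta>. indicat_real (?E h) \<eta> *\<^sub>R exp (p * V a b 0 \<eta>) \<partial>N)"
            using integrable_mult_indicator[OF R[OF elim(1)] iV] integrable_mult_indicator[OF E[OF elim(1)] iV] rare_subset[of b \<epsilon> h]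
            by (intro integral_mono) (auto simp: indicator_def)
          also have "\<dots> = trans_prob h a b * (\<integral>\<eta>. exp (p * V a b 0 \<eta>) \<partial>N)"
            using J_V_integral[OF elim(1), of "\<lambda>v. exp (p * v)" b] by simp
          also have "\<dots> \<le> (q a b + 1) * h * (\<integral>\<eta>. exp (p * V a b 0 \<eta>) \<partial>N)"
            using elim(2) by (intro mult_right_mono integral_nonneg_AE) auto
          finally show ?case by (simp add: mult_ac)
        qed
      qed
      have "((\<lambda>h. f1 h / h + f2 h / h + \<kappa> * (trans_prob h a b / h * A)) \<longlongrightarrow> 0 + 0 + \<kappa> * (q a b * A)) (at_right 0)"
        by (intro tendsto_intros f1 f2 trans_prob_rate[OF ab])
      moreover have "\<kappa> * (q a b * A) < e"
      proof -
        have "\<kappa> * (q a b * A) \<le> \<kappa> * D" unfolding D_def using \<kappa> A0 by (intro mult_left_mono mult_right_mono) auto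
        then show ?thesis using \<kappa>2 by linarith
      qed
      ultimately have "\<forall>\<^sub>F h in at_right 0. f1 h / h + f2 h / h + \<kappa> * (trans_prob h a b / h * A) < e"
        by (intro order_tendstoD(2)) auto
      then show "\<forall>\<^sub>F h in at_right 0. dist (mgf z h a b /\<^sub>R h - of_real (trans_prob h a b / h) * moment_gf N (V a b 0) z) 0 < e"
        using right_pos
      proof eventually_elim
        case (elim h)
        then have h: "0 < h" by simp
        note [measurable] = E[OF h] R[OF h] \<xi>m[OF h]
        note iE = integrable_mult_indicator[OF E[OF h]] and iR = integrable_mult_indicator[OF R[OF h]]
        have "mgf z h a b - of_real (trans_prob h a b) * moment_gf N (V a b 0) z =
            (\<integral>\<eta>. indicat_real (?E h) \<eta> *\<^sub>R ?e (\<xi> h (\<pi> \<eta>)) \<partial>N) - (\<integral>\<eta>. indicat_real (?E h) \<eta> *\<^sub>R ?e (V a b 0 \<eta>) \<partial>N)"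
          using J_V_integral[OF h, of ?e b] by (simp add: mgf_eq[OF h] moment_gf_def scaleR_conv_of_real)
        also have "\<dots> = (\<integral>\<eta>. indicat_real (?E h) \<eta> *\<^sub>R ?e (\<xi> h (\<pi> \<eta>)) - indicat_real (?E h) \<eta> *\<^sub>R ?e (V a b 0 \<eta>) \<partial>N)"
          by (rule Bochner_Integration.integral_diff[symmetric, OF iE[OF inte[OF h]] iE[OF iVe]])
        also have "norm \<dots> \<le> (\<integral>\<eta>. norm (indicat_real (?E h) \<eta> *\<^sub>R ?e (\<xi> h (\<pi> \<eta>)) - indicat_real (?E h) \<eta> *\<^sub>R ?e (V a b 0 \<eta>)) \<partial>N)"
          by (rule integral_norm_bound)
        also have "\<dots> \<le> (\<integral>\<eta>. (indicat_real (?R h) \<eta> * exp (\<theta> * p * \<xi> h (\<pi> \<eta>)) + indicat_real (?R h) \<eta> * exp (\<theta> * p * V a b 0 \<eta>)) +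
            \<kappa> * (indicat_real (?E h) \<eta> * exp (\<theta> * p * V a b 0 \<eta>)) \<partial>N)"
        proof (rule integral_mono_AE)
          show "integrable N (\<lambda>\<eta>. norm (indicat_real (?E h) \<eta> *\<^sub>R ?e (\<xi> h (\<pi> \<eta>)) - indicat_real (?E h) \<eta> *\<^sub>R ?e (V a b 0 \<eta>)))"
            using iE[OF inte[OF h]] iE[OF iVe] by (intro integrable_norm Bochner_Integration.integrable_diff)
          show "integrable N (\<lambda>\<eta>. (indicat_real (?R h) \<eta> * exp (\<theta> * p * \<xi> h (\<pi> \<eta>)) + indicat_real (?R h) \<eta> * exp (\<theta> * p * V a b 0 \<eta>)) +
            \<kappa> * (indicat_real (?E h) \<eta> * exp (\<theta> * p * V a b 0 \<eta>)))"
            using iR[OF int\<theta>[OF h]] iR[OF iV\<theta>] iE[OF iV\<theta>]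
            by (intro Bochner_Integration.integrable_add integrable_mult_right) simp_all
          show "AE \<eta> in N. norm (indicat_real (?E h) \<eta> *\<^sub>R ?e (\<xi> h (\<pi> \<eta>)) - indicat_real (?E h) \<eta> *\<^sub>R ?e (V a b 0 \<eta>)) \<le>
            (indicat_real (?R h) \<eta> * exp (\<theta> * p * \<xi> h (\<pi> \<eta>)) + indicat_real (?R h) \<eta> * exp (\<theta> * p * V a b 0 \<eta>)) +
            \<kappa> * (indicat_real (?E h) \<eta> * exp (\<theta> * p * V a b 0 \<eta>))"
            using not_rare[OF h ab, of \<epsilon>]
          proof eventually_elim
            case (elim \<eta>)
            consider "\<eta> \<in> ?R h" | "\<eta> \<in> ?E h - ?R h" | "\<eta> \<notin> ?E h" by auto
            then show ?case
            proof cases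
              case 1
              then have "\<eta> \<in> ?E h" using rare_subset by blast
              have "norm (?e (\<xi> h (\<pi> \<eta>)) - ?e (V a b 0 \<eta>)) \<le> exp (\<theta> * p * \<xi> h (\<pi> \<eta>)) + exp (\<theta> * p * V a b 0 \<eta>)"
                using norm_triangle_ineq4[of "?e (\<xi> h (\<pi> \<eta>))" "?e (V a b 0 \<eta>)"] by (simp only: ne)
              moreover have "0 \<le> \<kappa> * exp (\<theta> * p * V a b 0 \<eta>)" using \<kappa> by simp
              ultimately show ?thesis using 1 \<open>\<eta> \<in> ?E h\<close> by simp
            next
              case 2
              then have dd: "\<bar>\<xi> h (\<pi> \<eta>) - V a b 0 \<eta>\<bar> \<le> 2 * \<epsilon>" using elim by blast
              have "?e (\<xi> h (\<pi> \<eta>)) - ?e (V a b 0 \<eta>) = ?e (V a b 0 \<eta>) * (?e (\<xi> h (\<pi> \<eta>) - V a b 0 \<eta>) - 1)"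
                by (simp add: right_diff_distrib exp_add[symmetric])
              then have "norm (?e (\<xi> h (\<pi> \<eta>)) - ?e (V a b 0 \<eta>)) = exp (\<theta> * p * V a b 0 \<eta>) * norm (?e (\<xi> h (\<pi> \<eta>) - V a b 0 \<eta>) - 1)"
                by (simp only: norm_mult ne)
              also have "\<dots> \<le> exp (\<theta> * p * V a b 0 \<eta>) * \<kappa>" by (intro mult_left_mono \<epsilon>(2)[OF dd]) simp
              finally show ?thesis using 2 by (simp add: mult.commute)
            next
              case 3
              then have "\<eta> \<notin> ?R h" using rare_subset by blast
              with 3 show ?thesis by simp
            qed
          qed
        qed
        also have "\<dots> = f1 h + f2 h + \<kappa> * (trans_prob h a b * A)"
        proof -
          have "(\<integral>\<eta>. indicat_real (?E h) \<eta> * exp (\<theta> * p * V a b 0 \<eta>) \<partial>N) = trans_prob h a b * A"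
            using J_V_integral[OF h, of "\<lambda>v. exp (\<theta> * p * v)" b] by (simp add: A_def)
          then show ?thesis
            using iR[OF int\<theta>[OF h]] iR[OF iV\<theta>] iE[OF iV\<theta>]
            by (subst Bochner_Integration.integral_add | simp add: f1_def f2_def)+
        qed
        finally have main: "norm (mgf z h a b - of_real (trans_prob h a b) * moment_gf N (V a b 0) z) \<le> f1 h + f2 h + \<kappa> * (trans_prob h a b * A)" .
        have "mgf z h a b /\<^sub>R h - of_real (trans_prob h a b / h) * moment_gf N (V a b 0) z =
            (mgf z h a b - of_real (trans_prob h a b) * moment_gf N (V a b 0) z) /\<^sub>R h"
          by (simp add: scaleR_conv_of_real divide_inverse algebra_simps)
        then have "norm (mgf z h a b /\<^sub>R h - of_real (trans_prob h a b / h) * moment_gf N (V a b 0) z) =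
            norm (mgf z h a b - of_real (trans_prob h a b) * moment_gf N (V a b 0) z) / h"
          using h by (simp add: divide_inverse mult.commute)
        also have "\<dots> \<le> (f1 h + f2 h + \<kappa> * (trans_prob h a b * A)) / h" using main h by (intro divide_right_mono) auto
        also have "\<dots> = f1 h / h + f2 h / h + \<kappa> * (trans_prob h a b / h * A)" by (simp add: add_divide_distrib)
        finally show ?case using elim by simp
      qed
    qed
    have "((\<lambda>h. (mgf z h a b /\<^sub>R h - of_real (trans_prob h a b / h) * moment_gf N (V a b 0) z) +
        of_real (trans_prob h a b / h) * moment_gf N (V a b 0) z) \<longlongrightarrow> 0 + of_real (q a b) * moment_gf N (V a b 0) z) (at_right 0)"
      by (intro tendsto_intros diff trans_prob_rate[OF ab])
    then show ?thesis by simp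
  qed
qed

end

section \<open>The matrix exponent and the option prices\<close>

context markov_additive_moment
begin

lemma nn_mgf_fraction_finite:
  assumes t: "0 < t" and \<theta>: "0 \<le> \<theta>" "\<theta> < 1"
  shows "nn_mgf (\<theta> * p) t \<alpha> \<beta> < \<infinity>"
proof -
  have t0: "0 \<le> t" using t by simp
  have "integrable (law t \<alpha> \<beta>) (\<lambda>x. exp (p * x))"
    using fin[OF t, of \<alpha> \<beta>] unfolding nn_mgf_def by (intro integrableI_bounded) auto
  then have "integrable (law t \<alpha> \<beta>) (\<lambda>x. exp (\<theta> * p * x))"
    by (intro exp_moment_split(1)[OF finite_measure_law[OF t0] _ _ \<theta>]) auto
  then have "(\<integral>\<^sup>+x. ennreal (norm (exp (\<theta> * p * x))) \<partial>law t \<alpha> \<beta>) < \<infinity>"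
    unfolding integrable_iff_bounded by blast
  then show ?thesis by (simp add: nn_mgf_def)
qed

lemma expectation_exp_eq_sum_mgf:
  assumes t: "0 < t" and \<theta>: "0 \<le> \<theta>" "\<theta> < 1" and z: "Re z = \<theta> * p"
  shows "(\<integral>\<omega>. exp (z * of_real (\<xi> t \<omega>)) \<partial>P \<alpha>) = (\<Sum>\<beta>\<in>UNIV. mgf z t \<alpha> \<beta>)"
proof -
  have t0: "0 \<le> t" using t by simp
  let ?e = "\<lambda>x::real. exp (z * of_real x) :: complex"
  let ?I = "\<lambda>\<beta>. (in_state t \<beta>)"
  have em: "?e \<in> borel_measurable borel" by measurable
  have "integrable (law t \<alpha> \<beta>) ?e" for \<beta>
    by (rule integrable_mgf) (use nn_mgf_fraction_finite[OF t \<theta>] z in simp)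
  then have int: "integrable (P \<alpha>) (\<lambda>\<omega>. indicat_real (?I \<beta>) \<omega> *\<^sub>R ?e (\<xi> t \<omega>))" for \<beta>
    using integrable_law_iff[OF t0 em] by blast
  have "(\<integral>\<omega>. ?e (\<xi> t \<omega>) \<partial>P \<alpha>) = (\<integral>\<omega>. (\<Sum>\<beta>\<in>UNIV. indicat_real (?I \<beta>) \<omega> *\<^sub>R ?e (\<xi> t \<omega>)) \<partial>P \<alpha>)"
  proof (rule Bochner_Integration.integral_cong[OF refl])
    fix \<omega> assume "\<omega> \<in> space (P \<alpha>)"
    then have "(\<Sum>\<beta>\<in>UNIV. indicat_real (?I \<beta>) \<omega>) = 1"
      by (simp add: space_P indicator_def of_bool_def sum.delta)
    then show "?e (\<xi> t \<omega>) = (\<Sum>\<beta>\<in>UNIV. indicat_real (?I \<beta>) \<omega> *\<^sub>R ?e (\<xi> t \<omega>))"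
      by (simp only: scaleR_sum_left[symmetric] scaleR_one)
  qed
  also have "\<dots> = (\<Sum>\<beta>\<in>UNIV. \<integral>\<omega>. indicat_real (?I \<beta>) \<omega> *\<^sub>R ?e (\<xi> t \<omega>) \<partial>P \<alpha>)"
    by (rule Bochner_Integration.integral_sum) (rule int)
  also have "\<dots> = (\<Sum>\<beta>\<in>UNIV. mgf z t \<alpha> \<beta>)" by (simp only: mgf_def integral_law[OF t0 em])
  finally show ?thesis .
qed

end

lemma moment_gf_distr_cong:
  assumes "X \<in> borel_measurable M" "Y \<in> borel_measurable N" "distr M borel X = distr N borel Y"
  shows "moment_gf M X z = moment_gf N Y z"
proof -
  have "moment_gf M X z = (\<integral>x. exp (z * complex_of_real x) \<partial>distr M borel X)"
    unfolding moment_gf_def using assms by (subst integral_distr) auto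
  also have "\<dots> = moment_gf N Y z"
    unfolding assms(3) moment_gf_def using assms by (subst integral_distr) auto
  finally show ?thesis .
qed

text \<open>The moment generating functions form a matrix semigroup whose generator has been computed entry by
  entry in terms of the copies; these have the same laws as the given Levy processes and jumps.\<close>

theorem mgf_eq_mat_exp:
  fixes M :: "'w measure" and P :: "'e::finite \<Rightarrow> 'w measure" and N :: "'e \<Rightarrow> 'v measure"
  assumes moment: "markov_additive_moment M P \<F> J \<xi> q p"
    and levy: "\<And>\<alpha>. levy_process B (L \<alpha>)"
    and jumps: "\<And>\<alpha> \<beta>. \<alpha> \<noteq> \<beta> \<Longrightarrow> U \<alpha> \<beta> \<in> borel_measurable B"
    and decomposition: "map_decomposition P J \<xi> B L U N \<pi>"
    and \<theta>: "0 \<le> \<theta>" "\<theta> < 1" and z: "Re z = \<theta> * p" and t: "0 < t"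
  shows "markov_additive_process.mgf M P J \<xi> z t \<alpha> \<beta> = mat_exp (t *\<^sub>R matrix_exponent q B L U z) $ \<alpha> $ \<beta>"
proof -
  interpret markov_additive_moment M P \<F> J \<xi> q p by (rule moment)
  have "\<exists>X V. decomposed_start M P \<F> J \<xi> q p a (N a) \<pi> X V \<and>
      (\<forall>\<beta> n. process_law (N a) borel (X \<beta> n) = process_law B borel (L \<beta>)) \<and>
      (\<forall>\<beta> \<gamma> n. \<beta> \<noteq> \<gamma> \<longrightarrow> distr (N a) borel (V \<beta> \<gamma> n) = distr B borel (U \<beta> \<gamma>))" for a
  proof -
    note d = decomposition[unfolded map_decomposition_def, THEN spec, of a]
    have N: "prob_space (N a)" "\<pi> \<in> N a \<rightarrow>\<^sub>M P a" "distr (N a) (P a) \<pi> = P a"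
      by (rule conjunct1[OF d] conjunct1[OF conjunct2[OF d]] conjunct1[OF conjunct2[OF conjunct2[OF d]]])+
    obtain X V where XV:
      "\<forall>\<beta> n. levy_process (N a) (X \<beta> n) \<and> process_law (N a) borel (X \<beta> n) = process_law B borel (L \<beta>)"
      "\<forall>\<beta> \<gamma> n. V \<beta> \<gamma> n \<in> borel_measurable (N a) \<and>
        (\<beta> \<noteq> \<gamma> \<longrightarrow> distr (N a) borel (V \<beta> \<gamma> n) = distr B borel (U \<beta> \<gamma>))"
      "prob_space.indep_sets (N a)
            (\<lambda>c. case c of
                Chain \<Rightarrow> process_sigma (N a) (count_space UNIV) (\<lambda>t \<eta>. J t (\<pi> \<eta>))
              | Levy \<beta> n \<Rightarrow> process_sigma (N a) borel (X \<beta> n)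
              | Jump \<beta> \<gamma> n \<Rightarrow> sets (vimage_algebra (space (N a)) (V \<beta> \<gamma> n) borel)) UNIV"
      "AE \<eta> in N a. \<forall>t\<ge>0.
             \<xi> t (\<pi> \<eta>) = additive_path (\<lambda>s. J s (\<pi> \<eta>)) (\<lambda>\<beta> n s. X \<beta> n s \<eta>) (\<lambda>\<beta> \<gamma> n. V \<beta> \<gamma> n \<eta>) t"
      using d by (elim conjE exE) (rule that)
    have "decomposed_start M P \<F> J \<xi> q p a (N a) \<pi> X V"
      by (intro decomposed_start.intro decomposed_start_axioms.intro moment)
         (rule N XV(1)[rule_format, THEN conjunct1] XV(2)[rule_format, THEN conjunct1] XV(3,4))+
    moreover have "\<forall>\<beta> n. process_law (N a) borel (X \<beta> n) = process_law B borel (L \<beta>)"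
      "\<forall>\<beta> \<gamma> n. \<beta> \<noteq> \<gamma> \<longrightarrow> distr (N a) borel (V \<beta> \<gamma> n) = distr B borel (U \<beta> \<gamma>)"
      using XV(1,2) by blast+
    ultimately show ?thesis by blast
  qed
  then obtain X V where D: "\<And>a. decomposed_start M P \<F> J \<xi> q p a (N a) \<pi> (X a) (V a)"
    and X: "\<And>a \<beta> n. process_law (N a) borel (X a \<beta> n) = process_law B borel (L \<beta>)"
    and V: "\<And>a \<beta> \<gamma> n. \<beta> \<noteq> \<gamma> \<Longrightarrow> distr (N a) borel (V a \<beta> \<gamma> n) = distr B borel (U \<beta> \<gamma>)"
    by metis
  have lower: "\<exists>K. \<forall>\<^sub>F h in at_right 0. 1 - K * h \<le> real_mgf p h a a" for a
  proof -
    interpret d: decomposed_start M P \<F> J \<xi> q p a "N a" \<pi> "X a" "V a" by (rule D)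
    obtain K where "\<forall>\<^sub>F h in at_right 0. 1 - K * h \<le> measure (P a) (const_event h a) * d.LM.moment h"
      using d.real_mgf_diag_lower by blast
    then have "\<forall>\<^sub>F h in at_right 0. 1 - K * h \<le> real_mgf p h a a"
      using right_pos by eventually_elim (rule order_trans[OF _ d.real_mgf_diag_ge])
    then show ?thesis by blast
  qed
  note upper = real_mgf_upper_bounds[OF lower]
  define F where "F = matrix_exponent q B L U z"
  \<comment> \<open>The Markov property concerns positive times, so the value at time 0 is put in by hand.\<close>
  define K where "K = (\<lambda>t. if t = 0 then mat 1 else (\<chi> a b. mgf z t a b))"
  have gen: "((\<lambda>h. (K h $ a $ b - mat 1 $ a $ b) /\<^sub>R h) \<longlongrightarrow> F $ a $ b) (at_right 0)" for a b
  proof -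
    interpret d: decomposed_start M P \<F> J \<xi> q p a "N a" \<pi> "X a" "V a" by (rule D)
    show ?thesis
    proof (cases "a = b")
      case True
      have "moment_gf (N a) (X a a 0 t) z = moment_gf B (L a t) z" if t: "0 \<le> t" for t
      proof (rule moment_gf_distr_cong)
        have Lm: "\<And>t. 0 \<le> t \<Longrightarrow> L a t \<in> borel_measurable B" using levy[of a] by (simp add: levy_process_def)
        show "X a a 0 t \<in> borel_measurable (N a)" "L a t \<in> borel_measurable B"
          using d.L.X_measurable[OF t] Lm[OF t] by auto
        show "distr (N a) borel (X a a 0 t) = distr B borel (L a t)"
          using process_law_distr[of "X a a 0" "N a" borel t, OF d.L.X_measurable t]
            process_law_distr[of "L a" B borel t, OF Lm t] X[of a a 0] by simp
      qed
      then have "laplace_exponent (N a) (X a a 0) z = laplace_exponent B (L a) z"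
        unfolding laplace_exponent_def by (intro arg_cong[where f=The] ext) simp
      then have Fab: "F $ a $ b = laplace_exponent (N a) (X a a 0) z - of_real (exit_rate a)"
        using True by (simp add: F_def matrix_exponent_def exit_rate_def)
      have "((\<lambda>h. (mgf z h a a - 1) /\<^sub>R h) \<longlongrightarrow> F $ a $ b) (at_right 0)"
        unfolding Fab by (rule d.mgf_diag_derivative[OF \<theta> z upper(1)])
      then show ?thesis
        by (rule tendsto_eventually_eq[OF _ eventually_mono[OF right_pos]]) (simp_all add: K_def True mat_def)
    next
      case False
      have "moment_gf (N a) (V a a b 0) z = moment_gf B (U a b) z"
        by (rule moment_gf_distr_cong[OF d.V_measurable jumps[OF False] V[OF False]])
      then have Fab: "F $ a $ b = of_real (q a b) * moment_gf (N a) (V a a b 0) z"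
        using False by (simp add: F_def matrix_exponent_def)
      have "((\<lambda>h. mgf z h a b /\<^sub>R h) \<longlongrightarrow> F $ a $ b) (at_right 0)"
        unfolding Fab by (rule d.mgf_offdiag_derivative[OF \<theta> z False upper(2)[OF False]])
      then show ?thesis
        by (rule tendsto_eventually_eq[OF _ eventually_mono[OF right_pos]]) (simp_all add: K_def False mat_def)
    qed
  qed
  have mult: "K (s + t) = K s ** K t" if "0 \<le> s" "0 \<le> t" for s t
  proof (cases "s = 0 \<or> t = 0")
    case True
    then show ?thesis by (auto simp: K_def)
  next
    case False
    with that have st: "0 < s" "0 < t" by auto
    have "mgf z (s + t) a c = (\<Sum>b\<in>UNIV. mgf z s a b * mgf z t b c)" for a c
      by (rule mgf_semigroup[OF st]) (use nn_mgf_fraction_finite[OF _ \<theta>] st z in simp_all)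
    then show ?thesis using st by (simp add: K_def matrix_matrix_mult_def vec_eq_iff)
  qed
  have "K t = mat_exp (t *\<^sub>R F)"
    by (rule matrix_semigroup_eq_mat_exp[OF mult _ gen]) (use t in \<open>simp_all add: K_def\<close>)
  then have "K t $ \<alpha> $ \<beta> = mat_exp (t *\<^sub>R F) $ \<alpha> $ \<beta>" by simp
  then show ?thesis using t by (simp add: K_def F_def)
qed

text \<open>A moment that is finite under the initial law \<open>\<nu>\<close> is finite from some state in its support, hence,
  by irreducibility, from every state and at every positive time.\<close>

lemma bind_pmf_integrable_imp_nn_mgf_finite:
  fixes \<nu> :: "'e::finite pmf"
  assumes chain: "markov_additive_chain M P \<F> J \<xi> q" and T: "0 < T"
    and int: "integrable (measure_pmf \<nu> \<bind> P) (\<lambda>\<omega>. exp (\<xi> T \<omega>) powr p)"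
  shows "markov_additive_moment M P \<F> J \<xi> q p"
proof -
  interpret markov_additive_chain M P \<F> J \<xi> q by (rule chain)
  have T0: "0 \<le> T" using T by simp
  have \<xi>M[measurable]: "\<xi> T \<in> borel_measurable M"
    using measurable_from_subalg[OF subalgebra[OF T0] \<xi>_measurable_\<F>[OF T0]] .
  have K: "P \<in> measurable (measure_pmf \<nu>) (subprob_algebra M)"
    by (auto simp: space_subprob_algebra sets_P intro: prob_space_imp_subprob_space prob)
  have "(\<integral>\<^sup>+\<omega>. ennreal (exp (p * \<xi> T \<omega>)) \<partial>(measure_pmf \<nu> \<bind> P)) < \<infinity>"
    using int unfolding integrable_iff_bounded by (simp add: exp_powr_real mult.commute)
  also have "(\<integral>\<^sup>+\<omega>. ennreal (exp (p * \<xi> T \<omega>)) \<partial>(measure_pmf \<nu> \<bind> P)) =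
      (\<integral>\<^sup>+\<alpha>. \<integral>\<^sup>+\<omega>. ennreal (exp (p * \<xi> T \<omega>)) \<partial>P \<alpha> \<partial>measure_pmf \<nu>)"
    by (rule nn_integral_bind[OF _ K]) measurable
  finally have "AE \<alpha> in measure_pmf \<nu>. (\<integral>\<^sup>+\<omega>. ennreal (exp (p * \<xi> T \<omega>)) \<partial>P \<alpha>) \<noteq> \<infinity>"
    by (intro nn_integral_PInf_AE) auto
  moreover obtain \<alpha>0 where "\<alpha>0 \<in> set_pmf \<nu>" using set_pmf_not_empty[of \<nu>] by blast
  ultimately have fin0: "(\<integral>\<^sup>+\<omega>. ennreal (exp (p * \<xi> T \<omega>)) \<partial>P \<alpha>0) < \<infinity>"
    by (auto simp: AE_measure_pmf_iff less_top)
  have "nn_mgf p T \<alpha>0 \<beta> < \<infinity>" for \<beta>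
  proof -
    have "nn_mgf p T \<alpha>0 \<beta> = (\<integral>\<^sup>+\<omega>. indicator (in_state T \<beta>) \<omega> * ennreal (exp (p * \<xi> T \<omega>)) \<partial>P \<alpha>0)"
      unfolding nn_mgf_def using T0 by (intro nn_integral_law) auto
    also have "\<dots> \<le> (\<integral>\<^sup>+\<omega>. ennreal (exp (p * \<xi> T \<omega>)) \<partial>P \<alpha>0)"
      by (rule nn_integral_mono) (auto simp: indicator_def)
    finally show ?thesis using fin0 by (rule le_less_trans)
  qed
  from nn_mgf_finite[OF T this] show ?thesis
    by unfold_locales
qed

text \<open>The payoff enters only through its Mellin transform, which is the same expression for calls and
  puts; the two differ in the half-plane where it converges.\<close>

lemma expected_payoff_mellin_map:
  fixes M :: "'w measure" and P :: "'e::finite \<Rightarrow> 'w measure" and N :: "'e \<Rightarrow> 'v measure"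
  assumes moment: "markov_additive_moment M P \<F> J \<xi> q p"
    and levy: "\<And>\<alpha>. levy_process B (L \<alpha>)"
    and jumps: "\<And>\<alpha> \<beta>. \<alpha> \<noteq> \<beta> \<Longrightarrow> U \<alpha> \<beta> \<in> borel_measurable B"
    and decomposition: "map_decomposition P J \<xi> B L U N \<pi>"
    and \<theta>: "0 \<le> \<theta>" "\<theta> < 1" and u: "Re u + 1 = \<theta> * p" and T: "0 < T"
    and pay: "(\<lambda>(y, k). pay y k) \<in> borel_measurable (borel \<Otimes>\<^sub>M borel)" "\<And>y k. 0 \<le> pay y k"
    and mellin: "\<And>y. 0 < y \<Longrightarrow> set_integrable lborel {0<..} (\<lambda>k. k powr (Re u - 1) * pay y k)"
      "\<And>y. 0 < y \<Longrightarrow> (LINT k:{0<..}|lborel. k powr (Re u - 1) * pay y k) = y powr (Re u + 1) / (Re u * (Re u + 1))"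
      "\<And>y. 0 < y \<Longrightarrow> (LINT k:{0<..}|lborel. of_real k powr (u - 1) * of_real (pay y k)) =
         (of_real y powr (u + 1) / (u * (u + 1)) :: complex)"
    and price: "\<And>k. price k = exp (- r * T) * (\<integral>\<omega>. pay (exp (\<xi> T \<omega>)) k \<partial>P \<alpha>)"
  shows "set_integrable lborel {0<..} (\<lambda>k. complex_of_real k powr (u - 1) * complex_of_real (price k))"
    and "(LINT k:{0<..}|lborel. complex_of_real k powr (u - 1) * complex_of_real (price k)) =
      complex_of_real (exp (- r * T)) / (u * (u + 1)) *
        (\<Sum>\<beta>\<in>UNIV. mat_exp (T *\<^sub>R matrix_exponent q B L U (u + 1)) $ \<alpha> $ \<beta>)"
proof -
  interpret markov_additive_moment M P \<F> J \<xi> q p by (rule moment)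
  interpret Pa: prob_space "P \<alpha>" by (rule prob)
  have T0: "0 \<le> T" using T by simp
  note [measurable] = \<xi>_measurable[OF T0]
  have z: "Re (u + 1) = \<theta> * p" using u by simp
  have m: "integrable (P \<alpha>) (\<lambda>\<omega>. exp (\<xi> T \<omega>) powr (Re u + 1))"
    using exp_moment_split(1)[OF Pa.finite_measure_axioms \<xi>_measurable[OF T0] exp_moment_integrable[OF T] \<theta>]
    by (simp add: exp_powr_real u mult.commute)
  have Ym: "(\<lambda>\<omega>. exp (\<xi> T \<omega>)) \<in> borel_measurable (P \<alpha>)" by measurable
  note E = expected_payoff_mellin[OF prob Ym _ pay mellin(1)
      _ _ m, where c="1 / (Re u * (Re u + 1))" and C="1 / (u * (u + 1))"]
  have E1: "set_integrable lborel {0<..} (\<lambda>k. of_real k powr (u - 1) * of_real (\<integral>\<omega>. pay (exp (\<xi> T \<omega>)) k \<partial>P \<alpha>))"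
    and E2: "(LINT k:{0<..}|lborel. of_real k powr (u - 1) * of_real (\<integral>\<omega>. pay (exp (\<xi> T \<omega>)) k \<partial>P \<alpha>)) =
      1 / (u * (u + 1)) * (\<integral>\<omega>. complex_of_real (exp (\<xi> T \<omega>)) powr (u + 1) \<partial>P \<alpha>)"
    by (rule E; use mellin in simp)+
  have split: "complex_of_real k powr (u - 1) * complex_of_real (price k) =
      complex_of_real (exp (- r * T)) * (of_real k powr (u - 1) * of_real (\<integral>\<omega>. pay (exp (\<xi> T \<omega>)) k \<partial>P \<alpha>))" for k
    by (simp only: price of_real_mult mult_ac)
  show "set_integrable lborel {0<..} (\<lambda>k. complex_of_real k powr (u - 1) * complex_of_real (price k))"
    unfolding split using E1 by (rule set_integrable_mult_right)
  have "complex_of_real (exp x) powr (u + 1) = exp ((u + 1) * of_real x)" for x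
    by (simp add: powr_def Ln_of_real)
  then have "(\<integral>\<omega>. complex_of_real (exp (\<xi> T \<omega>)) powr (u + 1) \<partial>P \<alpha>) = (\<Sum>\<beta>\<in>UNIV. mgf (u + 1) T \<alpha> \<beta>)"
    using expectation_exp_eq_sum_mgf[OF T \<theta> z] by simp
  also have "\<dots> = (\<Sum>\<beta>\<in>UNIV. mat_exp (T *\<^sub>R matrix_exponent q B L U (u + 1)) $ \<alpha> $ \<beta>)"
    by (intro sum.cong refl mgf_eq_mat_exp[OF moment levy jumps decomposition \<theta> z T])
  finally have "(\<integral>\<omega>. complex_of_real (exp (\<xi> T \<omega>)) powr (u + 1) \<partial>P \<alpha>) =
      (\<Sum>\<beta>\<in>UNIV. mat_exp (T *\<^sub>R matrix_exponent q B L U (u + 1)) $ \<alpha> $ \<beta>)" .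
  then show "(LINT k:{0<..}|lborel. complex_of_real k powr (u - 1) * complex_of_real (price k)) =
      complex_of_real (exp (- r * T)) / (u * (u + 1)) *
        (\<Sum>\<beta>\<in>UNIV. mat_exp (T *\<^sub>R matrix_exponent q B L U (u + 1)) $ \<alpha> $ \<beta>)"
    unfolding split set_integral_mult_right E2 by simp
qed

theorem proposition3p1:
  fixes M :: "'w measure" and P :: "'e::finite \<Rightarrow> 'w measure" and \<F> :: "real \<Rightarrow> 'w measure"
    and J :: "real \<Rightarrow> 'w \<Rightarrow> 'e" and \<xi> Y :: "real \<Rightarrow> 'w \<Rightarrow> real"
    and q :: "'e \<Rightarrow> 'e \<Rightarrow> real"
    and B :: "'b measure" and L :: "'e \<Rightarrow> real \<Rightarrow> 'b \<Rightarrow> real" and U :: "'e \<Rightarrow> 'e \<Rightarrow> 'b \<Rightarrow> real"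
    and N :: "'e \<Rightarrow> 'v measure" and \<pi> :: "'v \<Rightarrow> 'w"
    and \<nu> :: "'e pmf" and F :: "complex \<Rightarrow> complex ^ 'e ^ 'e" and T r :: real
  assumes MAP: "markov_additive_process M P \<F> J \<xi>"
    and chain: "ctmc_with_rates P \<F> J q" "irreducible_rates q"
    and levy: "\<And>\<alpha>. levy_process B (L \<alpha>)"
    and jumps: "\<And>\<alpha> \<beta>. \<alpha> \<noteq> \<beta> \<Longrightarrow> U \<alpha> \<beta> \<in> borel_measurable B"
      "\<And>\<alpha> \<beta>. \<alpha> \<noteq> \<beta> \<Longrightarrow> q \<alpha> \<beta> = 0 \<Longrightarrow> AE \<omega> in B. U \<alpha> \<beta> \<omega> = 0"
    and decomposition: "map_decomposition P J \<xi> B L U N \<pi>"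
    and F_def: "F = matrix_exponent q B L U"
    and Y_def: "Y = (\<lambda>t \<omega>. exp (\<xi> t \<omega>))"
    and T_pos: "0 < T"
  shows
    "(\<forall>s>0. integrable (measure_pmf \<nu> \<bind> P) (\<lambda>\<omega>. Y T \<omega> powr (1 + s)) \<longrightarrow>
       (\<forall>\<alpha> u. Re u \<in> {0<..<s} \<longrightarrow>
          set_integrable lborel {0<..}
            (\<lambda>k. complex_of_real k powr (u - 1) * complex_of_real (call_price P Y r T \<alpha> k)) \<and>
          (LINT k:{0<..}|lborel.
             complex_of_real k powr (u - 1) * complex_of_real (call_price P Y r T \<alpha> k)) =
          complex_of_real (exp (- r * T)) / (u * (u + 1)) *
            (\<Sum>\<beta>\<in>UNIV. mat_exp (T *\<^sub>R F (u + 1)) $ \<alpha> $ \<beta>))) \<and>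
     (\<forall>s>0. integrable (measure_pmf \<nu> \<bind> P) (\<lambda>\<omega>. Y T \<omega> powr (- s)) \<longrightarrow>
       (\<forall>\<alpha> u. Re u \<in> {-s<..<-1} \<longrightarrow>
          set_integrable lborel {0<..}
            (\<lambda>k. complex_of_real k powr (u - 1) * complex_of_real (put_price P Y r T \<alpha> k)) \<and>
          (LINT k:{0<..}|lborel.
             complex_of_real k powr (u - 1) * complex_of_real (put_price P Y r T \<alpha> k)) =
          complex_of_real (exp (- r * T)) / (u * (u + 1)) *
            (\<Sum>\<beta>\<in>UNIV. mat_exp (T *\<^sub>R F (u + 1)) $ \<alpha> $ \<beta>)))"
proof -
  have chain': "markov_additive_chain M P \<F> J \<xi> q"
    by (intro markov_additive_chain.intro markov_additive_chain_axioms.intro MAP chain)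
  have moment: "markov_additive_moment M P \<F> J \<xi> q p"
    if "integrable (measure_pmf \<nu> \<bind> P) (\<lambda>\<omega>. Y T \<omega> powr p)" for p
    by (rule bind_pmf_integrable_imp_nn_mgf_finite[OF chain' T_pos]) (use that in \<open>simp add: Y_def\<close>)
  have call: "set_integrable lborel {0<..}
            (\<lambda>k. complex_of_real k powr (u - 1) * complex_of_real (call_price P Y r T \<alpha> k)) \<and>
          (LINT k:{0<..}|lborel.
             complex_of_real k powr (u - 1) * complex_of_real (call_price P Y r T \<alpha> k)) =
          complex_of_real (exp (- r * T)) / (u * (u + 1)) *
            (\<Sum>\<beta>\<in>UNIV. mat_exp (T *\<^sub>R F (u + 1)) $ \<alpha> $ \<beta>)"
    if s: "0 < s" and int: "integrable (measure_pmf \<nu> \<bind> P) (\<lambda>\<omega>. Y T \<omega> powr (1 + s))"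
      and u: "Re u \<in> {0<..<s}" for s \<alpha> u
  proof -
    \<comment> \<open>The moment that is assumed has order \<open>1 + s\<close>, the one in the formula has order \<open>Re u + 1\<close>.\<close>
    have \<theta>: "0 \<le> (Re u + 1) / (1 + s)" "(Re u + 1) / (1 + s) < 1" "Re u + 1 = (Re u + 1) / (1 + s) * (1 + s)"
      using s u by (auto simp: field_simps)
    have u0: "0 < Re u" using u by simp
    have pm: "(\<lambda>(y, k). max (y - k) 0) \<in> borel_measurable (borel \<Otimes>\<^sub>M borel :: (real \<times> real) measure)" by measurable
    have pr: "call_price P Y r T \<alpha> k = exp (- r * T) * (\<integral>\<omega>. max (exp (\<xi> T \<omega>) - k) 0 \<partial>P \<alpha>)" for k
      by (simp add: call_price_def Y_def)
    note E = expected_payoff_mellin_map[OF moment[OF int] levy jumps(1) decomposition \<theta> T_pos pm _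
        call_payoff_mellin(1)[OF _ u0] call_payoff_mellin(2)[OF _ u0] call_payoff_mellin(3)[OF _ u0] pr]
    show ?thesis unfolding F_def by (intro conjI E) simp_all
  qed
  have put: "set_integrable lborel {0<..}
            (\<lambda>k. complex_of_real k powr (u - 1) * complex_of_real (put_price P Y r T \<alpha> k)) \<and>
          (LINT k:{0<..}|lborel.
             complex_of_real k powr (u - 1) * complex_of_real (put_price P Y r T \<alpha> k)) =
          complex_of_real (exp (- r * T)) / (u * (u + 1)) *
            (\<Sum>\<beta>\<in>UNIV. mat_exp (T *\<^sub>R F (u + 1)) $ \<alpha> $ \<beta>)"
    if s: "0 < s" and int: "integrable (measure_pmf \<nu> \<bind> P) (\<lambda>\<omega>. Y T \<omega> powr (- s))"
      and u: "Re u \<in> {-s<..<-1}" for s \<alpha> u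
  proof -
    \<comment> \<open>Both orders \<open>- s\<close> and \<open>Re u + 1\<close> are negative, with \<open>- s < 1 - s < Re u + 1\<close>.\<close>
    have \<theta>: "0 \<le> (Re u + 1) / (- s)" "(Re u + 1) / (- s) < 1" "Re u + 1 = (Re u + 1) / (- s) * (- s)"
      using s u by (auto simp: field_simps)
    have u0: "Re u < -1" using u by simp
    have pm: "(\<lambda>(y, k). max (k - y) 0) \<in> borel_measurable (borel \<Otimes>\<^sub>M borel :: (real \<times> real) measure)" by measurable
    have pr: "put_price P Y r T \<alpha> k = exp (- r * T) * (\<integral>\<omega>. max (k - exp (\<xi> T \<omega>)) 0 \<partial>P \<alpha>)" for k
      by (simp add: put_price_def Y_def)
    note E = expected_payoff_mellin_map[OF moment[OF int] levy jumps(1) decomposition \<theta> T_pos pm _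
        put_payoff_mellin(1)[OF _ u0] put_payoff_mellin(2)[OF _ u0] put_payoff_mellin(3)[OF _ u0] pr]
    show ?thesis unfolding F_def by (intro conjI E) simp_all
  qed
  show ?thesis using call put by blast
qed

end
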